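(* Let $\delta, \alpha > 0$ be real numbers and let $d \geq 2$ be an integer. Let $p = p(n) = \omega(1)/n$, i.e. $p = f(n)/n$ for some function $f$ with $f(n)\to\infty$. For each $n$, let $T$ be an $n$-vertex tree with maximum degree at most $d$, and let $G$ be any graph on vertex set $[n]$ with minimum degree at least $\delta n$. Let $\Gamma = G \cup R$ where $R \sim \mathbb{G}(n,p)$ on the same vertex set $[n]$, and let $\psi$ be a $(1+\alpha)n$-uniform colouring of $\Gamma$. Then asymptotically almost surely $(\Gamma,\psi)$ admits a $\psi$-rainbow copy of $T$ (a spanning subgraph of $\Gamma$ isomorphic to $T$ whose edges all receive distinct colours).
   Context: $\mathbb{G}(n,p)$ denotes the binomial random graph on vertex set $[n]$ in which each pair is an edge independently with probability $p$. An edge colouring of a graph is $k$-uniform if the colour of every edge is chosen independently and uniformly at random from a fixed palette of size $k$. A subgraph is $\psi$-rainbow if all its edges have pairwise distinct colours under $\psi$. "Asymptotically almost surely" means with probability tending to $1$ as $n\to\infty$; the statement holds for every choice of the (deterministic) seed graph $G$. *)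

theory Defs
  imports "HOL-Probability.Probability"
begin

datatype 'a ugraph = Graph (verts: "'a set") (edges: "'a set set")

definition all_pairs :: "'a set \<Rightarrow> 'a set set" where
  "all_pairs V = {e. e \<subseteq> V \<and> card e = 2}"

definition simple_graph :: "'a ugraph \<Rightarrow> bool" where
  "simple_graph G \<longleftrightarrow> finite (verts G) \<and> edges G \<subseteq> all_pairs (verts G)"

definition degree :: "'a ugraph \<Rightarrow> 'a \<Rightarrow> nat" where
  "degree G v = card {e \<in> edges G. v \<in> e}"

text \<open>The minimum and maximum degree are meaningful only for graphs with a nonempty finite
  vertex set.\<close>

definition min_degree :: "'a ugraph \<Rightarrow> nat" where
  "min_degree G = Min (degree G ` verts G)"

definition max_degree :: "'a ugraph \<Rightarrow> nat" where
  "max_degree G = Max (degree G ` verts G)"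

definition connected_graph :: "'a ugraph \<Rightarrow> bool" where
  "connected_graph G \<longleftrightarrow>
     verts G \<noteq> {} \<and> (\<forall>u\<in>verts G. \<forall>v\<in>verts G. (u, v) \<in> {(x, y). {x, y} \<in> edges G}\<^sup>*)"

definition is_cycle :: "'a ugraph \<Rightarrow> 'a list \<Rightarrow> bool" where
  "is_cycle G xs \<longleftrightarrow> length xs \<ge> 3 \<and> distinct xs \<and>
     (\<forall>i<length xs. {xs ! i, xs ! (Suc i mod length xs)} \<in> edges G)"

definition is_tree :: "'a ugraph \<Rightarrow> bool" where
  "is_tree T \<longleftrightarrow> simple_graph T \<and> connected_graph T \<and> (\<nexists>xs. is_cycle T xs)"

definition graph_union :: "'a ugraph \<Rightarrow> 'a ugraph \<Rightarrow> 'a ugraph" where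
  "graph_union G H = Graph (verts G \<union> verts H) (edges G \<union> edges H)"

definition spanning_subgraph :: "'a ugraph \<Rightarrow> 'a ugraph \<Rightarrow> bool" where
  "spanning_subgraph H G \<longleftrightarrow> simple_graph H \<and> verts H = verts G \<and> edges H \<subseteq> edges G"

definition graph_isomorphic :: "'a ugraph \<Rightarrow> 'b ugraph \<Rightarrow> bool" where
  "graph_isomorphic G H \<longleftrightarrow>
     (\<exists>\<phi>. bij_betw \<phi> (verts G) (verts H) \<and> edges H = (\<lambda>e. \<phi> ` e) ` edges G)"

definition rainbow :: "('a set \<Rightarrow> 'c) \<Rightarrow> 'a ugraph \<Rightarrow> bool" where
  "rainbow \<psi> H \<longleftrightarrow> inj_on \<psi> (edges H)"

definition has_spanning_rainbow_copy :: "'a ugraph \<Rightarrow> ('a set \<Rightarrow> 'c) \<Rightarrow> 'b ugraph \<Rightarrow> bool" where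
  "has_spanning_rainbow_copy \<Gamma> \<psi> T \<longleftrightarrow>
     (\<exists>H. spanning_subgraph H \<Gamma> \<and> graph_isomorphic T H \<and> rainbow \<psi> H)"

definition binomial_random_graph :: "nat \<Rightarrow> real \<Rightarrow> nat ugraph pmf" where
  "binomial_random_graph n p =
     map_pmf (\<lambda>b. Graph {1..n} {e \<in> all_pairs {1..n}. b e})
       (Pi_pmf (all_pairs {1..n}) False (\<lambda>_. bernoulli_pmf p))"

text \<open>The palette is \<open>{1..k}\<close>; sets that are not edges receive the dummy value \<open>0\<close>.\<close>

definition uniform_colouring :: "nat \<Rightarrow> 'a ugraph \<Rightarrow> ('a set \<Rightarrow> nat) pmf" where
  "uniform_colouring k \<Gamma> = Pi_pmf (edges \<Gamma>) 0 (\<lambda>_. pmf_of_set {1..k})"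

text \<open>The joint law of \<open>(\<Gamma>, \<psi>)\<close>: the random graph is exposed first, and then the edges of the
  union with the seed graph are coloured with fresh randomness.\<close>

definition coloured_perturbed_graph ::
    "nat ugraph \<Rightarrow> nat \<Rightarrow> real \<Rightarrow> nat \<Rightarrow> (nat ugraph \<times> (nat set \<Rightarrow> nat)) pmf" where
  "coloured_perturbed_graph G n p k =
     bind_pmf (binomial_random_graph n p)
       (\<lambda>R. let \<Gamma> = graph_union G R in map_pmf (\<lambda>\<psi>. (\<Gamma>, \<psi>)) (uniform_colouring k \<Gamma>))"

end

theory Submission
  imports Defs "HOL-Real_Asymp.Real_Asymp"
begin

text \<open>Colours are removed first. Replace, one pair at a time, a randomly coloured edge by a plain edge
  that is kept with probability smaller by the factor \<open>(k - n) / k\<close>, \<open>k\<close> being the palette size. Any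
  copy of \<open>T\<close> that needs this edge forbids at most \<open>n\<close> colours, so no replacement increases the
  probability of a rainbow copy. It remains to find \<open>T\<close> in \<open>G' \<union> R\<close>, where \<open>G'\<close> is a random sparsification
  of \<open>G\<close> of linear minimum degree and \<open>R\<close> is a sparse random graph with \<open>n p \<rightarrow> \<infinity>\<close>.

  A gadget is a path \<open>(a, y, b)\<close> of \<open>R\<close>. It serves \<open>(w, x)\<close> if \<open>w\<close> is adjacent to \<open>a\<close> and \<open>b\<close> and \<open>x\<close> to \<open>y\<close>
  in \<open>G'\<close>: when a tree vertex \<open>s\<close> with neighbours on \<open>a\<close> and \<open>b\<close> sits on \<open>y\<close>, an unused vertex \<open>w\<close> can take over
  \<open>s\<close>, and \<open>y\<close> is free to become a new neighbour of \<open>x\<close>. Linearly many disjoint gadgets such that every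
  pair is served linearly often exist with high probability: choose them greedily with respect to the
  weights \<open>2^-(times served)\<close>; getting stuck means that \<open>R\<close> avoids quadratically many pairs, which is so
  unlikely that it survives a union bound over all possible histories.

  The gadgets are planted in a small branch of \<open>T\<close> embedded greedily in \<open>G'\<close>, around vertices with at
  most one child. The rest of \<open>T\<close> is cut into pieces of bounded size, and each piece is attached by one
  absorption: its root goes to the centre \<open>y\<close> of a gadget, its other vertices are embedded in \<open>R\<close>, which
  joins any two linear sets. The last few vertices are absorbed one by one.\<close>

section \<open>Rooted trees\<close>

text \<open>Since \<open>n p\<close> may grow arbitrarily slowly, \<open>R\<close> can have isolated
  vertices, and \<open>G'\<close> alone can be disconnected; neither carries a spanning tree by
  itself. Absorption divides the labour: a vertex \<open>w\<close> enters through edges of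
  \<open>G'\<close> only, while \<open>R\<close> has to join linear sets and to contain gadgets.

  The gadgets are chosen adaptively, which leaves no fresh randomness; hence the union bound over
  histories. It is affordable because a history is charged the probability of its own edges. With
  \<open>x = n p\<close>, disjoint gadgets, indexed by their centres, cost
  \<open>(1 + x^2)^n\<close> and the recorded neighbours \<open>(1 + x)^n\<close>, together
  \<open>exp(O(n log x))\<close>, whereas quadratically many absent pairs give
  \<open>exp(- \<Omega>(x n))\<close>. The latter wins once \<open>x\<close> is a large constant.

  The weights turn an average gain into one for every pair: each gadget removes a constant fraction
  of the total weight, so after linearly many the total is below the weight of any pair served too
  rarely.\<close>

locale rooted_tree =
  fixes V :: "'a set" and root :: 'a and par :: "'a \<Rightarrow> 'a" and rk :: "'a \<Rightarrow> nat"
  assumes finV: "finite V" and rootV: "root \<in> V"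
    and parV: "\<And>v. v \<in> V - {root} \<Longrightarrow> par v \<in> V"
    and rk_par: "\<And>v. v \<in> V - {root} \<Longrightarrow> rk (par v) < rk v"
begin

definition children :: "'a \<Rightarrow> 'a set" where
  "children z = {v \<in> V - {root}. par v = z}"

text \<open>Vertex sets of the subtrees that contain the root. Partial embeddings live on such sets:
  a new vertex whose parent lies in the set is joined to it by that one tree edge only.\<close>

definition parent_closed :: "'a set \<Rightarrow> bool" where
  "parent_closed A \<longleftrightarrow> A \<subseteq> V \<and> root \<in> A \<and> (\<forall>v\<in>A - {root}. par v \<in> A)"

definition up :: "('a \<times> 'a) set" where
  "up = {(v, par v) |v. v \<in> V - {root}}"

definition desc :: "'a \<Rightarrow> 'a set" where
  "desc x = {v \<in> V. (v, x) \<in> up\<^sup>*}"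

lemma finite_children [simp]: "finite (children z)"
  unfolding children_def using finV by auto

lemma up_rk: "(v, x) \<in> up\<^sup>* \<Longrightarrow> rk x \<le> rk v \<and> (v = x \<or> rk x < rk v)"
proof (induction rule: rtrancl_induct)
  case (step y z)
  then have "rk z < rk y" using rk_par unfolding up_def by auto
  then show ?case using step.IH by auto
qed simp

lemma desc_self: "x \<in> V \<Longrightarrow> x \<in> desc x"
  by (simp add: desc_def)

lemma desc_subset: "desc x \<subseteq> V"
  by (auto simp: desc_def)

lemma finite_desc [simp]: "finite (desc x)"
  using finite_subset[OF desc_subset finV] .

lemma desc_root: "desc root = V"
proof -
  have "(v, root) \<in> up\<^sup>*" if "v \<in> V" for v
    using that
  proof (induction "rk v" arbitrary: v rule: less_induct)
    case less
    show ?case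
    proof (cases "v = root")
      case False
      then have "(v, par v) \<in> up" "rk (par v) < rk v" "par v \<in> V"
        using less.prems parV rk_par unfolding up_def by auto
      then show ?thesis using less.hyps[of "par v"] by (meson converse_rtrancl_into_rtrancl)
    qed simp
  qed
  then show ?thesis by (auto simp: desc_def)
qed

lemma desc_unfold:
  assumes "x \<in> V"
  shows "desc x = insert x (\<Union>c\<in>children x. desc c)"
proof
  show "desc x \<subseteq> insert x (\<Union>c\<in>children x. desc c)"
  proof
    fix v assume "v \<in> desc x"
    then have v: "v \<in> V" "(v, x) \<in> up\<^sup>*" by (auto simp: desc_def)
    show "v \<in> insert x (\<Union>c\<in>children x. desc c)"
    proof (cases "v = x")
      case False
      with v(2) obtain c where c: "(v, c) \<in> up\<^sup>*" "(c, x) \<in> up"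
        by (metis rtranclE)
      then have "c \<in> children x" by (auto simp: up_def children_def)
      moreover have "v \<in> desc c" using c v by (auto simp: desc_def)
      ultimately show ?thesis by blast
    qed simp
  qed
next
  show "insert x (\<Union>c\<in>children x. desc c) \<subseteq> desc x"
  proof -
    have "v \<in> desc x" if "c \<in> children x" "v \<in> desc c" for c v
    proof -
      have "(c, x) \<in> up" using that by (auto simp: children_def up_def)
      then show ?thesis using that by (auto simp: desc_def intro: rtrancl_into_rtrancl)
    qed
    then show ?thesis using desc_self[OF assms] by auto
  qed
qed

lemma desc_par: "v \<in> desc x \<Longrightarrow> v \<noteq> x \<Longrightarrow> v \<noteq> root \<and> par v \<in> desc x"
proof -
  assume "v \<in> desc x" "v \<noteq> x"
  then have v: "v \<in> V" "(v, x) \<in> up\<^sup>*" by (auto simp: desc_def)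
  then obtain u where "(v, u) \<in> up" "(u, x) \<in> up\<^sup>*"
    using \<open>v \<noteq> x\<close> by (metis converse_rtranclE)
  then show ?thesis using parV by (auto simp: up_def desc_def)
qed

lemma desc_child: "u \<in> V - {root} \<Longrightarrow> par u \<in> desc x \<Longrightarrow> u \<in> desc x"
  unfolding desc_def up_def by (auto intro: converse_rtrancl_into_rtrancl)

lemma desc_child_psubset:
  assumes "x \<in> V" "c \<in> children x"
  shows "desc c \<subset> desc x"
proof -
  have "x \<notin> desc c"
  proof
    assume "x \<in> desc c"
    then have "rk c \<le> rk x" using up_rk by (auto simp: desc_def)
    moreover have "rk x < rk c" using assms rk_par by (auto simp: children_def)
    ultimately show False by simp
  qed
  then show ?thesis using desc_unfold[OF assms(1)] assms by auto
qed

text \<open>Descend as long as some child has at least \<open>N\<close> descendants. Where this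
  stops, each of the at most \<open>d\<close> children has at most \<open>N - 1\<close>, so the
  branch has at most \<open>1 + d * (N - 1)\<close> vertices.\<close>

lemma exists_branch:
  assumes deg: "\<And>z. z \<in> V \<Longrightarrow> card (children z) \<le> d"
    and "d \<ge> 1" "N \<ge> 1" "x0 \<in> V" "card (desc x0) \<ge> N"
  shows "\<exists>x\<in>desc x0. N \<le> card (desc x) \<and> card (desc x) \<le> d * N"
  using assms(4,5)
proof (induction "card (desc x0)" arbitrary: x0 rule: less_induct)
  case less
  show ?case
  proof (cases "\<exists>c\<in>children x0. card (desc c) \<ge> N")
    case True
    then obtain c where c: "c \<in> children x0" "card (desc c) \<ge> N" by blast
    have "desc c \<subset> desc x0" using desc_child_psubset[OF less.prems(1) c(1)] .
    then have "card (desc c) < card (desc x0)" by (simp add: psubset_card_mono)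
    moreover have "c \<in> V" using c by (auto simp: children_def)
    ultimately obtain x where "x \<in> desc c" "N \<le> card (desc x)" "card (desc x) \<le> d * N"
      using less.hyps c by blast
    then show ?thesis using \<open>desc c \<subset> desc x0\<close> by blast
  next
    case False
    have "card (desc x0) \<le> 1 + card (\<Union>c\<in>children x0. desc c)"
      unfolding desc_unfold[OF less.prems(1)]
      by (simp add: card_insert_if)
    also have "card (\<Union>c\<in>children x0. desc c) \<le> (\<Sum>c\<in>children x0. card (desc c))"
      by (rule card_UN_le) simp
    also have "(\<Sum>c\<in>children x0. card (desc c)) \<le> (\<Sum>c\<in>children x0. N - 1)"
      using False by (intro sum_mono) auto
    also have "\<dots> \<le> d * (N - 1)" using deg[OF less.prems(1)] by simp
    finally have "card (desc x0) \<le> 1 + d * (N - 1)" by simp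
    also have "\<dots> \<le> d * N" using \<open>d \<ge> 1\<close> \<open>N \<ge> 1\<close> by (cases N) auto
    finally show ?thesis using less.prems desc_self by blast
  qed
qed

lemma parent_closed_sub:
  assumes "parent_closed A"
  shows "rooted_tree A root par rk"
  using assms unfolding parent_closed_def
  by unfold_locales (auto intro: finite_subset[OF _ finV] rk_par)

lemma parent_closed_V: "parent_closed V"
  unfolding parent_closed_def using rootV parV by auto

lemma parent_closed_exit:
  assumes "parent_closed A" "A \<noteq> V"
  shows "\<exists>x\<in>V - A. par x \<in> A"
proof -
  have "V - A \<noteq> {}" using assms by (auto simp: parent_closed_def)
  then obtain x where x: "x \<in> V - A" "\<And>y. y \<in> V - A \<Longrightarrow> rk x \<le> rk y"
    using ex_has_least_nat[of "\<lambda>x. x \<in> V - A" _ rk] by blast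
  have "x \<noteq> root" using x assms by (auto simp: parent_closed_def)
  then have "par x \<in> A" using x parV[of x] rk_par[of x] by fastforce
  then show ?thesis using x by blast
qed

lemma parent_closed_insert:
  assumes "parent_closed A" "x \<in> V" "par x \<in> A"
  shows "parent_closed (insert x A)"
  using assms by (auto simp: parent_closed_def)

end

section \<open>Rooting a connected acyclic graph\<close>

lemma rtrancl_distinct_path:
  assumes "(x, y) \<in> r\<^sup>*"
  shows "\<exists>xs. xs \<noteq> [] \<and> hd xs = x \<and> last xs = y \<and> distinct xs \<and> successively (\<lambda>a b. (a, b) \<in> r) xs"
  using assms
proof (induction rule: converse_rtrancl_induct)
  case base
  then show ?case by (intro exI[of _ "[y]"]) auto
next
  case (step x z)
  then obtain xs where xs: "xs \<noteq> []" "hd xs = z" "last xs = y" "distinct xs"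
    "successively (\<lambda>a b. (a, b) \<in> r) xs" by blast
  show ?case
  proof (cases "x \<in> set xs")
    case False
    then show ?thesis using xs step.hyps
      by (intro exI[of _ "x # xs"]) (auto simp: successively_Cons)
  next
    case True
    then obtain as bs where ab: "xs = as @ x # bs" by (meson split_list)
    show ?thesis using xs unfolding ab
      by (intro exI[of _ "x # bs"]) (auto simp: successively_append_iff)
  qed
qed

text \<open>A path inside \<open>A\<close> between two distinct neighbours of \<open>u\<close> would
  close up to a cycle through \<open>u\<close>.\<close>

lemma tree_unique_neighbour:
  assumes T: "\<nexists>xs. is_cycle T xs"
    and conn: "(v, v') \<in> {(x, y). x \<in> A \<and> y \<in> A \<and> {x, y} \<in> edges T}\<^sup>*"
    and "{u, v} \<in> edges T" "{u, v'} \<in> edges T" "u \<notin> A" "v \<in> A" "v' \<in> A"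
  shows "v = v'"
proof (rule ccontr)
  assume "v \<noteq> v'"
  define r where "r = {(x, y). x \<in> A \<and> y \<in> A \<and> {x, y} \<in> edges T}"
  obtain xs where xs: "xs \<noteq> []" "hd xs = v" "last xs = v'" "distinct xs"
    "successively (\<lambda>a b. (a, b) \<in> r) xs"
    using rtrancl_distinct_path[OF conn[folded r_def]] by blast
  have len: "length xs \<ge> 2" using xs \<open>v \<noteq> v'\<close>
    by (cases xs; cases "tl xs") auto
  have nth: "(xs ! i, xs ! Suc i) \<in> r" if "Suc i < length xs" for i
    using xs(5) that by (simp add: successively_conv_nth)
  have sub: "set xs \<subseteq> A"
  proof
    fix z assume "z \<in> set xs"
    then obtain i where i: "i < length xs" "z = xs ! i" by (auto simp: in_set_conv_nth)
    show "z \<in> A"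
    proof (cases "Suc i < length xs")
      case True then show ?thesis using nth i by (auto simp: r_def)
    next
      case False
      then have "z = v'" using i xs by (metis Suc_lessI diff_Suc_1 last_conv_nth)
      then show ?thesis using assms by simp
    qed
  qed
  have "is_cycle T (u # xs)"
    unfolding is_cycle_def
  proof (intro conjI allI impI)
    show "3 \<le> length (u # xs)" using len by simp
    show "distinct (u # xs)" using xs sub assms by auto
    fix i assume i: "i < length (u # xs)"
    show "{(u # xs) ! i, (u # xs) ! (Suc i mod length (u # xs))} \<in> edges T"
    proof (cases i)
      case 0
      then show ?thesis using xs(1,2) assms(3) by (simp add: hd_conv_nth)
    next
      case (Suc j)
      show ?thesis
      proof (cases "Suc j < length xs")
        case True
        then have "Suc i mod length (u # xs) = Suc (Suc j)" using Suc by simp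
        then show ?thesis using nth[OF True] Suc by (simp add: r_def)
      next
        case False
        then have j: "Suc j = length xs" using i Suc by simp
        then have "Suc i mod length (u # xs) = 0" using Suc by simp
        moreover have "xs ! j = v'" using xs j by (metis diff_Suc_1 last_conv_nth)
        ultimately show ?thesis using Suc assms(4) by (simp add: insert_commute)
      qed
    qed
  qed
  then show False using T by blast
qed

text \<open>Grow a connected set \<open>A\<close> from \<open>r\<close>. A vertex outside with a
  neighbour in \<open>A\<close> has only that one, by \<open>tree_unique_neighbour\<close>, so the
  edges inside \<open>A\<close> remain exactly the parent edges. Connectivity inside
  \<open>A\<close> is part of the invariant because that lemma asks for it.\<close>

lemma tree_rooted:
  assumes T: "is_tree T" and r: "r \<in> verts T"
  shows "\<exists>par rk. rooted_tree (verts T) r par rk \<and> edges T = (\<lambda>v. {v, par v}) ` (verts T - {r})"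
proof -
  let ?V = "verts T" and ?E = "edges T"
  have fin: "finite ?V" and sub: "?E \<subseteq> all_pairs ?V" and conn: "connected_graph T"
    and cyc: "\<nexists>xs. is_cycle T xs"
    using T by (auto simp: is_tree_def simple_graph_def)
  have loop: "{x, x} \<notin> ?E" for x using sub by (auto simp: all_pairs_def)
  let ?r = "\<lambda>A. {(x, y). x \<in> A \<and> y \<in> A \<and> {x, y} \<in> ?E}"
  have ex: "\<exists>A par rk. A \<subseteq> ?V \<and> card A = Suc k \<and> rooted_tree A r par rk \<and>
      {e \<in> ?E. e \<subseteq> A} = (\<lambda>v. {v, par v}) ` (A - {r}) \<and> (\<forall>x\<in>A. \<forall>y\<in>A. (x, y) \<in> (?r A)\<^sup>*)"
    if "Suc k \<le> card ?V" for k
    using that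
  proof (induction k)
    case 0
    have "{e \<in> ?E. e \<subseteq> {r}} = {}"
    proof -
      have "e \<notin> ?E" if "e \<subseteq> {r}" for e
      proof -
        have "card e \<le> 1" using card_mono[OF _ that] by simp
        then show ?thesis using sub by (auto simp: all_pairs_def)
      qed
      then show ?thesis by blast
    qed
    then show ?case using r
      by (intro exI[of _ "{r}"] exI[of _ id] exI[of _ "\<lambda>_. 0"]) (auto simp: rooted_tree_def)
  next
    case (Suc k)
    then obtain A par rk where A: "A \<subseteq> ?V" "card A = Suc k" "rooted_tree A r par rk"
      "{e \<in> ?E. e \<subseteq> A} = (\<lambda>v. {v, par v}) ` (A - {r})"
      "\<forall>x\<in>A. \<forall>y\<in>A. (x, y) \<in> (?r A)\<^sup>*" by auto
    interpret rooted_tree A r par rk by fact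
    have "A \<noteq> ?V" using A(2) Suc.prems by auto
    then obtain z where z: "z \<in> ?V" "z \<notin> A" using A(1) by blast
    have "(r, z) \<in> {(x, y). {x, y} \<in> ?E}\<^sup>*" using conn z r by (auto simp: connected_graph_def)
    then have "\<exists>v u. v \<in> A \<and> u \<notin> A \<and> {u, v} \<in> ?E"
      using z(2)
    proof (induction rule: rtrancl_induct)
      case base then show ?case using rootV by simp
    next
      case (step y z)
      show ?case
      proof (cases "y \<in> A")
        case True
        moreover have "{z, y} \<in> ?E" using step.hyps(2) by (simp add: insert_commute)
        ultimately show ?thesis using step.prems by blast
      next
        case False then show ?thesis using step.IH by blast
      qed
    qed
    then obtain v u where uv: "v \<in> A" "u \<notin> A" "{u, v} \<in> ?E" by blast
    have uV: "u \<in> ?V" using uv(3) sub by (auto simp: all_pairs_def)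
    have uniq: "v' = v" if "v' \<in> A" "{u, v'} \<in> ?E" for v'
      using tree_unique_neighbour[OF cyc _ uv(3) that(2) uv(2) uv(1) that(1)] A(5) uv(1) that(1) by blast
    let ?A = "insert u A" and ?par = "par(u := v)" and ?rk = "rk(u := Suc (rk v))"
    have "u \<noteq> r" using uv rootV by auto
    have 1: "rooted_tree ?A r ?par ?rk"
      using finV rootV parV rk_par uv \<open>u \<noteq> r\<close> by unfold_locales auto
    have 2: "{e \<in> ?E. e \<subseteq> ?A} = (\<lambda>v. {v, ?par v}) ` (?A - {r})"
    proof -
      have "{e \<in> ?E. e \<subseteq> ?A} = insert {u, v} {e \<in> ?E. e \<subseteq> A}"
      proof
        show "{e \<in> ?E. e \<subseteq> ?A} \<subseteq> insert {u, v} {e \<in> ?E. e \<subseteq> A}"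
        proof
          fix e assume e: "e \<in> {e \<in> ?E. e \<subseteq> ?A}"
          show "e \<in> insert {u, v} {e \<in> ?E. e \<subseteq> A}"
          proof (cases "u \<in> e")
            case True
            have "card e = 2" using e sub by (auto simp: all_pairs_def)
            then obtain w where w: "e = {u, w}" "w \<noteq> u" using True
              by (metis card_2_iff doubleton_eq_iff insertE singletonD)
            then have "w \<in> A" using e by auto
            then show ?thesis using uniq[of w] w e by auto
          qed (use e in auto)
        qed
      qed (use uv in auto)
      also have "\<dots> = insert {u, v} ((\<lambda>v. {v, par v}) ` (A - {r}))" using A(4) by simp
      also have "\<dots> = (\<lambda>v. {v, ?par v}) ` (?A - {r})"
        using uv(2) \<open>u \<noteq> r\<close> by (auto simp: insert_Diff_if)
      finally show ?thesis .
    qed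
    have 3: "(x, y) \<in> (?r ?A)\<^sup>*" if "x \<in> ?A" "y \<in> ?A" for x y
    proof -
      have mono: "(?r A)\<^sup>* \<subseteq> (?r ?A)\<^sup>*" by (rule rtrancl_mono) auto
      have uu: "(u, v) \<in> ?r ?A" "(v, u) \<in> ?r ?A" using uv by (auto simp: insert_commute)
      have "(x, v) \<in> (?r ?A)\<^sup>*"
        using that(1) A(5) uv(1) mono uu by blast
      moreover have "(v, y) \<in> (?r ?A)\<^sup>*"
        using that(2) A(5) uv(1) mono uu by blast
      ultimately show ?thesis by (rule rtrancl_trans)
    qed
    have "card ?A = Suc (Suc k)" using A(2) uv(2) finV by simp
    then show ?case
      using A(1) uV by (intro exI[of _ ?A] exI[of _ ?par] exI[of _ ?rk] conjI ballI 1 2 3) auto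
  qed
  have "card ?V > 0" using r fin by (auto simp: card_gt_0_iff)
  then obtain A par rk where A: "A \<subseteq> ?V" "card A = card ?V" "rooted_tree A r par rk"
      "{e \<in> ?E. e \<subseteq> A} = (\<lambda>v. {v, par v}) ` (A - {r})"
    using ex[of "card ?V - 1"] by auto
  then have "A = ?V" using fin by (simp add: card_subset_eq)
  moreover have "{e \<in> ?E. e \<subseteq> ?V} = ?E" using sub by (auto simp: all_pairs_def)
  ultimately show ?thesis using A by auto
qed

section \<open>Cutting off pieces and finding sites for gadgets\<close>

context rooted_tree begin

lemma parent_closed_induct [consumes 2, case_names base step]:
  assumes "parent_closed B" "parent_closed A0" and sub: "A0 \<subseteq> B"
    and base: "P A0"
    and step: "\<And>A x. parent_closed A \<Longrightarrow> A0 \<subseteq> A \<Longrightarrow> x \<in> B - A \<Longrightarrow> par x \<in> A \<Longrightarrow> P A \<Longrightarrow> P (insert x A)"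
  shows "P B"
proof -
  interpret B: rooted_tree B root par rk using parent_closed_sub assms(1) .
  have "parent_closed A \<Longrightarrow> A0 \<subseteq> A \<Longrightarrow> A \<subseteq> B \<Longrightarrow> P A \<Longrightarrow> P B" for A
  proof (induction "card (B - A)" arbitrary: A rule: less_induct)
    case less
    show ?case
    proof (cases "A = B")
      case False
      have "B.parent_closed A" using less.prems by (auto simp: parent_closed_def B.parent_closed_def)
      then obtain x where x: "x \<in> B - A" "par x \<in> A" using B.parent_closed_exit False by blast
      have "card (B - insert x A) < card (B - A)"
        using x B.finV by (intro psubset_card_mono) auto
      moreover have "x \<in> V" using x assms(1) by (auto simp: parent_closed_def)
      ultimately show ?thesis
        using less x step[of A x] parent_closed_insert[of A x] by blast
    qed (use less in simp)
  qed
  then show ?thesis using assms by blast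
qed

lemma parent_closed_card:
  assumes "parent_closed A0" "card A0 \<le> k" "k \<le> card V"
  shows "\<exists>A. parent_closed A \<and> A0 \<subseteq> A \<and> card A = k"
proof -
  have "k \<le> card V \<longrightarrow> (\<exists>A. parent_closed A \<and> A0 \<subseteq> A \<and> card A = k)"
  proof (rule parent_closed_induct[of V A0, where P = "\<lambda>B. k \<le> card B \<longrightarrow> (\<exists>A. parent_closed A \<and> A0 \<subseteq> A \<and> card A = k)"])
    show "parent_closed V" by (rule parent_closed_V)
    show "parent_closed A0" "A0 \<subseteq> V" using assms by (auto simp: parent_closed_def)
    show "k \<le> card A0 \<longrightarrow> (\<exists>A. parent_closed A \<and> A0 \<subseteq> A \<and> card A = k)" using assms by auto
    fix A x assume A: "parent_closed A" "A0 \<subseteq> A" "x \<in> V - A" "par x \<in> A"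
      and IH: "k \<le> card A \<longrightarrow> (\<exists>A. parent_closed A \<and> A0 \<subseteq> A \<and> card A = k)"
    show "k \<le> card (insert x A) \<longrightarrow> (\<exists>A. parent_closed A \<and> A0 \<subseteq> A \<and> card A = k)"
    proof (cases "k \<le> card A")
      case False
      have "finite A" using A finV by (auto simp: parent_closed_def finite_subset)
      then have "card (insert x A) = Suc (card A)" using A by simp
      moreover have "parent_closed (insert x A)" using parent_closed_insert A by blast
      ultimately show ?thesis using False A(2) by (metis Suc_leI le_antisym not_le subset_insertI2)
    qed (use IH in blast)
  qed
  then show ?thesis using assms by blast
qed

text \<open>By \<open>exit\<close>, all of \<open>A - A0\<close> hangs below the single vertex
  \<open>w\<close>, so \<open>exists_branch\<close> can start its descent there. Taking a whole
  branch of the subtree \<open>A\<close> keeps \<open>A - P\<close> parent-closed: pieces are peeled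
  off from below and later embedded in reverse order.\<close>

lemma exists_piece:
  assumes A0: "parent_closed A0" and A: "parent_closed A" "A0 \<subseteq> A" "K \<le> card (A - A0)"
    and exit: "\<And>u. u \<in> V - A0 \<Longrightarrow> par u \<in> A0 \<Longrightarrow> u = w"
    and deg: "\<And>z. z \<in> V \<Longrightarrow> card (children z) \<le> d" and "d \<ge> 1" "K \<ge> 1"
  shows "\<exists>P x. P \<subseteq> A - A0 \<and> K \<le> card P \<and> card P \<le> d * K \<and> parent_closed (A - P) \<and>
    x \<in> P \<and> par x \<in> A - P \<and> (\<forall>v\<in>P - {x}. par v \<in> P)"
proof -
  interpret A: rooted_tree A root par rk using parent_closed_sub A(1) .
  have AV: "A \<subseteq> V" using A by (auto simp: parent_closed_def)
  have dsc: "z \<in> A.desc w" if "z \<in> A - A0" for z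
    using that
  proof (induction "rk z" arbitrary: z rule: less_induct)
    case less
    have z: "z \<in> A - {root}" using less.prems A0 by (auto simp: parent_closed_def)
    show ?case
    proof (cases "par z \<in> A0")
      case True
      then have "z = w" using exit less.prems AV by blast
      then show ?thesis using A.desc_self z by blast
    next
      case False
      then show ?thesis
        using less.hyps[of "par z"] A.parV[OF z] A.rk_par[OF z] A.desc_child[OF z] by blast
    qed
  qed
  have "A - A0 \<noteq> {}" using A(3) \<open>K \<ge> 1\<close> by (metis card.empty le_trans not_one_le_zero)
  then obtain z where "z \<in> A - A0" by blast
  then have "(z, w) \<in> A.up\<^sup>*" "z \<in> A" "z \<notin> A0" using dsc by (auto simp: A.desc_def)
  have wA: "w \<in> A \<and> w \<notin> A0"
  proof -
    from \<open>(z, w) \<in> A.up\<^sup>*\<close> show ?thesis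
    proof (cases rule: rtranclE)
      case base then show ?thesis using \<open>z \<in> A\<close> \<open>z \<notin> A0\<close> by simp
    next
      case (step y)
      then have w1: "w \<in> A" using A.parV by (auto simp: A.up_def)
      have "\<exists>u\<in>A - A0. par u \<in> A0"
      proof (rule ccontr)
        assume no: "\<not> ?thesis"
        have "u \<in> A - A0 \<Longrightarrow> False" for u
        proof (induction "rk u" arbitrary: u rule: less_induct)
          case less
          have u: "u \<in> A - {root}" using less.prems A0 by (auto simp: parent_closed_def)
          then show ?case using less A.parV[OF u] A.rk_par[OF u] no by blast
        qed
        then show False using \<open>z \<in> A - A0\<close> by blast
      qed
      then show ?thesis using exit AV w1 by blast
    qed
  qed
  have "A - A0 \<subseteq> A.desc w" using dsc by blast
  then have "K \<le> card (A.desc w)" using A(3) card_mono[OF A.finite_desc] le_trans by blast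
  moreover have "card (A.children z) \<le> d" if "z \<in> A" for z
  proof -
    have "A.children z \<subseteq> children z" using AV by (auto simp: A.children_def children_def)
    then show ?thesis using card_mono[OF finite_children] deg[of z] AV that by (meson le_trans subsetD)
  qed
  ultimately obtain x where x: "x \<in> A.desc w" "K \<le> card (A.desc x)" "card (A.desc x) \<le> d * K"
    using A.exists_branch[of d K w] wA \<open>d \<ge> 1\<close> \<open>K \<ge> 1\<close> by blast
  let ?P = "A.desc x"
  have notA0: "v \<notin> A0" if "(v, u) \<in> A.up\<^sup>*" "u \<notin> A0" for u v
    using that
  proof (induction rule: rtrancl_induct)
    case (step y z)
    then show ?case using A0 A by (auto simp: A.up_def parent_closed_def)
  qed simp
  have PA0: "?P \<inter> A0 = {}"
  proof -
    have "x \<notin> A0" using notA0 x wA by (auto simp: A.desc_def)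
    then show ?thesis using notA0 by (auto simp: A.desc_def)
  qed
  have xA: "x \<in> A" using x by (auto simp: A.desc_def)
  have "root \<in> A0" using A0 by (auto simp: parent_closed_def)
  then have xr: "x \<noteq> root" using PA0 A.desc_self xA by blast
  have "parent_closed (A - ?P)"
    unfolding parent_closed_def
  proof (intro conjI ballI)
    show "A - ?P \<subseteq> V" using AV by blast
    show "root \<in> A - ?P" using PA0 \<open>root \<in> A0\<close> A.rootV by blast
    fix v assume "v \<in> A - ?P - {root}"
    then show "par v \<in> A - ?P" using A.parV A.desc_child by blast
  qed
  moreover have "par x \<in> A - ?P"
  proof -
    have "par x \<notin> ?P"
    proof
      assume "par x \<in> ?P"
      then have "rk x \<le> rk (par x)" using A.up_rk by (auto simp: A.desc_def)
      then show False using A.rk_par xA xr by fastforce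
    qed
    then show ?thesis using A.parV xA xr by blast
  qed
  ultimately show ?thesis
    using x PA0 A.desc_par A.desc_self[OF xA] A.desc_subset
    by (intro exI[of _ ?P] exI[of _ x]) blast
qed

text \<open>The places for gadgets: \<open>s\<close> goes to the centre, its parent and its child
  (if any) to the ends, and its grandparent becomes the connecting vertex. The grandparent is not
  the root, so that its own parent is available as the point of attachment.\<close>

definition site :: "'a \<Rightarrow> bool" where
  "site s \<longleftrightarrow> s \<in> V \<and> card (children s) \<le> 1 \<and> s \<noteq> root \<and> par s \<noteq> root \<and> par (par s) \<noteq> root"

definition site_set :: "'a \<Rightarrow> 'a set" where
  "site_set s = {s, par s, par (par s)} \<union> children s"

lemma card_site_set:
  assumes "site s"
  shows "finite (site_set s)" "card (site_set s) \<le> 4"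
proof -
  show "finite (site_set s)" by (simp add: site_set_def)
  have "card (site_set s) \<le> card {s, par s, par (par s)} + card (children s)"
    unfolding site_set_def by (rule card_Un_le)
  also have "\<dots> \<le> 3 + 1" using assms by (intro add_mono) (auto simp: site_def card_insert_if)
  finally show "card (site_set s) \<le> 4" by simp
qed

text \<open>At most half of the vertices have two or more children, and at most
  \<open>1 + d + d * d\<close> are the root, its children or its grandchildren; all others are
  sites. A site set has at most four vertices, and each of these lies only in the site sets of
  itself, its parent, its children and its grandchildren. So a site conflicts with at most
  \<open>4 * (2 + d + d * d)\<close> sites, and a greedy choice succeeds.\<close>

lemma exists_sites:
  assumes deg: "\<And>z. z \<in> V \<Longrightarrow> card (children z) \<le> d"
    and big: "card V \<ge> 2 * (1 + d + d * d) + 2 * (4 * (2 + d + d * d)) * k"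
  shows "\<exists>S. card S = k \<and> finite S \<and> (\<forall>s\<in>S. site s) \<and>
    (\<forall>s\<in>S. \<forall>s'\<in>S. s \<noteq> s' \<longrightarrow> site_set s \<inter> site_set s' = {})"
proof -
  define C where "C = 4 * (2 + d + d * d)"
  have gc: "card (\<Union>c\<in>children z. children c) \<le> d * d" if "z \<in> V" for z
  proof -
    have "card (\<Union>c\<in>children z. children c) \<le> (\<Sum>c\<in>children z. card (children c))"
      by (rule card_UN_le) simp
    also have "\<dots> \<le> (\<Sum>c\<in>children z. d)"
      by (intro sum_mono deg) (auto simp: children_def)
    also have "\<dots> \<le> d * d" using deg[OF that] by simp
    finally show ?thesis .
  qed
  define Cand where "Cand = {s. site s}"
  have finC: "finite Cand" using finV by (auto simp: Cand_def site_def intro: finite_subset)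
  define B where "B = {z \<in> V. card (children z) \<ge> 2}"
  have finB: "finite B" using finV by (simp add: B_def)
  have "2 * card B \<le> (\<Sum>z\<in>B. card (children z))"
    using sum_mono[of B "\<lambda>_. 2" "\<lambda>z. card (children z)"] by (simp add: B_def mult.commute)
  also have "\<dots> = card (\<Union>z\<in>B. children z)"
    using finB finV by (subst card_UN_disjoint) (auto simp: children_def)
  also have "\<dots> \<le> card V" by (intro card_mono finV) (auto simp: children_def)
  finally have B2: "2 * card B \<le> card V" .
  have "V \<subseteq> B \<union> Cand \<union> ({root} \<union> children root \<union> (\<Union>c\<in>children root. children c))"
    using parV by (auto simp: B_def Cand_def site_def children_def)
  then have "card V \<le> card (B \<union> Cand \<union> ({root} \<union> children root \<union> (\<Union>c\<in>children root. children c)))"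
    using finB finC by (intro card_mono) auto
  also have "\<dots> \<le> card B + card Cand + (1 + card (children root) + card (\<Union>c\<in>children root. children c))"
    by (intro order_trans[OF card_Un_le] add_mono order_refl) auto
  also have "\<dots> \<le> card B + card Cand + (1 + d + d * d)"
    using deg[OF rootV] gc[OF rootV] by simp
  finally have "card V \<le> card B + card Cand + (1 + d + d * d)" .
  moreover have "card V \<ge> 2 * (1 + d + d * d) + 2 * (C * k)" using big by (simp only: C_def mult.assoc)
  moreover have "C * k \<le> c" if "v \<le> b + c + X" "2 * X + 2 * (C * k) \<le> v" "2 * b \<le> v" for v b c X :: nat
    using that by linarith
  ultimately have "C * k \<le> card Cand" using B2 by blast
  have conf: "card {s' \<in> Cand. site_set s \<inter> site_set s' \<noteq> {}} \<le> C" if "s \<in> Cand" for s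
  proof -
    have s: "site s" using that by (simp add: Cand_def)
    have one: "card {s' \<in> Cand. z \<in> site_set s'} \<le> 2 + d + d * d" if "z \<in> V" for z
    proof -
      have "{s' \<in> Cand. z \<in> site_set s'} \<subseteq> {z, par z} \<union> children z \<union> (\<Union>c\<in>children z. children c)"
        using parV by (auto simp: Cand_def site_def site_set_def children_def)
      then have "card {s' \<in> Cand. z \<in> site_set s'} \<le> card ({z, par z} \<union> children z \<union> (\<Union>c\<in>children z. children c))"
        by (intro card_mono) auto
      also have "\<dots> \<le> 2 + d + d * d"
        using deg[OF that] gc[OF that]
        by (intro order_trans[OF card_Un_le] add_mono) (auto simp: card_insert_if)
      finally show ?thesis .
    qed
    have sub: "site_set s \<subseteq> V"
      using s parV by (auto simp: site_def site_set_def children_def)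
    have "{s' \<in> Cand. site_set s \<inter> site_set s' \<noteq> {}} = (\<Union>z\<in>site_set s. {s' \<in> Cand. z \<in> site_set s'})"
      by auto
    then have "card {s' \<in> Cand. site_set s \<inter> site_set s' \<noteq> {}} \<le> (\<Sum>z\<in>site_set s. card {s' \<in> Cand. z \<in> site_set s'})"
      using card_UN_le[OF card_site_set(1)[OF s]] by simp
    also have "\<dots> \<le> (\<Sum>z\<in>site_set s. 2 + d + d * d)" using sub one by (intro sum_mono) blast
    also have "\<dots> = card (site_set s) * (2 + d + d * d)" by simp
    also have "\<dots> \<le> C" unfolding C_def using card_site_set(2)[OF s] by (intro mult_right_mono) auto
    finally show ?thesis .
  qed
  have "\<exists>S\<subseteq>Cand. card S = j \<and> (\<forall>s\<in>S. \<forall>s'\<in>S. s \<noteq> s' \<longrightarrow> site_set s \<inter> site_set s' = {})" if "j \<le> k" for j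
    using that
  proof (induction j)
    case 0 then show ?case by (intro exI[of _ "{}"]) auto
  next
    case (Suc j)
    then obtain S where S: "S \<subseteq> Cand" "card S = j" "\<forall>s\<in>S. \<forall>s'\<in>S. s \<noteq> s' \<longrightarrow> site_set s \<inter> site_set s' = {}" by auto
    have finS: "finite S" using finC S by (auto intro: finite_subset)
    have "card (\<Union>s\<in>S. {s' \<in> Cand. site_set s \<inter> site_set s' \<noteq> {}}) \<le> (\<Sum>s\<in>S. C)"
      using S conf by (intro order_trans[OF card_UN_le[OF finS]] sum_mono) auto
    also have "\<dots> = C * j" using S by simp
    also have "\<dots> < C * k" using Suc.prems by (simp add: C_def)
    also have "\<dots> \<le> card Cand" by fact
    finally have "card (\<Union>s\<in>S. {s' \<in> Cand. site_set s \<inter> site_set s' \<noteq> {}}) < card Cand" .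
    then obtain s where s: "s \<in> Cand" "s \<notin> (\<Union>s\<in>S. {s' \<in> Cand. site_set s \<inter> site_set s' \<noteq> {}})"
      by (metis (no_types, lifting) UN_I card_mono finC finS finite_UN_I finite_Collect_conjI finite_subset linorder_not_less mem_Collect_eq subsetI)
    then have disj: "site_set s \<inter> site_set s' = {}" if "s' \<in> S" for s'
      using that by auto
    have "s \<notin> S" using disj[of s] by (auto simp: site_set_def)
    then show ?case using S s finS disj
      by (intro exI[of _ "insert s S"]) (auto simp: Int_commute)
  qed
  then obtain S where "S \<subseteq> Cand" "card S = k" "\<forall>s\<in>S. \<forall>s'\<in>S. s \<noteq> s' \<longrightarrow> site_set s \<inter> site_set s' = {}" by blast
  then show ?thesis using finC by (intro exI[of _ S]) (auto simp: Cand_def intro: finite_subset)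
qed

end

section \<open>Embedding a small tree into a graph that joins large sets\<close>

definition nbs :: "'v set set \<Rightarrow> 'v \<Rightarrow> 'v set" where
  "nbs E x = {y. {x, y} \<in> E}"

definition joins_large :: "'v set \<Rightarrow> 'v set set \<Rightarrow> nat \<Rightarrow> bool" where
  "joins_large W E t \<longleftrightarrow> (\<forall>X\<subseteq>W. \<forall>Y\<subseteq>W. t \<le> card X \<longrightarrow> t \<le> card Y \<longrightarrow> (\<exists>x\<in>X. \<exists>y\<in>Y. {x, y} \<in> E))"

text \<open>Every vertex of the tree gets its own block of \<open>(d + 1) * t\<close> vertices,
  except that the root gets \<open>Y\<close>. From the leaves up, discard from each block the
  vertices without a neighbour among the candidates of some child. Each child costs at most
  \<open>t\<close> vertices: more of them, together with the at least \<open>t\<close> surviving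
  candidates of that child, would contradict \<open>joins_large\<close>. Since \<open>Y\<close> has
  more than \<open>d * t\<close> vertices, a candidate for the root survives, and the embedding is
  then chosen from the root down.\<close>

lemma (in rooted_tree) root_piece:
  fixes W :: "'v set"
  assumes deg: "\<And>z. z \<in> V \<Longrightarrow> card (children z) \<le> d"
    and finW: "finite W" and join: "joins_large W E t"
    and U: "U \<subseteq> W" "card V * ((d + 1) * t) \<le> card U"
    and Y: "Y \<subseteq> W - U" "d * t < card Y"
  shows "\<exists>\<xi>. inj_on \<xi> V \<and> \<xi> root \<in> Y \<and> \<xi> ` (V - {root}) \<subseteq> U \<and> (\<forall>v\<in>V - {root}. {\<xi> v, \<xi> (par v)} \<in> E)"
proof -
  define c where "c = (d + 1) * t"
  have finU: "finite U" using U finW finite_subset by blast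
  have "card (V \<times> {..<c}) \<le> card U" using U by (simp add: card_cartesian_product c_def)
  then obtain h where h: "h ` (V \<times> {..<c}) \<subseteq> U" "inj_on h (V \<times> {..<c})"
    using card_le_inj[of "V \<times> {..<c}" U] finV finU by auto
  define Us where "Us z = (if z = root then Y else h ` ({z} \<times> {..<c}))" for z
  have UsW: "Us z \<subseteq> W" if "z \<in> V" for z using h U Y that by (auto simp: Us_def)
  have cardUs: "card (Us z) = c" if "z \<in> V" "z \<noteq> root" for z
  proof -
    have "inj_on h ({z} \<times> {..<c})" using h(2) that by (auto intro: inj_on_subset)
    then show ?thesis using that by (simp add: Us_def card_image card_cartesian_product)
  qed
  have disj: "Us z \<inter> Us z' = {}" if "z \<in> V" "z' \<in> V" "z \<noteq> z'" for z z'
  proof -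
    have "h ` ({z} \<times> {..<c}) \<inter> h ` ({z'} \<times> {..<c}) = h ` ({z} \<times> {..<c} \<inter> {z'} \<times> {..<c})"
      using that by (intro inj_on_image_Int[OF h(2), symmetric]) auto
    then have "h ` ({z} \<times> {..<c}) \<inter> h ` ({z'} \<times> {..<c}) = {}" using that by auto
    moreover have "h ` ({z} \<times> {..<c}) \<inter> Y = {}" if "z \<in> V" for z using h(1) Y that by blast
    ultimately show ?thesis using that by (cases "z = root"; cases "z' = root") (auto simp: Us_def Int_commute)
  qed
  \<comment> \<open>From every vertex of the candidate set \<open>C z\<close> one can continue into \<open>C x\<close> for each child \<open>x\<close>.\<close>
  have cand: "\<exists>C. \<forall>z\<in>D. C z \<subseteq> Us z \<and> card (Us z) \<le> card (C z) + d * t \<and>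
      (\<forall>x\<in>children z. \<forall>y\<in>C z. \<exists>y'\<in>C x. {y, y'} \<in> E)"
    if "D \<subseteq> V" "\<And>z. z \<in> D \<Longrightarrow> children z \<subseteq> D" for D
    using that
  proof (induction "card D" arbitrary: D rule: less_induct)
    case less
    show ?case
    proof (cases "D = {}")
      case False
      then obtain z where z: "z \<in> D" "\<And>y. y \<in> D \<Longrightarrow> rk z \<le> rk y"
        using ex_has_least_nat[of "\<lambda>x. x \<in> D" _ rk] by blast
      have finD: "finite D" using less.prems finV finite_subset by blast
      let ?D = "D - {z}"
      have notch: "z \<notin> children x" if "x \<in> ?D" for x
        using z(2)[of x] that rk_par by (force simp: children_def)
      then have "children x \<subseteq> ?D" if "x \<in> ?D" for x
        using less.prems(2) that by blast
      moreover have "card ?D < card D" using z finD by (intro psubset_card_mono) auto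
      ultimately obtain C where C: "\<forall>z\<in>?D. C z \<subseteq> Us z \<and> card (Us z) \<le> card (C z) + d * t \<and>
        (\<forall>x\<in>children z. \<forall>y\<in>C z. \<exists>y'\<in>C x. {y, y'} \<in> E)"
        using less.hyps[of ?D] less.prems(1) by blast
      have zV: "z \<in> V" using z less.prems by blast
      have "z \<notin> children z" using rk_par by (force simp: children_def)
      then have chD: "children z \<subseteq> ?D" using less.prems(2) z by blast
      define Cz where "Cz = {y \<in> Us z. \<forall>x\<in>children z. \<exists>y'\<in>C x. {y, y'} \<in> E}"
      define bad where "bad x = {y \<in> Us z. \<forall>y'\<in>C x. {y, y'} \<notin> E}" for x
      have finUs: "finite (Us z)" using UsW[OF zV] finW finite_subset by blast
      have bad: "card (bad x) \<le> t" if "x \<in> children z" for x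
      proof (rule ccontr)
        assume "\<not> card (bad x) \<le> t"
        moreover have x: "x \<in> V" "x \<noteq> root" "x \<in> ?D" using that chD by (auto simp: children_def)
        then have "card (Us x) \<le> card (C x) + d * t" using C by blast
        then have "t \<le> card (C x)" using x cardUs[of x] by (simp add: c_def)
        moreover have "C x \<subseteq> W" using C x UsW by blast
        moreover have "bad x \<subseteq> W" using UsW[OF zV] by (auto simp: bad_def)
        ultimately obtain y y' where "y \<in> bad x" "y' \<in> C x" "{y, y'} \<in> E"
          using join unfolding joins_large_def by (metis nle_le)
        then show False by (auto simp: bad_def)
      qed
      have "Us z - Cz \<subseteq> (\<Union>x\<in>children z. bad x)" by (auto simp: Cz_def bad_def)
      then have "card (Us z - Cz) \<le> card (\<Union>x\<in>children z. bad x)"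
        using finUs by (intro card_mono) (auto simp: bad_def)
      also have "\<dots> \<le> (\<Sum>x\<in>children z. t)"
        using bad by (intro order_trans[OF card_UN_le] sum_mono) auto
      also have "\<dots> \<le> d * t" using deg[OF zV] by simp
      finally have "card (Us z - Cz) \<le> d * t" .
      moreover have "card (Us z - Cz) = card (Us z) - card Cz"
        using finUs by (intro card_Diff_subset) (auto simp: Cz_def intro: finite_subset)
      ultimately have "card (Us z) \<le> card Cz + d * t" by linarith
      moreover have "\<exists>y'\<in>(C(z := Cz)) u. {y, y'} \<in> E"
        if "x \<in> D" "u \<in> children x" "y \<in> (C(z := Cz)) x" for x u y
      proof (cases "x = z")
        case True
        then have "u \<noteq> z" using that chD by blast
        then show ?thesis using that True by (auto simp: Cz_def)
      next
        case False
        then have "u \<noteq> z" using that notch by blast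
        then show ?thesis using that False C by auto
      qed
      ultimately show ?thesis using C
        by (intro exI[of _ "C(z := Cz)"]) (auto simp: Cz_def)
    qed simp
  qed
  have "children z \<subseteq> V" for z by (auto simp: children_def)
  with cand[OF order_refl] obtain C where C: "\<And>z. z \<in> V \<Longrightarrow> C z \<subseteq> Us z" "\<And>z. z \<in> V \<Longrightarrow> card (Us z) \<le> card (C z) + d * t"
    "\<And>z x y. z \<in> V \<Longrightarrow> x \<in> children z \<Longrightarrow> y \<in> C z \<Longrightarrow> \<exists>y'\<in>C x. {y, y'} \<in> E"
    by blast
  have "card (C root) > 0" using C(2)[OF rootV] Y by (simp add: Us_def)
  then obtain y where y: "y \<in> C root" by (metis card_gt_0_iff equals0I)
  have "\<exists>\<xi>. (\<forall>v\<in>V. \<xi> v \<in> C v) \<and> (\<forall>v\<in>V - {root}. {\<xi> v, \<xi> (par v)} \<in> E)"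
  proof (rule parent_closed_induct[of V "{root}", where
        P = "\<lambda>A. \<exists>\<xi>. (\<forall>v\<in>A. \<xi> v \<in> C v) \<and> (\<forall>v\<in>A - {root}. {\<xi> v, \<xi> (par v)} \<in> E)"])
    show "\<exists>\<xi>. (\<forall>v\<in>{root}. \<xi> v \<in> C v) \<and> (\<forall>v\<in>{root} - {root}. {\<xi> v, \<xi> (par v)} \<in> E)"
      using y by (intro exI[of _ "\<lambda>_. y"]) auto
    fix A x
    assume A: "parent_closed A" "x \<in> V - A" "par x \<in> A" "{root} \<subseteq> A"
      and "\<exists>\<xi>. (\<forall>v\<in>A. \<xi> v \<in> C v) \<and> (\<forall>v\<in>A - {root}. {\<xi> v, \<xi> (par v)} \<in> E)"
    then obtain \<xi> where \<xi>: "\<forall>v\<in>A. \<xi> v \<in> C v" "\<forall>v\<in>A - {root}. {\<xi> v, \<xi> (par v)} \<in> E" by blast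
    have "x \<in> children (par x)" using A by (auto simp: children_def)
    moreover have "par x \<in> V" using A by (auto simp: parent_closed_def)
    ultimately obtain y' where "y' \<in> C x" "{\<xi> (par x), y'} \<in> E" using C(3) \<xi>(1) A(3) by blast
    moreover have "par v \<in> A" if "v \<in> A - {root}" for v using A that by (auto simp: parent_closed_def)
    ultimately show "\<exists>\<xi>. (\<forall>v\<in>insert x A. \<xi> v \<in> C v) \<and> (\<forall>v\<in>insert x A - {root}. {\<xi> v, \<xi> (par v)} \<in> E)"
      using \<xi> A by (intro exI[of _ "\<xi>(x := y')"]) (auto simp: insert_commute)
  qed (use rootV parent_closed_V in \<open>auto simp: parent_closed_def\<close>)
  then obtain \<xi> where \<xi>: "\<And>v. v \<in> V \<Longrightarrow> \<xi> v \<in> C v" "\<forall>v\<in>V - {root}. {\<xi> v, \<xi> (par v)} \<in> E" by blast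
  have in_Us: "\<xi> v \<in> Us v" if "v \<in> V" for v using \<xi>(1) C(1) that by blast
  have "inj_on \<xi> V"
    by (rule inj_onI) (metis disj in_Us disjoint_iff)
  moreover have "\<xi> root \<in> Y" using in_Us[OF rootV] by (simp add: Us_def)
  moreover have "\<xi> ` (V - {root}) \<subseteq> U"
  proof
    fix y assume "y \<in> \<xi> ` (V - {root})"
    then obtain v where "v \<in> V" "v \<noteq> root" "y = \<xi> v" by blast
    then show "y \<in> U" using in_Us[of v] h(1) by (auto simp: Us_def)
  qed
  ultimately show ?thesis using \<xi>(2) by blast
qed

section \<open>Embedding a bounded degree tree\<close>

type_synonym 'v gadget = "'v \<times> 'v \<times> 'v"

fun gverts :: "'v gadget \<Rightarrow> 'v set" where
  "gverts (a, y, b) = {a, y, b}"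

definition gfst :: "'v gadget \<Rightarrow> 'v" where "gfst = fst"
definition gmid :: "'v gadget \<Rightarrow> 'v" where "gmid g = fst (snd g)"
definition glast :: "'v gadget \<Rightarrow> 'v" where "glast g = snd (snd g)"

lemma gverts_alt: "gverts g = {gfst g, gmid g, glast g}"
  by (cases g) (auto simp: gfst_def gmid_def glast_def)

definition gadget_system :: "'v set \<Rightarrow> 'v set set \<Rightarrow> 'v gadget set \<Rightarrow> bool" where
  "gadget_system W E Q \<longleftrightarrow> finite Q \<and>
     (\<forall>g\<in>Q. gverts g \<subseteq> W \<and> card (gverts g) = 3 \<and> {gfst g, gmid g} \<in> E \<and> {gmid g, glast g} \<in> E) \<and>
     (\<forall>g\<in>Q. \<forall>g'\<in>Q. g \<noteq> g' \<longrightarrow> gverts g \<inter> gverts g' = {})"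

lemma gadget_distinct:
  assumes "card (gverts g) = 3"
  shows "gfst g \<noteq> gmid g" "gmid g \<noteq> glast g" "gfst g \<noteq> glast g"
  using assms by (auto simp: gverts_alt card_insert_if split: if_splits)

lemma disjoint_mono2: "A \<inter> B = {} \<Longrightarrow> C \<subseteq> B \<Longrightarrow> A \<inter> C = {}"
  by blast

context rooted_tree begin

text \<open>If \<open>s\<close> is a leaf, then no tree vertex needs to occupy the last vertex of the gadget.\<close>

definition planted :: "('a \<Rightarrow> 'v) \<Rightarrow> 'a \<Rightarrow> 'v gadget \<Rightarrow> bool" where
  "planted \<phi> s g \<longleftrightarrow> \<phi> s = gmid g \<and> \<phi> (par s) = gfst g \<and> (\<forall>c\<in>children s. \<phi> c = glast g)"

text \<open>Ordinary vertices are placed greedily along \<open>EG\<close> edges, outside all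
  gadgets. A site is placed in one go when its topmost vertex, the grandparent \<open>p\<close> of
  \<open>s\<close>, is reached: \<open>EG\<close> offers at least \<open>t\<close> places for
  \<open>p\<close>, at least \<open>t\<close> gadgets are still free, and \<open>joins_large\<close>
  gives an \<open>ER\<close> edge from one of these places to the first vertex of one of these
  gadgets. The degree bound pays for the occupied vertices, the gadget vertices and the
  \<open>t\<close> choices.\<close>

lemma embed_with_gadgets:
  fixes W :: "'v set"
  assumes finW: "finite W" and join: "joins_large W ER t" and t: "t \<ge> 1"
    and EGW: "\<And>x. nbs EG x \<subseteq> W" and neW: "W \<noteq> {}"
    and Q: "gadget_system W ER Q"
    and S: "finite S" "\<And>s. s \<in> S \<Longrightarrow> site s"
    and disj: "\<And>s s'. s \<in> S \<Longrightarrow> s' \<in> S \<Longrightarrow> s \<noteq> s' \<Longrightarrow> site_set s \<inter> site_set s' = {}"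
    and cardS: "card S + t \<le> card Q"
    and mindeg: "\<And>x. x \<in> W \<Longrightarrow> card V + 3 * card Q + t \<le> card (nbs EG x)"
  shows "\<exists>\<phi> \<kappa>. inj_on \<phi> V \<and> \<phi> ` V \<subseteq> W \<and> (\<forall>v\<in>V - {root}. {\<phi> v, \<phi> (par v)} \<in> EG \<union> ER) \<and>
    inj_on \<kappa> S \<and> \<kappa> ` S \<subseteq> Q \<and>
    (\<forall>s\<in>S. planted \<phi> s (\<kappa> s))"
proof -
  have finQ: "finite Q" using Q by (simp add: gadget_system_def)
  define QV where "QV = (\<Union>g\<in>Q. gverts g)"
  have finQV: "finite QV" unfolding QV_def using finQ by (auto simp: gverts_alt)
  have "card QV \<le> (\<Sum>g\<in>Q. card (gverts g))" unfolding QV_def by (rule card_UN_le[OF finQ])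
  also have "\<dots> = (\<Sum>g\<in>Q. 3)" using Q by (intro sum.cong) (auto simp: gadget_system_def)
  finally have cardQV: "card QV \<le> 3 * card Q" by simp
  have finN: "finite (nbs EG x)" for x using EGW finW finite_subset by blast
  define placed where "placed A = {s \<in> S. site_set s \<subseteq> A}" for A
  \<comment> \<open>Each site is entirely inside or entirely outside the embedded set, and gadgets
    not yet planted are untouched; this is what makes the next site placeable.\<close>
  define St where "St A \<phi> \<kappa> \<longleftrightarrow> parent_closed A \<and> inj_on \<phi> A \<and> \<phi> ` A \<subseteq> W \<and>
     (\<forall>v\<in>A - {root}. {\<phi> v, \<phi> (par v)} \<in> EG \<union> ER) \<and>
     (\<forall>s\<in>S. site_set s \<subseteq> A \<or> site_set s \<inter> A = {}) \<and>
     inj_on \<kappa> (placed A) \<and> \<kappa> ` placed A \<subseteq> Q \<and>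
     (\<forall>s\<in>placed A. planted \<phi> s (\<kappa> s)) \<and>
     (\<forall>g\<in>Q - \<kappa> ` placed A. gverts g \<inter> \<phi> ` A = {})" for A \<phi> and \<kappa> :: "'a \<Rightarrow> 'v gadget"
  have extend: "\<exists>\<phi> \<kappa>. St V \<phi> \<kappa>" if "St A \<phi> \<kappa>" for A \<phi> \<kappa>
    using that
  proof (induction "card (V - A)" arbitrary: A \<phi> \<kappa> rule: less_induct)
    case less
    note st = less.prems[unfolded St_def]
    have pc: "parent_closed A" and inj: "inj_on \<phi> A" and imW: "\<phi> ` A \<subseteq> W"
      and edge: "\<And>v. v \<in> A - {root} \<Longrightarrow> {\<phi> v, \<phi> (par v)} \<in> EG \<union> ER"
      and dich: "\<And>s. s \<in> S \<Longrightarrow> site_set s \<subseteq> A \<or> site_set s \<inter> A = {}"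
      and \<kappa>: "inj_on \<kappa> (placed A)" "\<kappa> ` placed A \<subseteq> Q"
      and gad: "\<And>s. s \<in> placed A \<Longrightarrow> planted \<phi> s (\<kappa> s)"
      and free: "\<And>g. g \<in> Q - \<kappa> ` placed A \<Longrightarrow> gverts g \<inter> \<phi> ` A = {}"
      using st by blast+
    have AV: "A \<subseteq> V" and parA: "\<And>v. v \<in> A - {root} \<Longrightarrow> par v \<in> A"
      using pc by (auto simp: parent_closed_def)
    have finA: "finite A" using AV finV finite_subset by blast
    show ?case
    proof (cases "A = V")
      case True then show ?thesis using less.prems by blast
    next
      case False
      then obtain x where x: "x \<in> V - A" "par x \<in> A" using parent_closed_exit pc by blast
      have large: "t \<le> card (nbs EG z - (\<phi> ` A \<union> QV))" if "z \<in> \<phi> ` A" for z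
      proof -
        have "card (\<phi> ` A \<union> QV) \<le> card V + 3 * card Q"
          using card_Un_le[of "\<phi> ` A" QV] card_image_le[OF finA, of \<phi>] card_mono[OF finV AV] cardQV by linarith
        moreover have "card (nbs EG z) - card (\<phi> ` A \<union> QV) \<le> card (nbs EG z - (\<phi> ` A \<union> QV))"
          by (rule diff_card_le_card_Diff) (use finA finQV in auto)
        ultimately show ?thesis using mindeg[of z] that imW by fastforce
      qed
      show ?thesis
      proof (cases "\<exists>s\<in>S. x \<in> site_set s")
        case noS: False
        have "card (nbs EG (\<phi> (par x)) - (\<phi> ` A \<union> QV)) > 0" using large[of "\<phi> (par x)"] x t by force
        then obtain z where z: "z \<in> nbs EG (\<phi> (par x))" "z \<notin> \<phi> ` A" "z \<notin> QV"
          by (metis Diff_iff UnCI card_gt_0_iff equals0I)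
        let ?A = "insert x A" and ?\<phi> = "\<phi>(x := z)"
        have eq: "?\<phi> v = \<phi> v" if "v \<in> A" for v using that x by auto
        have im: "?\<phi> ` ?A = insert z (\<phi> ` A)" using x by auto
        have placed: "placed ?A = placed A" unfolding placed_def using noS by blast
        have placedA: "s \<in> A \<and> par s \<in> A \<and> children s \<subseteq> A" if "s \<in> placed A" for s
          using that by (auto simp: placed_def site_set_def)
        have "St ?A ?\<phi> \<kappa>"
          unfolding St_def placed
        proof (intro conjI)
          show "parent_closed ?A" using parent_closed_insert pc x by blast
          show "inj_on ?\<phi> ?A" using inj z x by (auto simp: inj_on_def)
          show "?\<phi> ` ?A \<subseteq> W" unfolding im using imW z EGW by blast
          show "\<forall>v\<in>?A - {root}. {?\<phi> v, ?\<phi> (par v)} \<in> EG \<union> ER"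
          proof
            fix v assume v: "v \<in> ?A - {root}"
            show "{?\<phi> v, ?\<phi> (par v)} \<in> EG \<union> ER"
            proof (cases "v = x")
              case True
              have "par x \<noteq> x" using x by auto
              then show ?thesis using True z by (auto simp: nbs_def insert_commute)
            next
              case False
              then show ?thesis using v edge[of v] eq parA by auto
            qed
          qed
          show "\<forall>s\<in>S. site_set s \<subseteq> ?A \<or> site_set s \<inter> ?A = {}" using dich noS by blast
          show "\<forall>s\<in>placed A. planted ?\<phi> s (\<kappa> s)"
          proof
            fix s assume "s \<in> placed A"
            then show "planted ?\<phi> s (\<kappa> s)"
              using gad[of s] placedA[of s] eq unfolding planted_def by (metis subsetD)
          qed
          show "\<forall>g\<in>Q - \<kappa> ` placed A. gverts g \<inter> ?\<phi> ` ?A = {}"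
            unfolding im using free z(3) by (auto simp: QV_def)
        qed (use \<kappa> in auto)
        moreover have "card (V - ?A) < card (V - A)"
          using x finV by (intro psubset_card_mono) auto
        ultimately show ?thesis using less.hyps by blast
      next
        case True
        then obtain s where s: "s \<in> S" "x \<in> site_set s" by blast
        have sA: "site_set s \<inter> A = {}" using dich[OF s(1)] s(2) x by blast
        define e p where "e = par s" and "p = par e"
        have site: "s \<in> V - {root}" "e \<in> V - {root}" "p \<in> V - {root}"
          "card (children s) \<le> 1"
          using S(2)[OF s(1)] parV by (auto simp: site_def e_def p_def)
        have rk: "rk p < rk e" "rk e < rk s" "\<And>c. c \<in> children s \<Longrightarrow> rk s < rk c"
          using rk_par site by (auto simp: e_def p_def children_def)
        have F: "site_set s = {s, e, p} \<union> children s" by (simp add: site_set_def e_def p_def)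
        have chV: "c \<in> V - {root} \<and> par c = s" if "c \<in> children s" for c
          using that by (auto simp: children_def)
        \<comment> \<open>Every vertex of the site other than \<open>p\<close> has its parent in the
          site, so the vertex by which the site is reached must be \<open>p\<close>.\<close>
        have "par v \<in> site_set s" if "v \<in> site_set s" "v \<noteq> p" for v
          using that chV by (auto simp: F e_def p_def)
        then have "x = p" using s x sA by blast
        then have pp: "par p \<in> A" using x by blast
        have fresh: "s \<notin> A" "e \<notin> A" "p \<notin> A" "\<And>c. c \<in> children s \<Longrightarrow> c \<notin> A"
          using sA F by auto
        have chuniq: "c = c'" if "c \<in> children s" "c' \<in> children s" for c c'
          using that site(4) finite_children by (metis One_nat_def card_le_Suc0_iff_eq)
        define X where "X = nbs EG (\<phi> (par p)) - (\<phi> ` A \<union> QV)"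
        have "t \<le> card X" unfolding X_def by (rule large) (use pp in blast)
        have XW: "X \<subseteq> W" using EGW by (auto simp: X_def)
        define Q' where "Q' = Q - \<kappa> ` placed A"
        have injQ: "inj_on gfst Q"
        proof (rule inj_onI, rule ccontr)
          fix g g' assume g: "g \<in> Q" "g' \<in> Q" "gfst g = gfst g'" "g \<noteq> g'"
          then have "gverts g \<inter> gverts g' = {}" using Q by (auto simp: gadget_system_def)
          then show False using g by (auto simp: gverts_alt)
        qed
        have "card (\<kappa> ` placed A) \<le> card S"
          using S(1) by (intro order_trans[OF card_image_le card_mono]) (auto simp: placed_def)
        then have "t \<le> card Q'"
          using diff_card_le_card_Diff[of "\<kappa> ` placed A" Q] S(1) cardS by (auto simp: Q'_def placed_def)
        also have "card Q' = card (gfst ` Q')"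
          by (rule card_image[symmetric]) (rule inj_on_subset[OF injQ], auto simp: Q'_def)
        finally have "t \<le> card (gfst ` Q')" .
        moreover have "gfst ` Q' \<subseteq> W" using Q by (auto simp: Q'_def gadget_system_def gverts_alt)
        ultimately obtain P g where P: "P \<in> X" "g \<in> Q'" "{P, gfst g} \<in> ER"
          using join \<open>t \<le> card X\<close> XW unfolding joins_large_def by blast
        define a y b where "a = gfst g" and "y = gmid g" and "b = glast g"
        have gQ: "g \<in> Q" using P by (simp add: Q'_def)
        then have g: "gverts g = {a, y, b}" "a \<noteq> y" "y \<noteq> b" "a \<noteq> b" "{a, y} \<in> ER" "{y, b} \<in> ER" "{a, y, b} \<subseteq> W"
          using Q gadget_distinct[of g] unfolding a_def y_def b_def gadget_system_def by (auto simp: gverts_alt)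
        have gfree: "a \<notin> \<phi> ` A" "y \<notin> \<phi> ` A" "b \<notin> \<phi> ` A"
          using free[of g] P g(1) by (auto simp: Q'_def)
        have "{a, y, b} \<subseteq> QV" using g(1) gQ by (auto simp: QV_def)
        then have Pfree: "P \<notin> \<phi> ` A" "P \<noteq> a" "P \<noteq> y" "P \<noteq> b" "P \<notin> QV" "P \<in> nbs EG (\<phi> (par p))"
          using P(1) by (auto simp: X_def)
        let ?A = "A \<union> site_set s" and ?\<kappa> = "\<kappa>(s := g)"
        define \<phi>' where "\<phi>' v = (if v \<in> A then \<phi> v else if v = p then P else if v = e then a else if v = s then y else b)" for v
        have val: "\<And>v. v \<in> A \<Longrightarrow> \<phi>' v = \<phi> v" "\<phi>' p = P" "\<phi>' e = a" "\<phi>' s = y" "\<And>c. c \<in> children s \<Longrightarrow> \<phi>' c = b"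
        proof -
          have "e \<notin> children s" "p \<notin> children s" "s \<notin> children s" using rk(1,2) rk(3)[of e] rk(3)[of p] rk(3)[of s] by auto
          then show "\<And>v. v \<in> A \<Longrightarrow> \<phi>' v = \<phi> v" "\<phi>' p = P" "\<phi>' e = a" "\<phi>' s = y" "\<And>c. c \<in> children s \<Longrightarrow> \<phi>' c = b"
            using fresh rk(1,2) by (auto simp: \<phi>'_def)
        qed
        have im: "\<phi>' ` ?A \<subseteq> \<phi> ` A \<union> {P, a, y, b}" by (auto simp: \<phi>'_def)
        have Acases: "v \<in> A \<or> v = p \<or> v = e \<or> v = s \<or> v \<in> children s" if "v \<in> ?A" for v
          using that F by blast
        have "s \<notin> placed A" using fresh by (auto simp: placed_def F)
        have placed: "placed ?A = insert s (placed A)"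
        proof
          show "placed ?A \<subseteq> insert s (placed A)"
          proof
            fix s' assume s': "s' \<in> placed ?A"
            show "s' \<in> insert s (placed A)"
            proof (cases "s' = s")
              case False
              then have "site_set s' \<inter> site_set s = {}" using disj s(1) s' by (auto simp: placed_def)
              then show ?thesis using s' by (auto simp: placed_def)
            qed simp
          qed
        qed (use s in \<open>auto simp: placed_def\<close>)
        have placedA: "s' \<in> A \<and> par s' \<in> A \<and> children s' \<subseteq> A" if "s' \<in> placed A" for s'
          using that by (auto simp: placed_def site_set_def)
        have "St ?A \<phi>' ?\<kappa>"
          unfolding St_def placed
        proof (intro conjI)
          show "parent_closed ?A"
            unfolding parent_closed_def
          proof (intro conjI ballI)
            have "children s \<subseteq> V" using chV by auto
            then show "?A \<subseteq> V" using AV site F by auto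
            show "root \<in> ?A" using pc by (auto simp: parent_closed_def)
            fix v assume "v \<in> ?A - {root}"
            then show "par v \<in> ?A"
              using Acases[of v] parA pp chV F by (auto simp: e_def p_def)
          qed
          show "inj_on \<phi>' ?A"
          proof (rule inj_onI)
            fix v v' assume v: "v \<in> ?A" "v' \<in> ?A" "\<phi>' v = \<phi>' v'"
            have im': "\<phi>' u \<in> \<phi> ` A" if "u \<in> A" for u using that val(1) by auto
            show "v = v'"
              using Acases[OF v(1)] Acases[OF v(2)] v(3) val im' gfree Pfree g(2-4) inj chuniq
              by (elim disjE) (auto dest: inj_onD)
          qed
          show "\<phi>' ` ?A \<subseteq> W" using im imW P(1) XW g(7) by blast
          show "\<forall>v\<in>?A - {root}. {\<phi>' v, \<phi>' (par v)} \<in> EG \<union> ER"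
          proof
            fix v assume v: "v \<in> ?A - {root}"
            have "par v \<in> A" if "v \<in> A" using parA that v by blast
            then show "{\<phi>' v, \<phi>' (par v)} \<in> EG \<union> ER"
              using Acases[of v] v edge[of v] val pp chV[of v] P(3) g(5,6) Pfree(6)
              by (auto simp: e_def[symmetric] p_def[symmetric] a_def[symmetric] nbs_def insert_commute)
          qed
          show "\<forall>s'\<in>S. site_set s' \<subseteq> ?A \<or> site_set s' \<inter> ?A = {}"
            using dich disj s(1) by blast
          show "inj_on ?\<kappa> (insert s (placed A))"
            using \<kappa>(1) \<open>s \<notin> placed A\<close> P(2) by (auto simp: inj_on_def Q'_def)
          show "?\<kappa> ` insert s (placed A) \<subseteq> Q" using \<kappa>(2) gQ by auto
          show "\<forall>s'\<in>insert s (placed A). planted \<phi>' s' (?\<kappa> s')"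
          proof
            fix s' assume s': "s' \<in> insert s (placed A)"
            show "planted \<phi>' s' (?\<kappa> s')"
            proof (cases "s' = s")
              case True
              then show ?thesis using val by (simp add: planted_def a_def y_def b_def e_def[symmetric])
            next
              case False
              then have "s' \<in> placed A" using s' by blast
              then show ?thesis using False gad[of s'] placedA[of s'] val(1) by (auto simp: planted_def)
            qed
          qed
          show "\<forall>g'\<in>Q - ?\<kappa> ` insert s (placed A). gverts g' \<inter> \<phi>' ` ?A = {}"
          proof
            fix g' assume g': "g' \<in> Q - ?\<kappa> ` insert s (placed A)"
            then have "g' \<noteq> g" "g' \<in> Q - \<kappa> ` placed A" using \<open>s \<notin> placed A\<close> by auto
            then have "gverts g' \<inter> gverts g = {}" "gverts g' \<inter> \<phi> ` A = {}" "gverts g' \<subseteq> QV"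
              using Q gQ free by (auto simp: gadget_system_def QV_def)
            then have "gverts g' \<inter> (\<phi> ` A \<union> {P, a, y, b}) = {}" using g(1) Pfree(5) by auto
            from this im show "gverts g' \<inter> \<phi>' ` ?A = {}" by (rule disjoint_mono2)
          qed
        qed
        moreover have "card (V - ?A) < card (V - A)"
          using s(2) x finV by (intro psubset_card_mono) auto
        ultimately show ?thesis using less.hyps by blast
      qed
    qed
  qed
  \<comment> \<open>The gadgets do not cover \<open>W\<close>, since a single neighbourhood already
    has more than \<open>3 * card Q\<close> vertices.\<close>
  obtain z where z: "z \<in> W - QV"
  proof -
    have "W - QV \<noteq> {}"
    proof
      assume "W - QV = {}"
      then have "card W \<le> card QV" using finQV by (intro card_mono) auto
      moreover obtain x where "x \<in> W" using neW by blast
      ultimately show False using mindeg[of x] cardQV t card_mono[OF finW EGW[of x]] by simp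
    qed
    then show thesis using that by blast
  qed
  have "St {root} (\<lambda>_. z) (\<lambda>_. undefined)"
  proof -
    have noS: "root \<notin> site_set s" if "s \<in> S" for s
      using S(2)[OF that] by (auto simp: site_def site_set_def children_def)
    have "placed {root} = {}"
      unfolding placed_def using noS by (auto simp: site_set_def)
    moreover have "parent_closed {root}" using rootV by (auto simp: parent_closed_def)
    ultimately show ?thesis using z noS by (auto simp: St_def QV_def)
  qed
  then obtain \<phi> \<kappa> where "St V \<phi> \<kappa>" using extend by blast
  moreover have "placed V = S"
    using S(2) parV by (auto simp: placed_def site_def site_set_def children_def)
  ultimately show ?thesis unfolding St_def by auto
qed

section \<open>Absorbing pieces until the embedding is spanning\<close>

definition absorbing :: "'v set \<Rightarrow> 'v set set \<Rightarrow> 'a set \<Rightarrow> ('a \<Rightarrow> 'v gadget) \<Rightarrow> 'a set \<Rightarrow> ('a \<Rightarrow> 'v) \<Rightarrow> 'a set \<Rightarrow> bool" where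
  "absorbing W E S \<kappa> A \<phi> D \<longleftrightarrow> inj_on \<phi> A \<and> \<phi> ` A \<subseteq> W \<and>
     (\<forall>v\<in>A - {root}. {\<phi> v, \<phi> (par v)} \<in> E) \<and> D \<subseteq> S \<and>
     (\<forall>s\<in>S - D. planted \<phi> s (\<kappa> s))"

text \<open>Let \<open>x\<close> be the image of \<open>par r\<close> and \<open>w0\<close> an
  unoccupied vertex. More than \<open>k\<close> intact gadgets serve \<open>(w0, x)\<close>, so
  their centres form a set that \<open>rooting\<close> accepts; it puts \<open>r\<close> on one of
  them, say that of \<open>s\<close>. Then \<open>s\<close> moves to \<open>w0\<close>, which is
  adjacent to both ends of the gadget, and \<open>r\<close> sits next to \<open>x\<close>. Only one
  gadget is spent, whatever the size of \<open>P\<close>; \<open>D\<close> collects the sites whose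
  gadgets are spent.\<close>

lemma absorb_piece:
  fixes W :: "'v set"
  assumes pcA: "parent_closed A" and A0: "A0 \<subseteq> A" "S \<subseteq> A0 - {root}"
    and chS: "\<And>s. s \<in> S \<Longrightarrow> children s \<subseteq> A0" and parS: "\<And>s. s \<in> S \<Longrightarrow> par s \<notin> S"
    and finS: "finite S"
    and inj\<kappa>: "inj_on (\<lambda>s. gmid (\<kappa> s)) S"
    and st: "absorbing W E S \<kappa> A \<phi> D"
    and EG: "EG \<subseteq> E"
    and rich: "\<And>w x. w \<in> W \<Longrightarrow> x \<in> W \<Longrightarrow> k + card D <
      card {s \<in> S. {w, gfst (\<kappa> s)} \<in> EG \<and> {w, glast (\<kappa> s)} \<in> EG \<and> {x, gmid (\<kappa> s)} \<in> EG}"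
    and PV: "P \<subseteq> V" and P: "P \<inter> A = {}" "r \<in> P" "par r \<in> A" "\<And>v. v \<in> P - {r} \<Longrightarrow> par v \<in> P"
    and w0: "w0 \<in> W - \<phi> ` A"
    and rooting: "\<And>Y. Y \<subseteq> \<phi> ` A \<Longrightarrow> k < card Y \<Longrightarrow> \<exists>\<xi>. inj_on \<xi> P \<and> \<xi> r \<in> Y \<and>
      \<xi> ` (P - {r}) \<subseteq> W - \<phi> ` A - {w0} \<and> (\<forall>v\<in>P - {r}. {\<xi> v, \<xi> (par v)} \<in> E)"
  shows "\<exists>\<phi>' s. absorbing W E S \<kappa> (A \<union> P) \<phi>' (insert s D)"
proof -
  have AV: "A \<subseteq> V" and parA: "\<And>v. v \<in> A - {root} \<Longrightarrow> par v \<in> A" and rA: "root \<in> A"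
    using pcA by (auto simp: parent_closed_def)
  have inj: "inj_on \<phi> A" and imW: "\<phi> ` A \<subseteq> W" and edge: "\<And>v. v \<in> A - {root} \<Longrightarrow> {\<phi> v, \<phi> (par v)} \<in> E"
    and DS: "D \<subseteq> S"
    and gad: "\<And>s. s \<in> S - D \<Longrightarrow> planted \<phi> s (\<kappa> s)"
    using st by (auto simp: absorbing_def)
  note gad = gad[unfolded planted_def]
  define x where "x = \<phi> (par r)"
  define H where "H = {s \<in> S. {w0, gfst (\<kappa> s)} \<in> EG \<and> {w0, glast (\<kappa> s)} \<in> EG \<and> {x, gmid (\<kappa> s)} \<in> EG}"
  have "x \<in> W" using P(3) imW by (auto simp: x_def)
  then have "k + card D < card H" unfolding H_def using rich w0 by blast
  then have "k < card (H - D)"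
    using diff_card_le_card_Diff[of D H] DS finS finite_subset by fastforce
  also have "card (H - D) = card ((\<lambda>s. gmid (\<kappa> s)) ` (H - D))"
    by (rule card_image[symmetric], rule inj_on_subset[OF inj\<kappa>]) (auto simp: H_def)
  finally have big: "k < card ((\<lambda>s. gmid (\<kappa> s)) ` (H - D))" .
  have HA: "s \<in> A \<and> s \<noteq> root" if "s \<in> S" for s using that A0 by blast
  have "(\<lambda>s. gmid (\<kappa> s)) ` (H - D) \<subseteq> \<phi> ` A"
  proof
    fix y assume "y \<in> (\<lambda>s. gmid (\<kappa> s)) ` (H - D)"
    then obtain s where "s \<in> H - D" "y = gmid (\<kappa> s)" by blast
    then have "y = \<phi> s" "s \<in> A" using gad[of s] HA[of s] by (auto simp: H_def)
    then show "y \<in> \<phi> ` A" by blast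
  qed
  then obtain \<xi> where \<xi>: "inj_on \<xi> P" "\<xi> r \<in> (\<lambda>s. gmid (\<kappa> s)) ` (H - D)"
    "\<xi> ` (P - {r}) \<subseteq> W - \<phi> ` A - {w0}" "\<And>v. v \<in> P - {r} \<Longrightarrow> {\<xi> v, \<xi> (par v)} \<in> E"
    using rooting[OF _ big] by blast
  then obtain s where s: "s \<in> H" "s \<notin> D" "\<xi> r = gmid (\<kappa> s)" by blast
  then have sS: "s \<in> S" "s \<in> S - D" by (auto simp: H_def)
  have \<xi>r: "\<xi> r = \<phi> s" using s gad[OF sS(2)] by simp
  define \<phi>' where "\<phi>' v = (if v \<in> P then \<xi> v else if v = s then w0 else \<phi> v)" for v
  have disj: "v \<notin> P" if "v \<in> A" for v using that P(1) by blast
  have sA: "s \<in> A" "s \<noteq> root" "s \<notin> P" using HA[OF sS(1)] disj by auto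
  have val: "\<And>v. v \<in> P \<Longrightarrow> \<phi>' v = \<xi> v" "\<phi>' s = w0" "\<And>v. v \<in> A \<Longrightarrow> v \<noteq> s \<Longrightarrow> \<phi>' v = \<phi> v"
    using disj sA by (auto simp: \<phi>'_def)
  have chA: "children u \<subseteq> A" if "u \<in> S" for u using chS[OF that] A0 by blast
  have parAu: "par u \<in> A" if "u \<in> S" for u using parA HA[OF that] by blast
  have rroot: "r \<noteq> root" using P rA by blast
  have "absorbing W E S \<kappa> (A \<union> P) \<phi>' (insert s D)"
    unfolding absorbing_def
  proof (intro conjI)
    have onA: "\<phi>' v = (\<phi>(s := w0)) v" if "v \<in> A" for v using that val disj by auto
    have onP: "\<phi>' v = \<xi> v" if "v \<in> P" for v using that by (rule val(1))
    have imA: "\<phi>' ` A \<subseteq> insert w0 (\<phi> ` (A - {s}))" using onA by auto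
    have imP: "\<phi>' ` P \<subseteq> insert (\<phi> s) (W - \<phi> ` A - {w0})"
      using \<xi>(3) onP \<xi>r by auto
    have nots: "\<phi> s \<notin> \<phi> ` (A - {s})" using inj sA by (auto dest: inj_onD)
    show "inj_on \<phi>' (A \<union> P)"
      unfolding inj_on_Un
    proof (intro conjI)
      have "inj_on (\<phi>(s := w0)) A" using inj w0 by (intro inj_on_fun_updI) auto
      then show "inj_on \<phi>' A" by (subst inj_on_cong[OF onA])
      show "inj_on \<phi>' P" using \<xi>(1) by (subst inj_on_cong[OF onP])
      have "insert w0 (\<phi> ` (A - {s})) \<inter> insert (\<phi> s) (W - \<phi> ` A - {w0}) = {}"
        using nots w0 sA by auto
      then show "\<phi>' ` (A - P) \<inter> \<phi>' ` (P - A) = {}" using imA imP by blast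
    qed
    show "\<phi>' ` (A \<union> P) \<subseteq> W"
    proof -
      have "insert w0 (\<phi> ` (A - {s})) \<subseteq> W" "insert (\<phi> s) (W - \<phi> ` A - {w0}) \<subseteq> W"
        using imW sA w0 by auto
      then show ?thesis unfolding image_Un using imA imP order_trans Un_least by metis
    qed
    show "\<forall>v\<in>A \<union> P - {root}. {\<phi>' v, \<phi>' (par v)} \<in> E"
    proof
      fix v assume v: "v \<in> A \<union> P - {root}"
      consider "v \<in> P" "v \<noteq> r" | "v = r" | "v \<in> A" "v = s" | "v \<in> A" "v \<noteq> s" "par v = s" | "v \<in> A" "v \<noteq> s" "par v \<noteq> s"
        using v by blast
      then show "{\<phi>' v, \<phi>' (par v)} \<in> E"
      proof cases
        case 1
        then show ?thesis using \<xi>(4) P(4) val(1) by auto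
      next
        case 2
        \<comment> \<open>The children of a site lie in \<open>A\<close>, but \<open>r\<close> does
          not; so \<open>par r\<close> differs from \<open>s\<close> and has not moved.\<close>
        have rch: "r \<notin> children s" using chA[OF sS(1)] P(1,2) by blast
        then have "par r \<noteq> s" using rroot PV P(2) by (auto simp: children_def)
        then have "\<phi>' (par r) = x" using val(3) P(3) by (simp add: x_def)
        then show ?thesis using 2 val(1)[OF P(2)] s(1,3) EG by (auto simp: H_def insert_commute)
      next
        case 3
        have "par s \<noteq> s" using parS[OF sS(1)] sS by auto
        then have "\<phi>' (par s) = gfst (\<kappa> s)" using val(3) parAu sS gad by auto
        then show ?thesis using 3 val(2) s(1) EG by (auto simp: H_def)
      next
        case 4
        then have "v \<in> children s" using v AV by (auto simp: children_def)
        then have "\<phi>' v = glast (\<kappa> s)" using 4 val(3) gad[OF sS(2)] by auto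
        then show ?thesis using 4 val(2) s(1) EG by (auto simp: H_def insert_commute)
      next
        case 5
        then show ?thesis using parA v edge[of v] val(3) by auto
      qed
    qed
    show "insert s D \<subseteq> S" using DS sS by blast
    show "\<forall>u\<in>S - insert s D. planted \<phi>' u (\<kappa> u)"
    proof
      fix u assume u: "u \<in> S - insert s D"
      \<comment> \<open>Only \<open>s\<close> moves within \<open>A\<close>, and \<open>s\<close> is
        neither the parent nor a child of another site; so the other gadgets keep their
        occupants.\<close>
      have "par u \<noteq> s" "\<And>c. c \<in> children u \<Longrightarrow> c \<noteq> s"
        using parS[of u] parS[of s] sS u by (auto simp: children_def)
      then show "planted \<phi>' u (\<kappa> u)"
        using u gad[of u] val(3) HA[of u] parAu[of u] chA[of u] by (auto simp: planted_def)
    qed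
  qed
  then show ?thesis by blast
qed

text \<open>A budget for absorptions. The last \<open>u\<close> vertices are kept back, so that
  there is room for \<open>root_piece\<close> while pieces are embedded. All pieces but possibly one
  have at least \<open>K\<close> vertices, so there are at most \<open>card V div K + 1\<close> of
  them; the last \<open>u\<close> vertices are absorbed singly. The bound \<open>rich\<close>
  ensures that, after the \<open>t\<close> gadgets that are never planted and one spent gadget per
  absorption, more than \<open>d * t\<close> centres remain for the next root. By
  \<open>exit\<close> the rest of the tree is attached to \<open>A0\<close> only at the root, so the
  children of sites lie in \<open>A0\<close>.\<close>

theorem embed_spanning:
  fixes W :: "'v set"
  assumes deg: "\<And>z. z \<in> V \<Longrightarrow> card (children z) \<le> d" and d: "d \<ge> 1" and K: "K \<ge> 1"
    and finW: "finite W" and cardW: "card W = card V"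
    and join: "joins_large W ER t" and t: "t \<ge> 1"
    and EGW: "\<And>x. nbs EG x \<subseteq> W"
    and Q: "gadget_system W ER Q" "t \<le> card Q"
    and A0: "parent_closed A0"
    and exit: "\<And>u. u \<in> V - A0 \<Longrightarrow> par u \<in> A0 \<Longrightarrow> u = w \<and> par u = root"
    and cardA0: "card A0 \<ge> 2 * (1 + d + d * d) + 2 * (4 * (2 + d + d * d)) * (card Q - t)"
    and mindeg: "\<And>x. x \<in> W \<Longrightarrow> card A0 + 3 * card Q + t \<le> card (nbs EG x)"
    and u: "1 + d * K * ((d + 1) * t) \<le> u" "u + card A0 \<le> card V"
    and rich: "\<And>w x. w \<in> W \<Longrightarrow> x \<in> W \<Longrightarrow> t + d * t + card V div K + 1 + u <
      card {g \<in> Q. {w, gfst g} \<in> EG \<and> {w, glast g} \<in> EG \<and> {x, gmid g} \<in> EG}"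
  shows "\<exists>\<phi>. inj_on \<phi> V \<and> \<phi> ` V \<subseteq> W \<and> (\<forall>v\<in>V - {root}. {\<phi> v, \<phi> (par v)} \<in> EG \<union> ER)"
proof -
  interpret A0: rooted_tree A0 root par rk using parent_closed_sub A0 .
  have A0V: "A0 \<subseteq> V" and rA0: "root \<in> A0" and parA0: "\<And>v. v \<in> A0 - {root} \<Longrightarrow> par v \<in> A0"
    using A0 by (auto simp: parent_closed_def)
  have finQ: "finite Q" using Q by (simp add: gadget_system_def)
  have neW: "W \<noteq> {}" using cardW rootV finV by auto
  have ch0: "A0.children z = children z \<inter> A0" for z
    using A0V by (auto simp: children_def A0.children_def)
  have ch1: "A0.children z = children z" if "z \<noteq> root" "z \<in> A0" for z
  proof -
    have "c \<in> A0" if "c \<in> children z" for c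
      using exit[of c] that \<open>z \<noteq> root\<close> \<open>z \<in> A0\<close> by (auto simp: children_def)
    then show ?thesis using ch0 by blast
  qed
  have deg0: "card (A0.children z) \<le> d" if "z \<in> A0" for z
  proof -
    have "card (A0.children z) \<le> card (children z)" unfolding ch0 by (intro card_mono) auto
    then show ?thesis using deg[of z] A0V that by (meson le_trans subsetD)
  qed
  have "\<exists>S. card S = card Q - t \<and> finite S \<and> (\<forall>s\<in>S. A0.site s) \<and>
    (\<forall>s\<in>S. \<forall>s'\<in>S. s \<noteq> s' \<longrightarrow> A0.site_set s \<inter> A0.site_set s' = {})"
    by (rule A0.exists_sites[OF _ cardA0]) (rule deg0)
  then obtain S where S0: "card S = card Q - t" "finite S" "\<forall>s\<in>S. A0.site s"
    "\<forall>s\<in>S. \<forall>s'\<in>S. s \<noteq> s' \<longrightarrow> A0.site_set s \<inter> A0.site_set s' = {}"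
    by (elim exE conjE) (rule that, assumption+)
  note S = S0(1,2) S0(3)[rule_format] S0(4)[rule_format]
  have cS: "card S + t \<le> card Q" using S(1) Q(2) by simp
  have "\<exists>\<phi> \<kappa>. inj_on \<phi> A0 \<and> \<phi> ` A0 \<subseteq> W \<and> (\<forall>v\<in>A0 - {root}. {\<phi> v, \<phi> (par v)} \<in> EG \<union> ER) \<and>
    inj_on \<kappa> S \<and> \<kappa> ` S \<subseteq> Q \<and>
    (\<forall>s\<in>S. A0.planted \<phi> s (\<kappa> s))"
    by (rule A0.embed_with_gadgets[OF finW join t EGW neW Q(1) S(2) _ _ cS])
      (erule S(3), rule S(4), assumption+, erule mindeg)
  then obtain \<phi>0 \<kappa> where \<phi>0: "inj_on \<phi>0 A0" "\<phi>0 ` A0 \<subseteq> W"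
      "\<forall>v\<in>A0 - {root}. {\<phi>0 v, \<phi>0 (par v)} \<in> EG \<union> ER"
    and \<kappa>: "inj_on \<kappa> S" "\<kappa> ` S \<subseteq> Q"
    and gad: "\<forall>s\<in>S. A0.planted \<phi>0 s (\<kappa> s)"
    by (elim exE conjE) (rule that, assumption+)
  have SA0: "S \<subseteq> A0 - {root}" using S(3) by (auto simp: A0.site_def)
  have chS: "children s \<subseteq> A0" "A0.children s = children s" if "s \<in> S" for s
    using ch1[of s] ch0[of s] SA0 that by blast+
  have parS: "par s \<notin> S" if "s \<in> S" for s
  proof
    assume ps: "par s \<in> S"
    have "rk (par s) < rk s" using rk_par SA0 A0V that by blast
    then have "par s \<noteq> s" by auto
    moreover have "par s \<in> A0.site_set s \<inter> A0.site_set (par s)" by (auto simp: A0.site_set_def)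
    ultimately show False using S(4)[OF that ps] by auto
  qed
  have inj\<kappa>: "inj_on (\<lambda>s. gmid (\<kappa> s)) S"
  proof (rule inj_onI, rule ccontr)
    fix s s' assume s: "s \<in> S" "s' \<in> S" "gmid (\<kappa> s) = gmid (\<kappa> s')" "s \<noteq> s'"
    then have "\<kappa> s \<noteq> \<kappa> s'" "\<kappa> s \<in> Q" "\<kappa> s' \<in> Q" using \<kappa> by (auto dest: inj_onD)
    then have "gverts (\<kappa> s) \<inter> gverts (\<kappa> s') = {}" using Q by (auto simp: gadget_system_def)
    then show False using s(3) by (auto simp: gverts_alt)
  qed
  have richS: "d * t + card V div K + 1 + u <
      card {s \<in> S. {w, gfst (\<kappa> s)} \<in> EG \<and> {w, glast (\<kappa> s)} \<in> EG \<and> {x, gmid (\<kappa> s)} \<in> EG}"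
    if "w \<in> W" "x \<in> W" for w x
  proof -
    let ?p = "\<lambda>g. {w, gfst g} \<in> EG \<and> {w, glast g} \<in> EG \<and> {x, gmid g} \<in> EG"
    have "{g \<in> Q. ?p g} \<subseteq> (Q - \<kappa> ` S) \<union> \<kappa> ` {s \<in> S. ?p (\<kappa> s)}" by blast
    then have "card {g \<in> Q. ?p g} \<le> card ((Q - \<kappa> ` S) \<union> \<kappa> ` {s \<in> S. ?p (\<kappa> s)})"
      using finQ S(2) by (intro card_mono) auto
    also have "\<dots> \<le> card (Q - \<kappa> ` S) + card {s \<in> S. ?p (\<kappa> s)}"
      using S(2) by (intro order_trans[OF card_Un_le] add_left_mono card_image_le) auto
    also have "card (Q - \<kappa> ` S) = t"
      using card_Diff_subset[of "\<kappa> ` S" Q] S(1,2) \<kappa> Q(2) card_image[OF \<kappa>(1)] by simp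
    finally show ?thesis using rich[OF that] by linarith
  qed
  define st where "st = absorbing W (EG \<union> ER) S \<kappa>"
  have st0: "st A0 \<phi>0 {}"
    using \<phi>0 gad chS(2) by (auto simp: st_def absorbing_def planted_def A0.planted_def)
  \<comment> \<open>A single vertex needs no room besides \<open>w0\<close>, so room is demanded
    only of larger pieces: at least \<open>u\<close> vertices are then unoccupied, one of them is
    \<open>w0\<close>, and the others suffice for \<open>root_piece\<close>.\<close>
  have absorb: "\<exists>\<phi>' D'. st (A \<union> P) \<phi>' D' \<and> card D' \<le> card D + 1"
    if A: "parent_closed A" "A0 \<subseteq> A" "st A \<phi> D"
      and P: "P \<subseteq> V" "P \<inter> A = {}" "r \<in> P" "par r \<in> A" "\<And>v. v \<in> P - {r} \<Longrightarrow> par v \<in> P"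
      and D: "card D \<le> card V div K + u"
      and size: "P = {r} \<or> card P \<le> d * K \<and> u + card A \<le> card V"
    for A \<phi> D P r
  proof -
    have AV: "A \<subseteq> V" using A by (auto simp: parent_closed_def)
    have finA: "finite A" using AV finV finite_subset by blast
    have inj: "inj_on \<phi> A" "\<phi> ` A \<subseteq> W" using A(3) by (auto simp: st_def absorbing_def)
    have cardim: "card (\<phi> ` A) = card A" using inj by (simp add: card_image)
    have "A \<subset> V" using AV P by blast
    then have "card A < card V" using finV psubset_card_mono by blast
    then have "\<phi> ` A \<noteq> W" using cardim cardW by auto
    then obtain w0 where w0: "w0 \<in> W - \<phi> ` A" using inj by blast
    have rooting: "\<exists>\<xi>. inj_on \<xi> P \<and> \<xi> r \<in> Y \<and> \<xi> ` (P - {r}) \<subseteq> W - \<phi> ` A - {w0} \<and>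
        (\<forall>v\<in>P - {r}. {\<xi> v, \<xi> (par v)} \<in> EG \<union> ER)"
      if Y: "Y \<subseteq> \<phi> ` A" "d * t < card Y" for Y
    proof (cases "P = {r}")
      case True
      obtain y where "y \<in> Y" using Y by fastforce
      then show ?thesis using True by (intro exI[of _ "\<lambda>_. y"]) auto
    next
      case False
      interpret P: rooted_tree P r par rk
      proof
        show "finite P" using P(1) finV finite_subset by blast
        show "r \<in> P" by fact
        fix v assume v: "v \<in> P - {r}"
        then show "par v \<in> P" by (rule P(5))
        have "root \<notin> P" using P(2) A(1) by (auto simp: parent_closed_def)
        then show "rk (par v) < rk v" using rk_par v P(1) by blast
      qed
      have rP: "root \<notin> P" using P(2) A(1) by (auto simp: parent_closed_def)
      have degP: "card (P.children z) \<le> d" if "z \<in> P" for z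
      proof -
        have "P.children z \<subseteq> children z" using P(1) rP by (auto simp: children_def P.children_def)
        then show ?thesis using deg[of z] card_mono[OF finite_children] P(1) that by (meson le_trans subsetD)
      qed
      let ?U = "W - \<phi> ` A - {w0}"
      have "card ?U = card W - card A - 1"
        using w0 inj finW finA cardim by (subst card_Diff_singleton) (auto simp: card_Diff_subset)
      then have "d * K * ((d + 1) * t) \<le> card ?U" using size False u(1) cardW by linarith
      moreover have "card P * ((d + 1) * t) \<le> d * K * ((d + 1) * t)" using size False by (intro mult_right_mono) auto
      ultimately have cU: "card P * ((d + 1) * t) \<le> card ?U" by linarith
      have YU: "Y \<subseteq> W - ?U" and UW: "?U \<subseteq> W" using Y inj by auto
      have "\<exists>\<xi>. inj_on \<xi> P \<and> \<xi> r \<in> Y \<and> \<xi> ` (P - {r}) \<subseteq> ?U \<and> (\<forall>v\<in>P - {r}. {\<xi> v, \<xi> (par v)} \<in> ER)"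
        by (rule P.root_piece[OF _ finW join UW cU YU Y(2)]) (erule degP)
      then show ?thesis by auto
    qed
    have richD: "d * t + card D < card {s \<in> S. {w, gfst (\<kappa> s)} \<in> EG \<and> {w, glast (\<kappa> s)} \<in> EG \<and> {x, gmid (\<kappa> s)} \<in> EG}"
      if "w \<in> W" "x \<in> W" for w x using richS[OF that] D by linarith
    have "\<exists>\<phi>' s. absorbing W (EG \<union> ER) S \<kappa> (A \<union> P) \<phi>' (insert s D)"
      by (rule absorb_piece[OF A(1,2) SA0 _ _ S(2) inj\<kappa> A(3)[unfolded st_def] Un_upper1 _ P(1-4) _ w0, of "d * t"])
        (erule chS(1), erule parS, erule richD, assumption, erule P(5), erule rooting)
    then obtain \<phi>' s where "absorbing W (EG \<union> ER) S \<kappa> (A \<union> P) \<phi>' (insert s D)" by blast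
    moreover have "card (insert s D) \<le> card D + 1" using card_insert_le_m1[of "card D + 1" D s] by simp
    ultimately show ?thesis unfolding st_def by blast
  qed
  \<comment> \<open>The additive \<open>K\<close> pays for the one piece that may have fewer than
    \<open>K\<close> vertices: the remainder next to \<open>A0\<close>, which is embedded
    first.\<close>
  have phase2: "\<exists>\<phi> D. st A \<phi> D \<and> card D * K \<le> card (A - A0) + K"
    if "parent_closed A" "A0 \<subseteq> A" "u + card A \<le> card V" for A
    using that
  proof (induction "card A" arbitrary: A rule: less_induct)
    case less
    have AV: "A \<subseteq> V" using less.prems by (auto simp: parent_closed_def)
    have finA: "finite A" using AV finV finite_subset by blast
    show ?case
    proof (cases "K \<le> card (A - A0)")
      case True
      obtain P x where P: "P \<subseteq> A - A0" "K \<le> card P" "card P \<le> d * K" "parent_closed (A - P)"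
        "x \<in> P" "par x \<in> A - P" "\<forall>v\<in>P - {x}. par v \<in> P"
      proof -
        have "\<exists>P x. P \<subseteq> A - A0 \<and> K \<le> card P \<and> card P \<le> d * K \<and> parent_closed (A - P) \<and>
          x \<in> P \<and> par x \<in> A - P \<and> (\<forall>v\<in>P - {x}. par v \<in> P)"
          by (rule exists_piece[OF A0 less.prems(1,2) True, of w d]) (use exit deg d K in auto)
        then show thesis by (elim exE conjE) (rule that, assumption+)
      qed
      have finP: "finite P" using P(1) finA finite_subset by blast
      have "A - P \<subset> A" using P by blast
      then have lt: "card (A - P) < card A" using finA psubset_card_mono by blast
      moreover have sub: "A0 \<subseteq> A - P" using P less.prems by blast
      ultimately obtain \<phi> D where st: "st (A - P) \<phi> D" "card D * K \<le> card (A - P - A0) + K"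
        using less.hyps[of "A - P"] P(4) less.prems(3) by auto
      have "card (A - P - A0) + card P = card (A - A0)"
      proof -
        have "A - P - A0 = (A - A0) - P" by blast
        then show ?thesis using P(1) finA finP card_mono[of "A - A0" P] by (simp add: card_Diff_subset)
      qed
      then have Dle: "card D * K + K \<le> card (A - A0) + K" using st(2) P(2) by linarith
      have "card (A - A0) \<le> card V" using finV AV by (intro card_mono) auto
      then have "card D * K \<le> card V" using Dle by linarith
      then have "card D \<le> card V div K" using K by (simp add: less_eq_div_iff_mult_less_eq)
      then obtain \<phi>' D' where "st (A - P \<union> P) \<phi>' D'" "card D' \<le> card D + 1"
        using absorb[OF P(4) sub st(1), of P x] P AV lt less.prems(3) by fastforce
      moreover have "A - P \<union> P = A" using P(1) by blast
      moreover have "card D' * K \<le> card (A - A0) + K"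
        using Dle mult_right_mono[OF \<open>card D' \<le> card D + 1\<close>, of K] by (simp add: add.commute)
      ultimately show ?thesis by auto
    next
      case small: False
      show ?thesis
      proof (cases "A = A0")
        case True
        then show ?thesis using st0 by (intro exI[of _ \<phi>0] exI[of _ "{}"]) auto
      next
        case False
        interpret A: rooted_tree A root par rk using parent_closed_sub less.prems by blast
        have "A.parent_closed A0" using A0 less.prems by (auto simp: parent_closed_def A.parent_closed_def)
        then obtain x where x: "x \<in> A - A0" "par x \<in> A0" using A.parent_closed_exit False by blast
        have parP: "par v \<in> A - A0" if "v \<in> A - A0 - {x}" for v
        proof -
          have "par v \<in> A" using A.parV that rA0 by blast
          moreover have "par v \<notin> A0" using exit[of v] exit[of x] x that AV by blast
          ultimately show ?thesis by blast
        qed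
        have "card (A - A0) \<le> d * K" using small d by (cases d) auto
        moreover have "u + card A0 \<le> card V" by fact
        ultimately obtain \<phi>' D' where "st (A0 \<union> (A - A0)) \<phi>' D'" "card D' \<le> card ({} :: 'a set) + 1"
          using absorb[OF A0 order_refl st0, of "A - A0" x] x parP AV by fastforce
        moreover have "A0 \<union> (A - A0) = A" using less.prems by blast
        moreover have "card D' * K \<le> card (A - A0) + K" using calculation(2) by (cases "card D'") auto
        ultimately show ?thesis by auto
      qed
    qed
  qed
  obtain A1 where A1: "parent_closed A1" "A0 \<subseteq> A1" "card A1 = card V - u"
    using parent_closed_card[OF A0 _ diff_le_self] u(2) by (metis add.commute add_le_imp_le_diff)
  have A1V: "A1 \<subseteq> V" using A1 by (auto simp: parent_closed_def)
  have uV: "u \<le> card V" using u(2) by simp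
  obtain \<phi>1 D1 where 1: "st A1 \<phi>1 D1" "card D1 * K \<le> card (A1 - A0) + K"
    using phase2[OF A1(1,2)] A1(3) uV by auto
  have "card (A1 - A0) \<le> card V" using finV A1V by (intro card_mono) auto
  then have "card D1 * K \<le> card V + K" using 1(2) by linarith
  then have "card D1 * K div K \<le> (card V + K) div K" by (rule div_le_mono)
  then have D1: "card D1 \<le> card V div K + 1" using K by simp
  have "\<exists>\<phi> D. st V \<phi> D \<and> card D \<le> card V div K + 1 + card (V - A1)"
  proof (rule parent_closed_induct[OF parent_closed_V A1(1) A1V,
        where P = "\<lambda>A. \<exists>\<phi> D. st A \<phi> D \<and> card D \<le> card V div K + 1 + card (A - A1)"])
    show "\<exists>\<phi> D. st A1 \<phi> D \<and> card D \<le> card V div K + 1 + card (A1 - A1)" using 1 D1 by auto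
    fix A x assume A: "parent_closed A" "A1 \<subseteq> A" "x \<in> V - A" "par x \<in> A"
      and "\<exists>\<phi> D. st A \<phi> D \<and> card D \<le> card V div K + 1 + card (A - A1)"
    then obtain \<phi> D where st: "st A \<phi> D" "card D \<le> card V div K + 1 + card (A - A1)" by blast
    have AV: "A \<subseteq> V" and finA: "finite A" using A(1) finV finite_subset by (auto simp: parent_closed_def)
    have "x \<notin> A1" using A(2,3) by blast
    then have "card (insert x A - A1) = Suc (card (A - A1))"
      using A finA by (simp add: insert_Diff_if)
    moreover have "card (insert x A - A1) \<le> card (V - A1)" using A AV finV by (intro card_mono) auto
    moreover have "card (V - A1) = u" using A1(3) A1V finV uV by (simp add: card_Diff_subset finite_subset)
    ultimately have "card D \<le> card V div K + u" and *: "card D + 1 \<le> card V div K + 1 + card (insert x A - A1)"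
      using st(2) by linarith+
    then obtain \<phi>' D' where "st (A \<union> {x}) \<phi>' D'" "card D' \<le> card D + 1"
      using absorb[OF A(1) order_trans[OF A1(2) A(2)] st(1), of "{x}" x] A(3,4) by auto
    then show "\<exists>\<phi> D. st (insert x A) \<phi> D \<and> card D \<le> card V div K + 1 + card (insert x A - A1)"
      using * by (intro exI[of _ \<phi>'] exI[of _ D']) auto
  qed
  then show ?thesis unfolding st_def absorbing_def by blast
qed

end

section \<open>Gadget systems by multiplicative weights\<close>

text \<open>Averaging: the terms below \<open>c\<close> contribute at most \<open>card A * c\<close>
  altogether, each of the others at most \<open>M\<close>.\<close>

lemma many_large_terms:
  fixes f :: "'b \<Rightarrow> real"
  assumes "finite A" and up: "\<And>x. x \<in> A \<Longrightarrow> f x \<le> M" and "M > 0" "c \<ge> 0"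
    and tot: "real (card A) * c + l * M \<le> sum f A"
  shows "l \<le> real (card {x \<in> A. c \<le> f x})"
proof -
  let ?B = "{x \<in> A. c \<le> f x}"
  have "sum f A = sum f ?B + sum f (A - ?B)"
    using \<open>finite A\<close> by (intro sum.subset_diff[THEN trans]) (auto simp: add.commute)
  also have "sum f ?B \<le> (\<Sum>x\<in>?B. M)" using up by (intro sum_mono) auto
  also have "sum f (A - ?B) \<le> (\<Sum>x\<in>A - ?B. c)" by (intro sum_mono) auto
  also have "(\<Sum>x\<in>A - ?B. c) \<le> real (card A) * c"
    using \<open>finite A\<close> \<open>c \<ge> 0\<close> by (simp, intro mult_right_mono) (auto intro!: card_mono)
  finally have "l * M \<le> real (card ?B) * M" using tot by simp
  then show ?thesis using \<open>M > 0\<close> by simp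
qed

definition serves :: "'v set set \<Rightarrow> 'v \<times> 'v \<Rightarrow> 'v gadget \<Rightarrow> bool" where
  "serves E p g \<longleftrightarrow> {fst p, gfst g} \<in> E \<and> {fst p, glast g} \<in> E \<and> {snd p, gmid g} \<in> E"

definition weight :: "'v set set \<Rightarrow> 'v gadget set \<Rightarrow> 'v \<times> 'v \<Rightarrow> real" where
  "weight E Q p = (1/2) ^ card {g \<in> Q. serves E p g}"

definition potential :: "'v set \<Rightarrow> 'v set set \<Rightarrow> 'v gadget set \<Rightarrow> real" where
  "potential W E Q = (\<Sum>p\<in>W \<times> W. weight E Q p)"

definition gain :: "'v set \<Rightarrow> 'v set set \<Rightarrow> 'v gadget set \<Rightarrow> 'v gadget \<Rightarrow> real" where
  "gain W E Q g = (\<Sum>p\<in>W \<times> W. if serves E p g then weight E Q p else 0)"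

text \<open>The random edges do not enter here: the set is determined by \<open>E\<close> and the
  gadgets chosen so far. This allows the events of the union bound to be indexed by
  \<open>Q\<close>.\<close>

definition useful :: "'v set \<Rightarrow> 'v set set \<Rightarrow> real \<Rightarrow> 'v gadget set \<Rightarrow> 'v gadget set" where
  "useful W E \<kappa> Q = {g \<in> W \<times> W \<times> W. card (gverts g) = 3 \<and> gverts g \<inter> (\<Union>h\<in>Q. gverts h) = {} \<and>
     \<kappa> * potential W E Q \<le> gain W E Q g}"

lemma weight_pos: "weight E Q p > 0"
  by (simp add: weight_def)

lemma potential_pos: "finite W \<Longrightarrow> W \<noteq> {} \<Longrightarrow> potential W E Q > 0"
  unfolding potential_def by (intro sum_pos weight_pos) auto

lemma gain_le_potential: "gain W E Q g \<le> potential W E Q"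
  unfolding gain_def potential_def by (intro sum_mono) (auto intro: less_imp_le weight_pos)

lemma potential_insert:
  assumes "finite Q" "g \<notin> Q"
  shows "potential W E (insert g Q) = potential W E Q - gain W E Q g / 2"
proof -
  have "weight E (insert g Q) p = weight E Q p - (if serves E p g then weight E Q p else 0) / 2" for p
  proof (cases "serves E p g")
    case True
    have "{h \<in> insert g Q. serves E p h} = insert g {h \<in> Q. serves E p h}" using True by auto
    then have "card {h \<in> insert g Q. serves E p h} = Suc (card {h \<in> Q. serves E p h})"
      using assms by simp
    then show ?thesis using True by (simp add: weight_def)
  next
    case False
    then have "{h \<in> insert g Q. serves E p h} = {h \<in> Q. serves E p h}" by auto
    then show ?thesis using False by (simp add: weight_def)
  qed
  then show ?thesis by (simp add: potential_def gain_def sum_subtractf sum_divide_distrib)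
qed

lemma card_serving:
  assumes "finite W" "\<And>x. nbs E x \<subseteq> W"
  shows "card {g \<in> W \<times> W \<times> W. serves E p g} = card (nbs E (fst p)) ^ 2 * card (nbs E (snd p))"
proof -
  have "{g \<in> W \<times> W \<times> W. serves E p g} = nbs E (fst p) \<times> nbs E (snd p) \<times> nbs E (fst p)"
    using assms(2)[of "fst p"] assms(2)[of "snd p"]
    by (auto simp: serves_def nbs_def gfst_def gmid_def glast_def)
  then show ?thesis by (simp add: card_cartesian_product power2_eq_square)
qed

lemma card_bad_triples:
  assumes finW: "finite W" and U: "U \<subseteq> W"
  shows "card {g \<in> W \<times> W \<times> W. card (gverts g) \<noteq> 3 \<or> gverts g \<inter> U \<noteq> {}} \<le> card W ^ 2 * (3 * card U + 3)"
proof -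
  have finU: "finite U" using U finW finite_subset by blast
  let ?D1 = "(\<lambda>(x, y). (x, x, y)) ` (W \<times> W)" and ?D2 = "(\<lambda>(x, y). (x, y, y)) ` (W \<times> W)"
    and ?D3 = "(\<lambda>(x, y). (x, y, x)) ` (W \<times> W)"
  have D: "card ?D1 \<le> card W ^ 2" "card ?D2 \<le> card W ^ 2" "card ?D3 \<le> card W ^ 2"
    using finW by (auto intro!: order_trans[OF card_image_le] simp: card_cartesian_product power2_eq_square)
  have "{g \<in> W \<times> W \<times> W. card (gverts g) \<noteq> 3 \<or> gverts g \<inter> U \<noteq> {}} \<subseteq>
     (?D1 \<union> ?D2 \<union> ?D3) \<union> ((U \<times> W \<times> W) \<union> (W \<times> U \<times> W) \<union> (W \<times> W \<times> U))"
  proof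
    fix g assume g: "g \<in> {g \<in> W \<times> W \<times> W. card (gverts g) \<noteq> 3 \<or> gverts g \<inter> U \<noteq> {}}"
    obtain a y b where [simp]: "g = (a, y, b)" by (cases g) auto
    have W: "a \<in> W" "y \<in> W" "b \<in> W" using g by auto
    consider "a = y" | "y = b" | "a = b" | "a \<noteq> y" "y \<noteq> b" "a \<noteq> b" by blast
    then show "g \<in> (?D1 \<union> ?D2 \<union> ?D3) \<union> ((U \<times> W \<times> W) \<union> (W \<times> U \<times> W) \<union> (W \<times> W \<times> U))"
    proof cases
      case 4
      then have "a \<in> U \<or> y \<in> U \<or> b \<in> U" using g by auto
      then show ?thesis using W by auto
    qed (use W in auto)
  qed
  then have "card {g \<in> W \<times> W \<times> W. card (gverts g) \<noteq> 3 \<or> gverts g \<inter> U \<noteq> {}} \<le>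
      card ((?D1 \<union> ?D2 \<union> ?D3) \<union> ((U \<times> W \<times> W) \<union> (W \<times> U \<times> W) \<union> (W \<times> W \<times> U)))"
    using finW finU by (intro card_mono) auto
  also have "\<dots> \<le> (card W ^ 2 + card W ^ 2 + card W ^ 2) + (card (U \<times> W \<times> W) + card (W \<times> U \<times> W) + card (W \<times> W \<times> U))"
    by (intro order_trans[OF card_Un_le] add_mono D order_refl)
  also have "\<dots> = card W ^ 2 * (3 * card U + 3)"
    by (simp add: card_cartesian_product power2_eq_square algebra_simps)
  finally show ?thesis .
qed

text \<open>Double counting: every pair is served by at least \<open>(\<delta> * n)^3\<close>
  triples, so all gains add up to at least \<open>\<delta>^3 * n^3\<close> times the potential.
  Degenerate triples and triples meeting \<open>Q\<close> number at most
  \<open>n^2 * (9 * card Q + 3)\<close> and account for at most half of this, since no gain exceeds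
  the potential. Triples whose gain is below \<kappa> times the potential account for at most half
  of what is left, whence \<open>\<kappa> = \<delta>^3 / 4\<close>.\<close>

lemma card_useful:
  fixes W :: "'v set" and \<delta> \<kappa> :: real
  assumes finW: "finite W" and n: "card W = n" "n > 0" and EW: "\<And>x. nbs E x \<subseteq> W"
    and \<delta>: "0 < \<delta>" "\<And>x. x \<in> W \<Longrightarrow> \<delta> * n \<le> card (nbs E x)"
    and Q: "gadget_system W R Q" and small: "9 * card Q + 3 \<le> \<delta>^3 / 2 * n"
    and \<kappa>: "\<kappa> = \<delta>^3 / 4"
  shows "\<kappa> * n^3 \<le> card (useful W E \<kappa> Q)"
proof -
  let ?T = "W \<times> W \<times> W" and ?\<Phi> = "potential W E Q"
  have \<kappa>0: "\<kappa> > 0" unfolding \<kappa> using \<delta>(1) by simp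
  have \<Phi>: "?\<Phi> > 0" using potential_pos finW n by fastforce
  define U where "U = (\<Union>h\<in>Q. gverts h)"
  have finQ: "finite Q" using Q by (simp add: gadget_system_def)
  have "card U \<le> (\<Sum>g\<in>Q. card (gverts g))" unfolding U_def by (rule card_UN_le[OF finQ])
  also have "\<dots> = (\<Sum>g\<in>Q. 3)" using Q by (intro sum.cong) (auto simp: gadget_system_def)
  finally have cardU: "card U \<le> 3 * card Q" by simp
  have UW: "U \<subseteq> W" using Q by (auto simp: U_def gadget_system_def)
  define B where "B = {g \<in> ?T. card (gverts g) \<noteq> 3 \<or> gverts g \<inter> U \<noteq> {}}"
  have finB: "finite B" "B \<subseteq> ?T" using finW by (auto simp: B_def)
  have "real (card B) \<le> real (n ^ 2 * (3 * card U + 3))"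
    unfolding B_def of_nat_le_iff using card_bad_triples[OF finW UW] n by simp
  also have "\<dots> \<le> real n ^ 2 * (9 * card Q + 3)"
    using cardU by (simp add: mult_left_mono)
  also have "\<dots> \<le> real n ^ 2 * (\<delta>^3 / 2 * n)" using small by (intro mult_left_mono) auto
  finally have cardB: "real (card B) \<le> \<delta>^3 / 2 * n^3" by (simp add: power2_eq_square power3_eq_cube ac_simps)
  have "(\<Sum>g\<in>?T. gain W E Q g) = (\<Sum>p\<in>W \<times> W. \<Sum>g\<in>?T. if serves E p g then weight E Q p else 0)"
    unfolding gain_def by (rule sum.swap)
  also have "\<dots> = (\<Sum>p\<in>W \<times> W. weight E Q p * card {g \<in> ?T. serves E p g})"
    using finW by (intro sum.cong refl) (simp add: sum.If_cases Int_def)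
  also have "\<dots> \<ge> (\<Sum>p\<in>W \<times> W. weight E Q p * (\<delta>^3 * n^3))"
  proof (intro sum_mono mult_left_mono)
    fix p assume p: "p \<in> W \<times> W"
    have "\<delta>^3 * n^3 = (\<delta> * n)^2 * (\<delta> * n)" by (simp add: power2_eq_square power3_eq_cube)
    also have "\<dots> \<le> real (card (nbs E (fst p))) ^ 2 * card (nbs E (snd p))"
      using p \<delta> by (intro mult_mono power_mono) auto
    finally show "\<delta>^3 * n^3 \<le> card {g \<in> ?T. serves E p g}"
      using card_serving[OF finW EW] by simp
  qed (auto intro: less_imp_le weight_pos)
  finally have "\<delta>^3 * n^3 * ?\<Phi> \<le> (\<Sum>g\<in>?T. gain W E Q g)"
    by (simp add: potential_def sum_distrib_left sum_distrib_right mult.commute)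
  also have "\<dots> = (\<Sum>g\<in>?T - B. gain W E Q g) + (\<Sum>g\<in>B. gain W E Q g)"
    using finB finW by (intro sum.subset_diff) auto
  also have "(\<Sum>g\<in>B. gain W E Q g) \<le> card B * ?\<Phi>"
  proof -
    have "(\<Sum>g\<in>B. gain W E Q g) \<le> (\<Sum>g\<in>B. ?\<Phi>)" by (intro sum_mono gain_le_potential)
    then show ?thesis by simp
  qed
  also have "card B * ?\<Phi> \<le> \<delta>^3 / 2 * n^3 * ?\<Phi>" using cardB \<Phi> by (intro mult_right_mono) auto
  finally have big: "\<delta>^3 / 2 * n^3 * ?\<Phi> \<le> (\<Sum>g\<in>?T - B. gain W E Q g)" by (simp add: algebra_simps)
  have "card (?T - B) \<le> card ?T" using finW by (intro card_mono) auto
  then have "card (?T - B) \<le> n^3" using n by (simp add: card_cartesian_product power3_eq_cube mult.assoc)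
  then have "real (card (?T - B)) \<le> real n^3" by (metis of_nat_le_iff of_nat_power)
  then have "real (card (?T - B)) * (\<kappa> * ?\<Phi>) \<le> real n^3 * (\<kappa> * ?\<Phi>)" using \<kappa>0 \<Phi> by (intro mult_right_mono) auto
  then have "real (card (?T - B)) * (\<kappa> * ?\<Phi>) + \<kappa> * n^3 * ?\<Phi> \<le> \<delta>^3 / 2 * n^3 * ?\<Phi>"
    unfolding \<kappa> by (simp add: algebra_simps)
  then have "\<kappa> * n^3 \<le> card {g \<in> ?T - B. \<kappa> * ?\<Phi> \<le> gain W E Q g}"
    using big finW \<Phi> \<kappa>0 gain_le_potential
    by (intro many_large_terms[where M = ?\<Phi>]) auto
  also have "{g \<in> ?T - B. \<kappa> * ?\<Phi> \<le> gain W E Q g} = useful W E \<kappa> Q"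
    unfolding useful_def B_def U_def by auto
  finally show ?thesis by simp
qed

text \<open>The sets below are kept away from \<open>Y\<close>, so that the pairs \<open>{y, z}\<close> with \<open>y \<in> Y\<close>
  arising for different \<open>y\<close> are different.\<close>

definition fan :: "'v set \<Rightarrow> 'v gadget set \<Rightarrow> nat \<Rightarrow> 'v set \<Rightarrow> ('v \<Rightarrow> 'v set) \<Rightarrow> ('v \<Rightarrow> 'v \<Rightarrow> 'v set) \<Rightarrow> bool" where
  "fan W D k Y A B \<longleftrightarrow> Y \<subseteq> W \<and> card Y = k \<and> (\<forall>y\<in>Y. A y \<subseteq> W - Y \<and> k \<le> card (A y) \<and>
     (\<forall>a\<in>A y. B y a \<subseteq> W - Y \<and> k \<le> card (B y a) \<and> (\<forall>b\<in>B y a. (a, y, b) \<in> D)))"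

text \<open>Averaging twice: at least \<open>\<kappa> * n / 2\<close> centres lie in at least
  \<open>\<kappa> * n^2 / 2\<close> triples each, and each of these has at least
  \<open>\<kappa> * n / 4\<close> first vertices with at least \<open>\<kappa> * n / 4\<close> last
  vertices. As \<open>k\<close> is at most \<open>\<kappa> * n / 8\<close>, at least
  \<open>k\<close> vertices remain in each set when \<open>Y\<close> is removed.\<close>

lemma exists_fan:
  fixes W :: "'v set" and \<kappa> :: real
  assumes finW: "finite W" and n: "card W = n" "n > 0" and D: "D \<subseteq> W \<times> W \<times> W"
    and \<kappa>: "0 < \<kappa>" "\<kappa> * n^3 \<le> card D" and k: "real k \<le> \<kappa> * n / 8"
  shows "\<exists>Y A B. fan W D k Y A B"
proof -
  have finD: "finite D" using D finW by (meson finite_SigmaI finite_subset)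
  have "0 \<le> \<kappa> * real n" using \<kappa>(1) by simp
  define Dy where "Dy y = {(a, b). (a, y, b) \<in> D}" for y
  define Bb where "Bb y a = {b. (a, y, b) \<in> D}" for y a
  define Aa where "Aa y = {a \<in> W. \<kappa> * n / 4 \<le> card (Bb y a)}" for y
  have DyW: "Dy y \<subseteq> W \<times> W" for y using D by (auto simp: Dy_def)
  have BbW: "Bb y a \<subseteq> W" for y a using D by (auto simp: Bb_def)
  have finDy: "finite (Dy y)" for y using DyW finW by (meson finite_SigmaI finite_subset)
  have "D \<subseteq> (\<Union>y\<in>W. (\<lambda>(a, b). (a, y, b)) ` Dy y)"
  proof
    fix g assume g: "g \<in> D"
    obtain a y b where abc: "g = (a, y, b)" by (cases g)
    then have "y \<in> W" "(a, b) \<in> Dy y" using g D by (auto simp: Dy_def)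
    then show "g \<in> (\<Union>y\<in>W. (\<lambda>(a, b). (a, y, b)) ` Dy y)"
      unfolding abc by (intro UN_I image_eqI[of _ _ "(a, b)"]) auto
  qed
  then have "card D \<le> card (\<Union>y\<in>W. (\<lambda>(a, b). (a, y, b)) ` Dy y)"
    using finW finDy by (intro card_mono) auto
  also have "\<dots> \<le> (\<Sum>y\<in>W. card ((\<lambda>(a, b). (a, y, b)) ` Dy y))"
    by (rule card_UN_le[OF finW])
  also have "\<dots> \<le> (\<Sum>y\<in>W. card (Dy y))"
    using DyW finW by (intro sum_mono card_image_le) (meson finite_SigmaI finite_subset)
  finally have "real (card D) \<le> (\<Sum>y\<in>W. real (card (Dy y)))" by (simp flip: of_nat_sum)
  moreover have "real (card W) * (\<kappa> * n^2 / 2) + \<kappa> * n / 2 * n^2 = \<kappa> * n^3"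
    unfolding n by (simp add: power2_eq_square power3_eq_cube)
  ultimately have "real (card W) * (\<kappa> * n^2 / 2) + \<kappa> * n / 2 * n^2 \<le> (\<Sum>y\<in>W. real (card (Dy y)))"
    using \<kappa>(2) by linarith
  moreover have "real (card (Dy y)) \<le> real n^2" for y
  proof -
    have "card (Dy y) \<le> card (W \<times> W)" using finW DyW by (intro card_mono) auto
    then show ?thesis using n by (simp add: card_cartesian_product power2_eq_square flip: of_nat_mult)
  qed
  ultimately have "\<kappa> * n / 2 \<le> card {y \<in> W. \<kappa> * n^2 / 2 \<le> card (Dy y)}"
    using finW \<kappa> n by (intro many_large_terms[where M = "real n^2"]) auto
  then have "real k \<le> card {y \<in> W. \<kappa> * n^2 / 2 \<le> card (Dy y)}"
    using k \<open>0 \<le> \<kappa> * real n\<close> by linarith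
  then obtain Y where Y: "Y \<subseteq> {y \<in> W. \<kappa> * n^2 / 2 \<le> card (Dy y)}" "card Y = k"
    using obtain_subset_with_card_n[of k] by (auto simp only: of_nat_le_iff)
  have finY: "finite Y" using Y finW finite_subset[of Y W] by blast
  have cut: "k \<le> card (Z - Y)" if "\<kappa> * n / 4 \<le> card Z" "Z \<subseteq> W" for Z
  proof -
    have "card Z - card Y \<le> card (Z - Y)" by (rule diff_card_le_card_Diff[OF finY])
    moreover have "real (2 * k) \<le> card Z" using k that(1) by (simp only: of_nat_mult of_nat_numeral)
    then have "2 * k \<le> card Z" by (simp only: of_nat_le_iff)
    ultimately show ?thesis using Y by linarith
  qed
  have Aa: "\<kappa> * n / 4 \<le> card (Aa y)" if "y \<in> Y" for y
  proof -
    have "Dy y \<subseteq> (\<Union>a\<in>W. Pair a ` Bb y a)"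
    proof
      fix g assume g: "g \<in> Dy y"
      obtain a b where ab: "g = (a, b)" by (cases g)
      then have "a \<in> W" "b \<in> Bb y a" using g DyW[of y] by (auto simp: Dy_def Bb_def)
      then show "g \<in> (\<Union>a\<in>W. Pair a ` Bb y a)" unfolding ab by blast
    qed
    moreover have "finite (Bb y a)" for a using BbW finW finite_subset by blast
    ultimately have "card (Dy y) \<le> card (\<Union>a\<in>W. Pair a ` Bb y a)"
      using finW by (intro card_mono) auto
    also have "\<dots> \<le> (\<Sum>a\<in>W. card (Pair a ` Bb y a))" by (rule card_UN_le[OF finW])
    also have "\<dots> \<le> (\<Sum>a\<in>W. card (Bb y a))"
      using BbW finW by (intro sum_mono card_image_le) (meson finite_subset)
    finally have "real (card (Dy y)) \<le> (\<Sum>a\<in>W. real (card (Bb y a)))" by (simp flip: of_nat_sum)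
    moreover have "real (card W) * (\<kappa> * n / 4) + \<kappa> * n / 4 * n = \<kappa> * n^2 / 2"
      unfolding n by (simp add: power2_eq_square)
    moreover have "\<kappa> * n^2 / 2 \<le> card (Dy y)" using Y(1) that by blast
    ultimately have "real (card W) * (\<kappa> * n / 4) + \<kappa> * n / 4 * n \<le> (\<Sum>a\<in>W. real (card (Bb y a)))"
      by linarith
    moreover have "real (card (Bb y a)) \<le> n" for a
      using BbW finW n card_mono by (metis of_nat_le_iff)
    ultimately show ?thesis unfolding Aa_def
      using finW \<kappa> n by (intro many_large_terms[where M = "real n"]) auto
  qed
  have "fan W D k Y (\<lambda>y. Aa y - Y) (\<lambda>y a. Bb y a - Y)"
    unfolding fan_def
  proof (intro conjI ballI)
    show "Y \<subseteq> W" "card Y = k" using Y by auto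
    fix y assume y: "y \<in> Y"
    show "Aa y - Y \<subseteq> W - Y" by (auto simp: Aa_def)
    show "k \<le> card (Aa y - Y)" using cut[OF Aa[OF y]] by (auto simp: Aa_def)
    fix a assume "a \<in> Aa y - Y"
    then show "k \<le> card (Bb y a - Y)" using cut[OF _ BbW] by (auto simp: Aa_def)
    show "Bb y a - Y \<subseteq> W - Y" using BbW by blast
    fix b assume "b \<in> Bb y a - Y"
    then show "(a, y, b) \<in> D" by (simp add: Bb_def)
  qed
  then show ?thesis by blast
qed

definition stuck :: "'v set set \<Rightarrow> 'v gadget set \<Rightarrow> bool" where
  "stuck R D \<longleftrightarrow> (\<forall>g\<in>D. \<not> ({gfst g, gmid g} \<in> R \<and> {gmid g, glast g} \<in> R))"

text \<open>While \<open>R\<close> is not stuck, some useful triple is a path of \<open>R\<close>.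
  Adding it halves the weight of the pairs it serves, which carry at least a fraction \<kappa> of
  the potential. The start value is the number of pairs.\<close>

lemma exists_gadget_system:
  fixes W :: "'v set"
  assumes finW: "finite W" and \<kappa>: "0 < \<kappa>" "\<kappa> \<le> 1"
    and free: "\<And>Q. gadget_system W R Q \<Longrightarrow> card Q < m \<Longrightarrow> \<not> stuck R (useful W E \<kappa> Q)"
  shows "\<exists>Q. gadget_system W R Q \<and> card Q = m \<and> potential W E Q \<le> (card W)^2 * (1 - \<kappa> / 2) ^ m"
proof -
  have "\<exists>Q. gadget_system W R Q \<and> card Q = j \<and> potential W E Q \<le> (card W)^2 * (1 - \<kappa> / 2) ^ j"
    if "j \<le> m" for j
    using that
  proof (induction j)
    case 0
    show ?case
      by (intro exI[of _ "{}"])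
        (simp add: gadget_system_def potential_def weight_def card_cartesian_product power2_eq_square)
  next
    case (Suc j)
    then obtain Q where Q: "gadget_system W R Q" "card Q = j"
      "potential W E Q \<le> (card W)^2 * (1 - \<kappa> / 2) ^ j" by auto
    then obtain g where g: "g \<in> useful W E \<kappa> Q" "{gfst g, gmid g} \<in> R" "{gmid g, glast g} \<in> R"
      using free[OF Q(1)] Suc.prems by (auto simp: stuck_def)
    have finQ: "finite Q" using Q by (simp add: gadget_system_def)
    have gv: "card (gverts g) = 3" "gverts g \<inter> (\<Union>h\<in>Q. gverts h) = {}"
      "\<kappa> * potential W E Q \<le> gain W E Q g" "gverts g \<subseteq> W"
      using g(1) by (auto simp: useful_def gverts_alt gfst_def gmid_def glast_def)
    have gQ: "g \<notin> Q"
    proof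
      assume "g \<in> Q"
      then have "gverts g = {}" using gv(2) by blast
      then show False using gv(1) by simp
    qed
    have "gadget_system W R (insert g Q)"
      using Q(1) gv g unfolding gadget_system_def by (auto simp: Int_commute)
    moreover have "potential W E (insert g Q) \<le> (1 - \<kappa> / 2) * potential W E Q"
      unfolding potential_insert[OF finQ gQ] using gv(3) by (simp add: algebra_simps)
    moreover have "(1 - \<kappa> / 2) * potential W E Q \<le> (1 - \<kappa> / 2) * ((card W)^2 * (1 - \<kappa> / 2) ^ j)"
      using Q(3) \<kappa> by (intro mult_left_mono) auto
    ultimately show ?case using finQ gQ Q(2) by (intro exI[of _ "insert g Q"]) (simp add: algebra_simps)
  qed
  then show ?thesis by blast
qed

text \<open>Passes from the total to each single pair: a tiny potential means that no pair is served
  rarely.\<close>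

lemma weight_le_potential: "finite W \<Longrightarrow> p \<in> W \<times> W \<Longrightarrow> weight E Q p \<le> potential W E Q"
  unfolding potential_def by (rule member_le_sum) (auto intro: less_imp_le weight_pos)

section \<open>The random edges\<close>

definition random_pairs :: "'v set \<Rightarrow> real \<Rightarrow> ('v set \<Rightarrow> bool) pmf" where
  "random_pairs W p = Pi_pmf (all_pairs W) False (\<lambda>_. bernoulli_pmf p)"

definition present :: "'v set \<Rightarrow> ('v set \<Rightarrow> bool) \<Rightarrow> 'v set set" where
  "present W b = {e \<in> all_pairs W. b e}"

lemma finite_all_pairs: "finite W \<Longrightarrow> finite (all_pairs W)"
  by (simp add: all_pairs_def)

lemma doubleton_all_pairs: "{x, y} \<in> all_pairs W \<longleftrightarrow> x \<in> W \<and> y \<in> W \<and> x \<noteq> y"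
  by (auto simp: all_pairs_def card_insert_if)

lemma prob_pattern:
  assumes "finite W" "A \<subseteq> all_pairs W" "B \<subseteq> all_pairs W" "A \<inter> B = {}" "0 \<le> p" "p \<le> 1"
  shows "measure_pmf.prob (random_pairs W p) {b. A \<subseteq> present W b \<and> B \<inter> present W b = {}} =
    p ^ card A * (1 - p) ^ card B"
proof -
  let ?E = "all_pairs W"
  have finE: "finite ?E" using finite_all_pairs assms by blast
  define S where "S e = (if e \<in> A then {True} else if e \<in> B then {False} else UNIV)" for e
  have "{b. A \<subseteq> present W b \<and> B \<inter> present W b = {}} = Pi ?E S"
    using assms(2-4) by (auto simp: present_def Pi_def S_def)
  then have "measure_pmf.prob (random_pairs W p) {b. A \<subseteq> present W b \<and> B \<inter> present W b = {}} =
      (\<Prod>e\<in>?E. measure_pmf.prob (bernoulli_pmf p) (S e))"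
    unfolding random_pairs_def using measure_Pi_pmf_Pi[OF finE] by simp
  also have "\<dots> = (\<Prod>e\<in>?E. (if e \<in> A then p else 1) * (if e \<in> B then 1 - p else 1))"
    using assms(4-6) by (intro prod.cong refl) (auto simp: S_def measure_pmf_single)
  also have "\<dots> = (\<Prod>e\<in>A. p) * (\<Prod>e\<in>B. 1 - p)"
    using assms(2,3) finE by (simp add: prod.distrib prod.If_cases Int_absorb1)
  finally show ?thesis by simp
qed

lemma prob_pattern_union:
  assumes "finite W" "finite I" "0 \<le> p" "p \<le> 1"
    and "\<And>i. i \<in> I \<Longrightarrow> A i \<subseteq> all_pairs W" "\<And>i. i \<in> I \<Longrightarrow> B i \<subseteq> all_pairs W"
    and "\<And>i. i \<in> I \<Longrightarrow> A i \<inter> B i = {}"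
  shows "measure_pmf.prob (random_pairs W p) {b. \<exists>i\<in>I. A i \<subseteq> present W b \<and> B i \<inter> present W b = {}} \<le>
    (\<Sum>i\<in>I. p ^ card (A i) * (1 - p) ^ card (B i))"
proof -
  have "{b. \<exists>i\<in>I. A i \<subseteq> present W b \<and> B i \<inter> present W b = {}} =
      (\<Union>i\<in>I. {b. A i \<subseteq> present W b \<and> B i \<inter> present W b = {}})" by auto
  also have "measure_pmf.prob (random_pairs W p) \<dots> \<le>
      (\<Sum>i\<in>I. measure_pmf.prob (random_pairs W p) {b. A i \<subseteq> present W b \<and> B i \<inter> present W b = {}})"
    using assms(2) by (intro measure_pmf.finite_measure_subadditive_finite) auto
  also have "\<dots> = (\<Sum>i\<in>I. p ^ card (A i) * (1 - p) ^ card (B i))"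
    using assms by (intro sum.cong refl prob_pattern) auto
  finally show ?thesis .
qed

lemma card_pairs_image:
  assumes "finite Y" "\<And>y. y \<in> Y \<Longrightarrow> finite (Z y)" "\<And>y. y \<in> Y \<Longrightarrow> Z y \<inter> Y = {}"
    and "\<And>y. y \<in> Y \<Longrightarrow> k \<le> card (Z y)"
  shows "card Y * k \<le> card ((\<lambda>(y, z). {y, z}) ` Sigma Y Z)"
proof -
  have "inj_on (\<lambda>(y, z). {y, z}) (Sigma Y Z)"
    using assms(3) by (auto simp: inj_on_def doubleton_eq_iff)
  then have "card ((\<lambda>(y, z). {y, z}) ` Sigma Y Z) = (\<Sum>y\<in>Y. card (Z y))"
    using assms(1,2) by (simp add: card_image)
  also have "\<dots> \<ge> (\<Sum>y\<in>Y. k)" using assms(4) by (intro sum_mono)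
  finally show ?thesis by simp
qed

text \<open>Two sets of size \<open>2 * s\<close> may overlap but contain disjoint subsets of size
  \<open>s\<close>, so that \<open>s * s\<close> different pairs are absent. There are at most
  \<open>4 ^ n\<close> choices of the two subsets.\<close>

lemma prob_not_joins_large:
  assumes finW: "finite W" and n: "card W = n" and p: "0 \<le> p" "p \<le> 1"
  shows "measure_pmf.prob (random_pairs W p) {b. \<not> joins_large W (present W b) (2 * s)} \<le>
    4 ^ n * (1 - p) ^ (s * s)"
proof -
  define I where "I = {(X, Y). X \<subseteq> W \<and> Y \<subseteq> W \<and> X \<inter> Y = {} \<and> card X = s \<and> card Y = s}"
  define B where "B = (\<lambda>(X, Y). (\<lambda>(x, y). {x, y}) ` (X \<times> Y :: ('a \<times> 'a) set))"
  have I: "I \<subseteq> Pow W \<times> Pow W" by (auto simp: I_def)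
  then have finI: "finite I" using finW by (meson finite_Pow_iff finite_SigmaI finite_subset)
  have "card I \<le> card (Pow W \<times> Pow W)" using I finW by (intro card_mono) auto
  also have "\<dots> = 4 ^ n" using finW n by (simp add: card_cartesian_product card_Pow flip: power_mult_distrib)
  finally have cardI: "real (card I) \<le> 4 ^ n" by (metis of_nat_le_iff of_nat_numeral of_nat_power)
  have cardB: "s * s \<le> card (B i)" if "i \<in> I" for i
  proof -
    obtain X Y where i: "i = (X, Y)" by (cases i)
    have "card X * s \<le> card ((\<lambda>(y, z). {y, z}) ` Sigma X (\<lambda>_. Y))"
      using that finW unfolding i I_def by (intro card_pairs_image) (auto intro: finite_subset)
    then show ?thesis using that by (simp add: i I_def B_def)
  qed
  have "{b. \<not> joins_large W (present W b) (2 * s)} \<subseteq> {b. \<exists>i\<in>I. {} \<subseteq> present W b \<and> B i \<inter> present W b = {}}"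
  proof
    fix b assume "b \<in> {b. \<not> joins_large W (present W b) (2 * s)}"
    then obtain X Y where XY: "X \<subseteq> W" "Y \<subseteq> W" "2 * s \<le> card X" "2 * s \<le> card Y"
      "\<forall>x\<in>X. \<forall>y\<in>Y. {x, y} \<notin> present W b" by (auto simp: joins_large_def)
    have "s \<le> card X" using XY by simp
    then obtain X' where X': "X' \<subseteq> X" "card X' = s" using obtain_subset_with_card_n by metis
    have "finite X'" using X' XY finW finite_subset by metis
    then have "s \<le> card (Y - X')" using diff_card_le_card_Diff[of X' Y] X' XY by simp
    then obtain Y' where Y': "Y' \<subseteq> Y - X'" "card Y' = s" using obtain_subset_with_card_n by metis
    have "(X', Y') \<in> I" using X' Y' XY by (auto simp: I_def)
    moreover have "B (X', Y') \<inter> present W b = {}" using X' Y' XY(5) by (auto simp: B_def)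
    ultimately show "b \<in> {b. \<exists>i\<in>I. {} \<subseteq> present W b \<and> B i \<inter> present W b = {}}" by auto
  qed
  then have "measure_pmf.prob (random_pairs W p) {b. \<not> joins_large W (present W b) (2 * s)} \<le>
      measure_pmf.prob (random_pairs W p) {b. \<exists>i\<in>I. {} \<subseteq> present W b \<and> B i \<inter> present W b = {}}"
    by (intro measure_pmf.finite_measure_mono) auto
  also have "\<dots> \<le> (\<Sum>i\<in>I. p ^ card ({} :: 'a set set) * (1 - p) ^ card (B i))"
    by (rule prob_pattern_union[OF finW finI p])
      (auto simp: I_def B_def doubleton_all_pairs)
  also have "\<dots> \<le> (\<Sum>i\<in>I. (1 - p) ^ (s * s))"
    using cardB p by (intro sum_mono) (auto intro!: power_decreasing)
  also have "\<dots> \<le> 4 ^ n * (1 - p) ^ (s * s)" using cardI p by (auto intro!: mult_right_mono)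
  finally show ?thesis .
qed

text \<open>Expansion of the product over \<open>Y\<close>: \<open>None\<close> records the choice
  of the summand 1 at \<open>y\<close>, and \<open>Some a\<close> the choice of one of the summands
  \<open>q\<close>.\<close>

lemma sum_option_functions:
  fixes q :: real
  assumes "finite Y" "\<And>y. y \<in> Y \<Longrightarrow> finite (A y)"
  shows "(\<Sum>h\<in>PiE Y (\<lambda>y. insert None (Some ` A y)). q ^ card {y \<in> Y. h y \<noteq> None}) = (\<Prod>y\<in>Y. 1 + card (A y) * q)"
proof -
  have "(\<Prod>y\<in>Y. 1 + card (A y) * q) = (\<Prod>y\<in>Y. \<Sum>v\<in>insert None (Some ` A y). if v = None then 1 else q)"
  proof (intro prod.cong refl)
    fix y assume "y \<in> Y"
    have "(\<Sum>v\<in>Some ` A y. if v = None then 1 else q) = (\<Sum>v\<in>Some ` A y. q)"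
      by (intro sum.cong) auto
    then show "1 + card (A y) * q = (\<Sum>v\<in>insert None (Some ` A y). if v = None then 1 else q)"
      using assms(2)[OF \<open>y \<in> Y\<close>] by (simp add: card_image)
  qed
  also have "\<dots> = (\<Sum>h\<in>PiE Y (\<lambda>y. insert None (Some ` A y)). \<Prod>y\<in>Y. if h y = None then 1 else q)"
    using assms by (intro prod_sum_PiE) auto
  also have "\<dots> = (\<Sum>h\<in>PiE Y (\<lambda>y. insert None (Some ` A y)). q ^ card {y \<in> Y. h y \<noteq> None})"
    using assms(1) by (intro sum.cong refl) (simp add: prod.If_cases Int_def)
  finally show ?thesis ..
qed

definition gedges :: "'v gadget \<Rightarrow> 'v set set" where
  "gedges g = {{gfst g, gmid g}, {gmid g, glast g}}"

lemma card_gedges: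
  assumes "gadget_system W E Q"
  shows "card (\<Union>g\<in>Q. gedges g) = 2 * card Q"
proof -
  have "card (\<Union>g\<in>Q. gedges g) = (\<Sum>g\<in>Q. card (gedges g))"
  proof (rule card_UN_disjoint)
    show "finite Q" using assms by (simp add: gadget_system_def)
    show "\<forall>g\<in>Q. finite (gedges g)" by (simp add: gedges_def)
    show "\<forall>g\<in>Q. \<forall>g'\<in>Q. g \<noteq> g' \<longrightarrow> gedges g \<inter> gedges g' = {}"
    proof (intro ballI impI)
      fix g g' assume "g \<in> Q" "g' \<in> Q" "g \<noteq> g'"
      then have "gverts g \<inter> gverts g' = {}" using assms by (auto simp: gadget_system_def)
      moreover have "e \<subseteq> gverts g" "e \<noteq> {}" if "e \<in> gedges g" for e and g :: "'a gadget"
        using that by (auto simp: gedges_def gverts_alt)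
      ultimately show "gedges g \<inter> gedges g' = {}" by blast
    qed
  qed
  also have "\<dots> = (\<Sum>g\<in>Q. 2)"
  proof (rule sum.cong)
    fix g assume "g \<in> Q"
    then have "card (gverts g) = 3" using assms by (auto simp: gadget_system_def)
    from gadget_distinct[OF this] show "card (gedges g) = 2"
      by (auto simp: gedges_def card_insert_if doubleton_eq_iff)
  qed simp
  finally show ?thesis by simp
qed

lemma gadget_system_subset:
  "gadget_system W E Q \<Longrightarrow> Q \<subseteq> W \<times> W \<times> W"
  by (force simp: gadget_system_def gverts_alt gfst_def gmid_def glast_def)

text \<open>Gadgets of a system are disjoint, so each vertex is the centre of at most one, and the
  system amounts to a partial function from centres to pairs of ends. For \<open>q = p^2\<close> the
  resulting bound has a base that depends on \<open>n * p\<close> only.\<close>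

lemma sum_gadget_systems:
  fixes q :: real and W :: "'v set"
  assumes finW: "finite W" and n: "card W = n" and q: "0 \<le> q"
    and \<Q>: "\<And>Q. Q \<in> \<Q> \<Longrightarrow> gadget_system W E Q"
  shows "(\<Sum>Q\<in>\<Q>. q ^ card Q) \<le> (1 + n * n * q) ^ n"
proof -
  define enc where "enc Q = (\<lambda>y\<in>W. if \<exists>a b. (a, y, b) \<in> Q then Some (SOME ab. (fst ab, y, snd ab) \<in> Q) else None)" for Q :: "'v gadget set"
  have encS: "enc Q y = Some (a, b) \<longleftrightarrow> (a, y, b) \<in> Q" if "Q \<in> \<Q>" "y \<in> W" for Q y a b
  proof
    assume "enc Q y = Some (a, b)"
    then have ex: "\<exists>a b. (a, y, b) \<in> Q" and eq: "(SOME ab. (fst ab, y, snd ab) \<in> Q) = (a, b)"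
      using that by (auto simp: enc_def split: if_splits)
    then have "\<exists>ab. (fst ab, y, snd ab) \<in> Q" by auto
    from someI_ex[OF this] show "(a, y, b) \<in> Q" unfolding eq by simp
  next
    assume ab: "(a, y, b) \<in> Q"
    then have "\<exists>ab. (fst ab, y, snd ab) \<in> Q" by (intro exI[of _ "(a, b)"]) simp
    then have in_Q: "(fst (SOME ab. (fst ab, y, snd ab) \<in> Q), y, snd (SOME ab. (fst ab, y, snd ab) \<in> Q)) \<in> Q"
      by (rule someI_ex)
    obtain a' b' where eq: "(SOME ab. (fst ab, y, snd ab) \<in> Q) = (a', b')" by (rule prod.exhaust)
    note * = eq in_Q[unfolded eq fst_conv snd_conv]
    have "(a', y, b') = (a, y, b)"
    proof (rule ccontr)
      assume neq: "(a', y, b') \<noteq> (a, y, b)"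
      have "\<forall>g\<in>Q. \<forall>g'\<in>Q. g \<noteq> g' \<longrightarrow> gverts g \<inter> gverts g' = {}"
        using \<Q>[OF that(1)] unfolding gadget_system_def by (elim conjE)
      from this[rule_format, OF *(2) ab neq]
      show False by simp
    qed
    then show "enc Q y = Some (a, b)" using ab * that by (auto simp: enc_def)
  qed
  have sub: "Q \<subseteq> W \<times> W \<times> W" if "Q \<in> \<Q>" for Q using gadget_system_subset \<Q> that by blast
  have inj: "inj_on enc \<Q>"
  proof (rule inj_onI)
    fix Q Q' assume Q: "Q \<in> \<Q>" "Q' \<in> \<Q>" "enc Q = enc Q'"
    have "g \<in> Q \<longleftrightarrow> g \<in> Q'" for g
    proof -
      obtain a y b where g: "g = (a, y, b)" by (cases g)
      show ?thesis
      proof (cases "y \<in> W")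
        case True
        then show ?thesis using encS[of Q y a b] encS[of Q' y a b] Q g by auto
      next
        case False
        then show ?thesis using sub[OF Q(1)] sub[OF Q(2)] g by auto
      qed
    qed
    then show "Q = Q'" by blast
  qed
  have mem: "enc Q \<in> PiE W (\<lambda>_. insert None (Some ` (W \<times> W)))" if "Q \<in> \<Q>" for Q
  proof (rule PiE_I)
    fix y assume y: "y \<in> W"
    show "enc Q y \<in> insert None (Some ` (W \<times> W))"
    proof (cases "enc Q y")
      case (Some ab)
      then have "(fst ab, y, snd ab) \<in> Q" using encS[OF that y, of "fst ab" "snd ab"] by simp
      then have "ab \<in> W \<times> W" using sub[OF that] by (cases ab) auto
      then show ?thesis using Some by simp
    qed simp
  qed (simp add: enc_def)
  have card: "card Q = card {y \<in> W. enc Q y \<noteq> None}" if Q\<Q>: "Q \<in> \<Q>" for Q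
  proof -
    have "inj_on gmid Q"
    proof (rule inj_onI, rule ccontr)
      fix g g' assume g: "g \<in> Q" "g' \<in> Q" "gmid g = gmid g'" "g \<noteq> g'"
      then have "gverts g \<inter> gverts g' = {}" using \<Q>[OF Q\<Q>] by (auto simp: gadget_system_def)
      then show False using g by (auto simp: gverts_alt)
    qed
    moreover have "gmid ` Q = {y \<in> W. enc Q y \<noteq> None}"
    proof (intro equalityI subsetI)
      fix y assume "y \<in> gmid ` Q"
      then obtain a b where "(a, y, b) \<in> Q" by (auto simp: gmid_def)
      then show "y \<in> {y \<in> W. enc Q y \<noteq> None}" using sub[OF Q\<Q>] encS[OF Q\<Q>, of y a b] by auto
    next
      fix y assume "y \<in> {y \<in> W. enc Q y \<noteq> None}"
      then obtain a b where "y \<in> W" "enc Q y = Some (a, b)" by auto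
      then have "(a, y, b) \<in> Q" using encS[OF Q\<Q>] by blast
      then show "y \<in> gmid ` Q" by (force simp: gmid_def)
    qed
    ultimately show ?thesis by (metis card_image)
  qed
  have "(\<Sum>Q\<in>\<Q>. q ^ card Q) = (\<Sum>Q\<in>\<Q>. q ^ card {y \<in> W. enc Q y \<noteq> None})"
    by (intro sum.cong refl) (use card in simp)
  also have "\<dots> = (\<Sum>h\<in>enc ` \<Q>. q ^ card {y \<in> W. h y \<noteq> None})"
    by (simp add: sum.reindex[OF inj])
  also have "\<dots> \<le> (\<Sum>h\<in>PiE W (\<lambda>_. insert None (Some ` (W \<times> W))). q ^ card {y \<in> W. h y \<noteq> None})"
    using mem q finW by (intro sum_mono2 finite_PiE) auto
  also have "\<dots> = (1 + real n * real n * q) ^ n"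
    using finW n by (subst sum_option_functions) (auto simp: card_cartesian_product)
  finally show ?thesis .
qed

text \<open>A union bound over all gadget systems \<open>Q\<close> and all functions \<open>h\<close> recording, for each \<open>y\<close> of a fan of
  useful triples, one neighbour \<open>a\<close> of \<open>y\<close> that could start a gadget, or \<open>None\<close>. Given \<open>(Q, h)\<close>, being
  stuck forces \<open>k\<close> absent pairs at each of the \<open>k\<close> vertices \<open>y\<close>. The first two factors of the bound are
  the total weights of the choices of \<open>Q\<close> and \<open>h\<close>.\<close>

lemma prob_stuck:
  fixes W :: "'v set" and \<kappa> :: real
  assumes finW: "finite W" and n: "card W = n" "n > 0" and p: "0 \<le> p" "p \<le> 1"
    and \<kappa>: "0 < \<kappa>" and k: "k \<ge> 1" "real k \<le> \<kappa> * n / 8"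
    and useful: "\<And>Q. gadget_system W (all_pairs W) Q \<Longrightarrow> card Q < m \<Longrightarrow> \<kappa> * n^3 \<le> card (useful W E \<kappa> Q)"
  shows "measure_pmf.prob (random_pairs W p)
      {b. \<exists>Q. gadget_system W (present W b) Q \<and> card Q < m \<and> stuck (present W b) (useful W E \<kappa> Q)} \<le>
    (1 + n * n * p^2) ^ n * (1 + n * p) ^ n * (1 - p) ^ (k * k)"
proof -
  define \<Q> where "\<Q> = {Q. gadget_system W (all_pairs W) Q \<and> card Q < m}"
  have "\<Q> \<subseteq> Pow (W \<times> W \<times> W)" using gadget_system_subset by (auto simp: \<Q>_def)
  then have fin\<Q>: "finite \<Q>" using finW by (meson finite_Pow_iff finite_SigmaI finite_subset)
  have "\<exists>Y A B. fan W (useful W E \<kappa> Q) k Y A B" if "Q \<in> \<Q>" for Q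
    using that useful k by (intro exists_fan[OF finW n _ \<kappa>]) (auto simp: \<Q>_def useful_def)
  \<comment> \<open>The fan is a function of \<open>Q\<close> alone, fixed before the random pairs
    are looked at.\<close>
  then obtain Y A B where fan: "\<And>Q. Q \<in> \<Q> \<Longrightarrow> fan W (useful W E \<kappa> Q) k (Y Q) (A Q) (B Q)" by metis
  have fY: "Y Q \<subseteq> W" "card (Y Q) = k" and fA: "\<And>y. y \<in> Y Q \<Longrightarrow> A Q y \<subseteq> W - Y Q"
    "\<And>y. y \<in> Y Q \<Longrightarrow> k \<le> card (A Q y)"
    and fB: "\<And>y a. y \<in> Y Q \<Longrightarrow> a \<in> A Q y \<Longrightarrow> B Q y a \<subseteq> W - Y Q"
    "\<And>y a. y \<in> Y Q \<Longrightarrow> a \<in> A Q y \<Longrightarrow> k \<le> card (B Q y a)"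
    "\<And>y a b. y \<in> Y Q \<Longrightarrow> a \<in> A Q y \<Longrightarrow> b \<in> B Q y a \<Longrightarrow> (a, y, b) \<in> useful W E \<kappa> Q"
    if "Q \<in> \<Q>" for Q
    using fan[OF that] by (auto simp: fan_def)
  have finY: "finite (Y Q)" if "Q \<in> \<Q>" for Q using fY[OF that] finW finite_subset by blast
  have YQ: "y \<notin> gverts g" if Q: "Q \<in> \<Q>" and y: "y \<in> Y Q" and g: "g \<in> Q" for Q y g
  proof -
    have "card (A Q y) > 0" using fA(2)[OF Q y] k by simp
    then obtain a where a: "a \<in> A Q y" by (metis card_gt_0_iff equals0I)
    have "card (B Q y a) > 0" using fB(2)[OF Q y a] k by simp
    then obtain b where "b \<in> B Q y a" by (metis card_gt_0_iff equals0I)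
    then have "gverts (a, y, b) \<inter> (\<Union>h\<in>Q. gverts h) = {}"
      using fB(3)[OF Q y a] unfolding useful_def by blast
    then show ?thesis using g by auto
  qed
  \<comment> \<open>Where absent pairs at \<open>y\<close> are certain: all of \<open>A Q y\<close>
    if no pair from \<open>y\<close> to it is present; otherwise, \<open>{y, a}\<close> being
    present, every \<open>b\<close> that would complete a useful triple.\<close>
  define Z where "Z Q h y = (case h y of None \<Rightarrow> A Q y | Some a \<Rightarrow> B Q y a)" for Q and h :: "'v \<Rightarrow> 'v option" and y
  define H where "H Q = PiE (Y Q) (\<lambda>y. insert None (Some ` A Q y))" for Q
  define he where "he Q h = (\<lambda>y. {y, the (h y)}) ` {y \<in> Y Q. h y \<noteq> None}" for Q and h :: "'v \<Rightarrow> 'v option"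
  \<comment> \<open>A history \<open>(Q, h)\<close> forces \<open>AA\<close> to be present and
    \<open>BB\<close> to be absent. As they are disjoint, independence makes the probability a
    product.\<close>
  define AA where "AA = (\<lambda>(Q, h). (\<Union>g\<in>Q. gedges g) \<union> he Q h)"
  define BB where "BB = (\<lambda>(Q, h). (\<lambda>(y, z). {y, z}) ` Sigma (Y Q) (Z Q h))"
  have hS: "a \<in> A Q y" if "h \<in> H Q" "y \<in> Y Q" "h y = Some a" for Q h y a
  proof -
    have "h y \<in> insert None (Some ` A Q y)" using that unfolding H_def by blast
    then show ?thesis using that(3) by auto
  qed
  have Zsub: "Z Q h y \<subseteq> W - Y Q" and Zcard: "k \<le> card (Z Q h y)"
    if "Q \<in> \<Q>" "h \<in> H Q" "y \<in> Y Q" for Q h y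
    using fA[OF that(1,3)] fB[OF that(1,3)] hS[OF that(2,3)] by (auto simp: Z_def split: option.splits)
  have finH: "finite (H Q)" if "Q \<in> \<Q>" for Q
    unfolding H_def using finY[OF that] fA(1)[OF that] finW by (intro finite_PiE) (auto intro: finite_subset)
  have finI: "finite (Sigma \<Q> H)" using fin\<Q> finH by auto
  have AAsub: "AA i \<subseteq> all_pairs W" if i: "i \<in> Sigma \<Q> H" for i
  proof -
    obtain Q h where Qh: "i = (Q, h)" "Q \<in> \<Q>" "h \<in> H Q" using i by auto
    have "gedges g \<subseteq> all_pairs W" if "g \<in> Q" for g
      using Qh(2) that by (auto simp: \<Q>_def gadget_system_def gedges_def)
    moreover have "{y, the (h y)} \<in> all_pairs W" if y: "y \<in> Y Q" "h y \<noteq> None" for y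
    proof -
      obtain a where a: "h y = Some a" using y by blast
      then show ?thesis using hS[OF Qh(3) y(1) a] fA(1)[OF Qh(2) y(1)] fY(1)[OF Qh(2)] y
        by (auto simp: doubleton_all_pairs)
    qed
    then have "he Q h \<subseteq> all_pairs W" unfolding he_def by blast
    ultimately show ?thesis unfolding Qh(1) AA_def by auto
  qed
  have BBsub: "BB i \<subseteq> all_pairs W" if i: "i \<in> Sigma \<Q> H" for i
    using i Zsub fY(1) by (fastforce simp: BB_def doubleton_all_pairs)
  have hedge: "\<exists>y a. e = {y, a} \<and> y \<in> Y Q \<and> a \<notin> Y Q \<and> h y = Some a" if Qhe: "Q \<in> \<Q>" "h \<in> H Q" "e \<in> he Q h" for Q h e
  proof -
    obtain y where y: "y \<in> Y Q" "h y \<noteq> None" "e = {y, the (h y)}" using Qhe(3) unfolding he_def by blast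
    then obtain a where a: "h y = Some a" by blast
    then have "a \<in> A Q y" by (rule hS[OF Qhe(2) y(1)])
    then have "a \<notin> Y Q" using fA(1)[OF Qhe(1) y(1)] by blast
    then show ?thesis using y a by (intro exI[of _ y] exI[of _ a]) simp
  qed
  have Qedge: "e \<subseteq> (\<Union>g\<in>Q. gverts g)" if "e \<in> (\<Union>g\<in>Q. gedges g)" for e and Q :: "'v gadget set"
    using that by (auto simp: gedges_def gverts_alt)
  have disj: "AA i \<inter> BB i = {}" if i: "i \<in> Sigma \<Q> H" for i
  proof -
    obtain Q h where Qh: "i = (Q, h)" "Q \<in> \<Q>" "h \<in> H Q" using i by auto
    have "e \<notin> AA i" if e: "e \<in> BB i" for e
    proof
      obtain y z where yz: "e = {y, z}" "y \<in> Y Q" "z \<in> Z Q h y" using e by (auto simp: BB_def Qh(1))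
      then have zY: "z \<notin> Y Q" using Zsub[OF Qh(2,3)] by blast
      assume "e \<in> AA i"
      then consider "e \<in> (\<Union>g\<in>Q. gedges g)" | "e \<in> he Q h" by (auto simp: AA_def Qh(1))
      then show False
      proof cases
        case 1
        then show False using Qedge[of e Q] YQ[OF Qh(2) yz(2)] yz(1) by auto
      next
        case 2
        then obtain y' a where ya: "e = {y', a}" "y' \<in> Y Q" "a \<notin> Y Q" "h y' = Some a" using hedge Qh by blast
        then have eq: "y' = y" "a = z" using yz zY by (auto simp: doubleton_eq_iff)
        then have "z \<in> B Q y a" using yz(3) ya(4) by (simp add: Z_def)
        \<comment> \<open>A common pair would require \<open>a\<close> to be among its own last
          vertices, but \<open>(a, y, a)\<close> is degenerate.\<close>
        then have "(a, y, a) \<in> useful W E \<kappa> Q" using fB(3)[OF Qh(2) yz(2)] hS[OF Qh(3) yz(2)] ya(4) eq by auto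
        then show False by (auto simp: useful_def card_insert_if split: if_splits)
      qed
    qed
    then show ?thesis by blast
  qed
  have cardAA: "card (AA (Q, h)) = 2 * card Q + card {y \<in> Y Q. h y \<noteq> None}" if Qh: "Q \<in> \<Q>" "h \<in> H Q" for Q h
  proof -
    have "(\<Union>g\<in>Q. gedges g) \<inter> he Q h = {}"
    proof -
      have "e \<notin> (\<Union>g\<in>Q. gedges g)" if e: "e \<in> he Q h" for e
        using hedge[OF Qh e] Qedge[of e Q] YQ[OF Qh(1)] by blast
      then show ?thesis by blast
    qed
    moreover have "inj_on (\<lambda>y. {y, the (h y)}) {y \<in> Y Q. h y \<noteq> None}"
    proof (rule inj_onI)
      fix y y' assume y: "y \<in> {y \<in> Y Q. h y \<noteq> None}" "y' \<in> {y \<in> Y Q. h y \<noteq> None}"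
        and eq: "{y, the (h y)} = {y', the (h y')}"
      have "the (h y') \<notin> Y Q" using hS[OF Qh(2), of y'] fA(1)[OF Qh(1), of y'] y(2) by auto
      then show "y = y'" using eq y(1) by (auto simp: doubleton_eq_iff)
    qed
    then have "card (he Q h) = card {y \<in> Y Q. h y \<noteq> None}" by (simp add: he_def card_image)
    moreover have "card (\<Union>g\<in>Q. gedges g) = 2 * card Q" using card_gedges Qh(1) by (auto simp: \<Q>_def)
    moreover have "finite (\<Union>g\<in>Q. gedges g)" using Qh(1) by (auto simp: \<Q>_def gadget_system_def gedges_def)
    moreover have "finite (he Q h)" using finY[OF Qh(1)] by (simp add: he_def)
    ultimately show ?thesis by (simp add: AA_def card_Un_disjoint)
  qed
  have cardBB: "k * k \<le> card (BB (Q, h))" if Qh: "Q \<in> \<Q>" "h \<in> H Q" for Q h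
  proof -
    have "card (Y Q) * k \<le> card ((\<lambda>(y, z). {y, z}) ` Sigma (Y Q) (Z Q h))"
      using finY[OF Qh(1)] Zcard[OF Qh] Zsub[OF Qh] finW
      by (intro card_pairs_image) (blast intro: finite_subset)+
    then show ?thesis using fY(2)[OF Qh(1)] by (simp add: BB_def)
  qed
  have cover: "\<exists>i\<in>Sigma \<Q> H. AA i \<subseteq> present W b \<and> BB i \<inter> present W b = {}"
    if Q: "gadget_system W (present W b) Q" "card Q < m" and st: "stuck (present W b) (useful W E \<kappa> Q)" for b Q
  proof -
    let ?R = "present W b"
    have Q\<Q>: "Q \<in> \<Q>" using Q by (auto simp: \<Q>_def gadget_system_def present_def)
    define h where "h = (\<lambda>y\<in>Y Q. if \<exists>a\<in>A Q y. {y, a} \<in> ?R then Some (SOME a. a \<in> A Q y \<and> {y, a} \<in> ?R) else None)"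
    have hSome: "a \<in> A Q y \<and> {y, a} \<in> ?R" if "y \<in> Y Q" "h y = Some a" for y a
    proof -
      have ex: "\<exists>a. a \<in> A Q y \<and> {y, a} \<in> ?R" and a: "a = (SOME a. a \<in> A Q y \<and> {y, a} \<in> ?R)"
        using that by (auto simp: h_def split: if_splits)
      show ?thesis unfolding a by (rule someI_ex[OF ex])
    qed
    have hNone: "{y, a} \<notin> ?R" if "y \<in> Y Q" "h y = None" "a \<in> A Q y" for y a
      using that by (auto simp: h_def split: if_splits)
    have hH: "h \<in> H Q"
      unfolding H_def
    proof (rule PiE_I)
      fix y assume "y \<in> Y Q"
      then show "h y \<in> insert None (Some ` A Q y)" using hSome[of y] by (cases "h y") auto
    qed (simp add: h_def)
    have "gedges g \<subseteq> ?R" if "g \<in> Q" for g using Q(1) that by (auto simp: gadget_system_def gedges_def)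
    moreover have "he Q h \<subseteq> ?R" using hSome by (auto simp: he_def)
    ultimately have "AA (Q, h) \<subseteq> ?R" by (auto simp: AA_def)
    moreover have "{y, z} \<notin> ?R" if y: "y \<in> Y Q" and z: "z \<in> Z Q h y" for y z
    proof (cases "h y")
      case None
      then show ?thesis using hNone[OF y] z by (simp add: Z_def)
    next
      case (Some a)
      then have a: "a \<in> A Q y" "{y, a} \<in> ?R" "z \<in> B Q y a" using hSome[OF y] z by (auto simp: Z_def)
      then have "(a, y, z) \<in> useful W E \<kappa> Q" using fB(3)[OF Q\<Q> y] by blast
      then have "\<not> ({a, y} \<in> ?R \<and> {y, z} \<in> ?R)"
        using st unfolding stuck_def gfst_def gmid_def glast_def by fastforce
      then show ?thesis using a(2) by (simp add: insert_commute)
    qed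
    then have "BB (Q, h) \<inter> ?R = {}" by (auto simp: BB_def)
    ultimately show ?thesis using Q\<Q> hH by blast
  qed
  have "measure_pmf.prob (random_pairs W p)
      {b. \<exists>Q. gadget_system W (present W b) Q \<and> card Q < m \<and> stuck (present W b) (useful W E \<kappa> Q)} \<le>
      measure_pmf.prob (random_pairs W p) {b. \<exists>i\<in>Sigma \<Q> H. AA i \<subseteq> present W b \<and> BB i \<inter> present W b = {}}"
    using cover by (intro measure_pmf.finite_measure_mono) auto
  also have "\<dots> \<le> (\<Sum>i\<in>Sigma \<Q> H. p ^ card (AA i) * (1 - p) ^ card (BB i))"
    by (rule prob_pattern_union[OF finW finI p AAsub BBsub disj])
  also have "\<dots> = (\<Sum>Q\<in>\<Q>. \<Sum>h\<in>H Q. p ^ card (AA (Q, h)) * (1 - p) ^ card (BB (Q, h)))"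
    using fin\<Q> finH by (subst sum.Sigma) auto
  \<comment> \<open>Each gadget is charged \<open>p^2\<close> for its two edges and each recorded
    neighbour \<open>p\<close>; these factors pay for the number of histories.\<close>
  also have "\<dots> \<le> (\<Sum>Q\<in>\<Q>. \<Sum>h\<in>H Q. ((p^2) ^ card Q * p ^ card {y \<in> Y Q. h y \<noteq> None}) * (1 - p) ^ (k * k))"
    using p cardBB by (intro sum_mono mult_mono power_decreasing) (auto simp: cardAA power_add power_mult)
  also have "\<dots> = (\<Sum>Q\<in>\<Q>. (p^2) ^ card Q * (\<Sum>h\<in>H Q. p ^ card {y \<in> Y Q. h y \<noteq> None})) * (1 - p) ^ (k * k)"
    by (simp add: sum_distrib_left sum_distrib_right)
  also have "\<dots> \<le> (\<Sum>Q\<in>\<Q>. (p^2) ^ card Q * (1 + n * p) ^ n) * (1 - p) ^ (k * k)"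
  proof (intro mult_right_mono sum_mono mult_left_mono)
    fix Q assume Q: "Q \<in> \<Q>"
    have "(\<Sum>h\<in>H Q. p ^ card {y \<in> Y Q. h y \<noteq> None}) = (\<Prod>y\<in>Y Q. 1 + card (A Q y) * p)"
      unfolding H_def using finY[OF Q] fA(1)[OF Q] finW
      by (intro sum_option_functions) (blast intro: finite_subset)+
    also have "\<dots> \<le> (\<Prod>y\<in>Y Q. 1 + n * p)"
    proof (intro prod_mono conjI add_left_mono mult_right_mono)
      fix y assume "y \<in> Y Q"
      then have "card (A Q y) \<le> card W" using fA(1)[OF Q] finW by (intro card_mono) auto
      then show "real (card (A Q y)) \<le> real n" using n by simp
    qed (use p in auto)
    also have "\<dots> = (1 + n * p) ^ k" using fY[OF Q] by simp
    also have "\<dots> \<le> (1 + n * p) ^ n"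
    proof (rule power_increasing)
      show "k \<le> n" using fY[OF Q] card_mono[OF finW] n by metis
    qed (use p in auto)
    finally show "(\<Sum>h\<in>H Q. p ^ card {y \<in> Y Q. h y \<noteq> None}) \<le> (1 + n * p) ^ n" .
  qed (use p in auto)
  also have "\<dots> = (\<Sum>Q\<in>\<Q>. (p^2) ^ card Q) * (1 + n * p) ^ n * (1 - p) ^ (k * k)"
    by (simp add: sum_distrib_right)
  also have "\<dots> \<le> (1 + real n * real n * p^2) ^ n * (1 + n * p) ^ n * (1 - p) ^ (k * k)"
  proof -
    have "(\<Sum>Q\<in>\<Q>. (p^2) ^ card Q) \<le> (1 + real n * real n * p^2) ^ n"
      by (rule sum_gadget_systems[OF finW n(1), where E = "all_pairs W"]) (auto simp: \<Q>_def)
    then show ?thesis using p by (intro mult_right_mono) auto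
  qed
  finally show ?thesis .
qed

section \<open>Removing the colours\<close>

text \<open>The state of a pair: \<open>None\<close> if it is absent, \<open>Some None\<close> if it is a plain edge that
  conflicts with nothing, and \<open>Some (Some c)\<close> if it is an edge of colour \<open>c\<close>.\<close>

type_synonym pair_state = "nat option option"

definition rainbow_state :: "'e set \<Rightarrow> ('e \<Rightarrow> pair_state) \<Rightarrow> bool" where
  "rainbow_state F \<sigma> \<longleftrightarrow> (\<forall>e\<in>F. \<sigma> e \<noteq> None) \<and>
     (\<forall>e\<in>F. \<forall>e'\<in>F. \<forall>c. \<sigma> e = Some (Some c) \<longrightarrow> \<sigma> e' = Some (Some c) \<longrightarrow> e = e')"

definition has_rainbow :: "'e set set \<Rightarrow> ('e \<Rightarrow> pair_state) set" where
  "has_rainbow \<F> = {\<sigma>. \<exists>F\<in>\<F>. rainbow_state F \<sigma>}"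

lemma rainbow_state_cong:
  "(\<And>e. e \<in> F \<Longrightarrow> \<sigma> e = \<sigma>' e) \<Longrightarrow> rainbow_state F \<sigma> = rainbow_state F \<sigma>'"
  unfolding rainbow_state_def by (intro conj_cong ball_cong all_cong) auto

text \<open>With all other pairs fixed there are three cases. If a rainbow member exists without
  \<open>e\<close>, both sides are 1. If even a plain \<open>e\<close> creates none, the left side
  is 0. Otherwise a member becomes rainbow with \<open>e\<close> plain, and then also with
  \<open>e\<close> in any colour outside the at most \<open>m\<close> colours of its other
  edges.\<close>

lemma colouring_step:
  fixes P C :: "pair_state pmf"
  assumes \<F>: "\<And>F. F \<in> \<F> \<Longrightarrow> finite F \<and> card F \<le> m"
    and P: "set_pmf P \<subseteq> {None, Some None}"
    and C: "\<And>U. finite U \<Longrightarrow> card U \<le> m \<Longrightarrow>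
      measure_pmf.prob P {Some None} \<le> measure_pmf.prob C {v. \<exists>c. c \<notin> U \<and> v = Some (Some c)}"
  shows "measure_pmf.prob P {v. \<sigma>(e := v) \<in> has_rainbow \<F>} \<le> measure_pmf.prob C {v. \<sigma>(e := v) \<in> has_rainbow \<F>}"
proof (cases "\<sigma>(e := None) \<in> has_rainbow \<F>")
  case True
  then obtain F where F: "F \<in> \<F>" "rainbow_state F (\<sigma>(e := None))" by (auto simp: has_rainbow_def)
  then have "e \<notin> F" by (auto simp: rainbow_state_def)
  then have "rainbow_state F (\<sigma>(e := v))" for v
  proof -
    have "rainbow_state F (\<sigma>(e := v)) = rainbow_state F (\<sigma>(e := None))"
      using \<open>e \<notin> F\<close> by (intro rainbow_state_cong) auto
    then show ?thesis using F(2) by simp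
  qed
  then have "{v. \<sigma>(e := v) \<in> has_rainbow \<F>} = UNIV" using F(1) by (auto simp: has_rainbow_def)
  then show ?thesis by simp
next
  case absent: False
  show ?thesis
  proof (cases "\<sigma>(e := Some None) \<in> has_rainbow \<F>")
    case False
    then have "{v. \<sigma>(e := v) \<in> has_rainbow \<F>} \<inter> set_pmf P = {}" using P absent by auto
    then have "measure_pmf.prob P {v. \<sigma>(e := v) \<in> has_rainbow \<F>} = 0"
      by (simp add: measure_pmf_zero_iff Int_commute)
    then show ?thesis by simp
  next
    case True
    then obtain F where F: "F \<in> \<F>" "rainbow_state F (\<sigma>(e := Some None))" by (auto simp: has_rainbow_def)
    define U where "U = {c. \<exists>e'\<in>F - {e}. \<sigma> e' = Some (Some c)}"
    have finF: "finite F" "card F \<le> m" using \<F>[OF F(1)] by auto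
    have "U \<subseteq> (\<lambda>e'. the (the (\<sigma> e'))) ` F" by (force simp: U_def)
    then have "finite U" "card U \<le> m"
      using finF by (auto intro: finite_surj surj_card_le[THEN order_trans])
    have "\<sigma>(e := Some (Some c)) \<in> has_rainbow \<F>" if "c \<notin> U" for c
    proof -
      have nd: "\<sigma> e' \<noteq> None" if "e' \<in> F" "e' \<noteq> e" for e' using F(2) that by (auto simp: rainbow_state_def)
      have inj: "e1 = e2" if "e1 \<in> F" "e2 \<in> F" "e1 \<noteq> e" "e2 \<noteq> e" "\<sigma> e1 = Some (Some c)" "\<sigma> e2 = Some (Some c)" for e1 e2 c
        using F(2) that unfolding rainbow_state_def by (metis fun_upd_other)
      have nU: "\<sigma> e' \<noteq> Some (Some c)" if "e' \<in> F" "e' \<noteq> e" for e' using \<open>c \<notin> U\<close> that by (auto simp: U_def)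
      have "rainbow_state F (\<sigma>(e := Some (Some c)))"
        unfolding rainbow_state_def
      proof (intro conjI ballI allI impI)
        fix e1 e2 c' assume *: "e1 \<in> F" "e2 \<in> F" "(\<sigma>(e := Some (Some c))) e1 = Some (Some c')"
          "(\<sigma>(e := Some (Some c))) e2 = Some (Some c')"
        show "e1 = e2"
        proof (cases "e1 = e"; cases "e2 = e")
          assume "e1 \<noteq> e" "e2 \<noteq> e" then show ?thesis using * inj[of e1 e2 c'] by simp
        next
          assume "e1 = e" "e2 \<noteq> e" then show ?thesis using * nU[of e2] by simp
        next
          assume "e1 \<noteq> e" "e2 = e" then show ?thesis using * nU[of e1] by simp
        qed simp
      qed (use nd in auto)
      then show ?thesis using F(1) by (auto simp: has_rainbow_def)
    qed
    then have sub: "{v. \<exists>c. c \<notin> U \<and> v = Some (Some c)} \<subseteq> {v. \<sigma>(e := v) \<in> has_rainbow \<F>}" by auto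
    have "measure_pmf.prob P {v. \<sigma>(e := v) \<in> has_rainbow \<F>} \<le> measure_pmf.prob P {Some None}"
    proof -
      have "{v. \<sigma>(e := v) \<in> has_rainbow \<F>} \<inter> set_pmf P \<subseteq> {Some None}" using P absent by auto
      then have "measure_pmf.prob P ({v. \<sigma>(e := v) \<in> has_rainbow \<F>} \<inter> set_pmf P) \<le> measure_pmf.prob P {Some None}"
        by (intro measure_pmf.finite_measure_mono) auto
      then show ?thesis by (simp add: measure_Int_set_pmf)
    qed
    also have "\<dots> \<le> measure_pmf.prob C {v. \<exists>c. c \<notin> U \<and> v = Some (Some c)}"
      by (rule C) fact+
    also have "\<dots> \<le> measure_pmf.prob C {v. \<sigma>(e := v) \<in> has_rainbow \<F>}"
      by (intro measure_pmf.finite_measure_mono sub) auto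
    finally show ?thesis .
  qed
qed

text \<open>Recolouring the pairs one at a time only increases the chance of a rainbow member of \<open>\<F>\<close>:
  if the state of \<open>e\<close> matters, some member is rainbow apart from \<open>e\<close> and blocks at most \<open>m\<close> colours.\<close>

lemma plain_le_coloured:
  fixes P C :: "'e \<Rightarrow> pair_state pmf"
  assumes finE: "finite E" and \<F>: "\<And>F. F \<in> \<F> \<Longrightarrow> finite F \<and> card F \<le> m"
    and P: "\<And>e. e \<in> E \<Longrightarrow> set_pmf (P e) \<subseteq> {None, Some None}"
    and C: "\<And>e U. e \<in> E \<Longrightarrow> finite U \<Longrightarrow> card U \<le> m \<Longrightarrow>
      measure_pmf.prob (P e) {Some None} \<le> measure_pmf.prob (C e) {v. \<exists>c. c \<notin> U \<and> v = Some (Some c)}"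
  shows "emeasure (Pi_pmf E None P) (has_rainbow \<F>) \<le> emeasure (Pi_pmf E None C) (has_rainbow \<F>)"
proof -
  have "emeasure (Pi_pmf E None P) (has_rainbow \<F>) \<le>
      emeasure (Pi_pmf E None (\<lambda>e. if e \<in> H then C e else P e)) (has_rainbow \<F>)"
    if "finite H" "H \<subseteq> E" for H
    using that
  proof (induction H rule: finite_induct)
    case (insert x H)
    let ?D = "\<lambda>H e. if e \<in> H then C e else P e" and ?A = "has_rainbow \<F>"
    have E: "E = insert x (E - {x})" and finE': "finite (E - {x})" using insert.prems finE by auto
    \<comment> \<open>The state of \<open>x\<close> is drawn last, so all other pairs are fixed when
      \<open>P x\<close> is exchanged for \<open>C x\<close>.\<close>
    have decomp: "emeasure (Pi_pmf E None D) ?A =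
        (\<integral>\<^sup>+\<sigma>. emeasure (D x) {v. \<sigma>(x := v) \<in> ?A} \<partial>Pi_pmf (E - {x}) None D)" for D :: "'e \<Rightarrow> pair_state pmf"
    proof -
      have "Pi_pmf E None D = bind_pmf (Pi_pmf (E - {x}) None D) (\<lambda>\<sigma>. map_pmf (\<lambda>v. \<sigma>(x := v)) (D x))"
        by (subst E, subst Pi_pmf_insert'[OF finE']) (auto simp: map_pmf_def intro: bind_commute_pmf)
      then show ?thesis by (simp add: vimage_def)
    qed
    have same: "Pi_pmf (E - {x}) None (?D (insert x H)) = Pi_pmf (E - {x}) None (?D H)"
      using finE' by (intro Pi_pmf_cong) auto
    have "emeasure (Pi_pmf E None P) ?A \<le> emeasure (Pi_pmf E None (?D H)) ?A"
      using insert by blast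
    also have "\<dots> = (\<integral>\<^sup>+\<sigma>. emeasure (P x) {v. \<sigma>(x := v) \<in> ?A} \<partial>Pi_pmf (E - {x}) None (?D H))"
      using insert.hyps by (simp add: decomp)
    also have "\<dots> \<le> (\<integral>\<^sup>+\<sigma>. emeasure (C x) {v. \<sigma>(x := v) \<in> ?A} \<partial>Pi_pmf (E - {x}) None (?D H))"
    proof (rule nn_integral_mono)
      fix \<sigma>
      have "x \<in> E" using insert.prems by blast
      then have "measure_pmf.prob (P x) {v. \<sigma>(x := v) \<in> ?A} \<le> measure_pmf.prob (C x) {v. \<sigma>(x := v) \<in> ?A}"
        using P C by (intro colouring_step[OF \<F>]) auto
      then show "emeasure (P x) {v. \<sigma>(x := v) \<in> ?A} \<le> emeasure (C x) {v. \<sigma>(x := v) \<in> ?A}"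
        by (simp add: measure_pmf.emeasure_eq_measure)
    qed
    also have "\<dots> = emeasure (Pi_pmf E None (?D (insert x H))) ?A"
      using decomp[of "?D (insert x H)"] unfolding same by simp
    finally show ?case .
  qed simp
  from this[OF finE order_refl] have "emeasure (Pi_pmf E None P) (has_rainbow \<F>) \<le>
      emeasure (Pi_pmf E None (\<lambda>e. if e \<in> E then C e else P e)) (has_rainbow \<F>)" .
  also have "Pi_pmf E None (\<lambda>e. if e \<in> E then C e else P e) = Pi_pmf E None C"
    by (intro Pi_pmf_cong finE) auto
  finally show ?thesis .
qed

section \<open>The perturbed graph as a product over pairs\<close>

definition copies :: "'v set \<Rightarrow> 'a ugraph \<Rightarrow> 'v set set set" where
  "copies W T = {F. F \<subseteq> all_pairs W \<and> graph_isomorphic T (Graph W F)}"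

definition coloured_pair :: "nat ugraph \<Rightarrow> real \<Rightarrow> nat \<Rightarrow> nat set \<Rightarrow> pair_state pmf" where
  "coloured_pair G p k e = bind_pmf (bernoulli_pmf p)
     (\<lambda>b. if b \<or> e \<in> edges G then map_pmf (\<lambda>c. Some (Some c)) (pmf_of_set {1..k}) else return_pmf None)"

text \<open>Exposing \<open>R\<close> and colouring the union afterwards has the same law as giving
  each pair its state independently. A member of \<open>copies\<close> that is rainbow in these
  states is then a spanning rainbow copy.\<close>

lemma coloured_pair_le:
  assumes G: "simple_graph G" "verts G = {1..n}"
  shows "emeasure (Pi_pmf (all_pairs {1..n}) None (coloured_pair G p k)) (has_rainbow (copies {1..n} T)) \<le>
    emeasure (coloured_perturbed_graph G n p k) {(\<Gamma>, \<psi>). has_spanning_rainbow_copy \<Gamma> \<psi> T}"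
proof -
  let ?E = "all_pairs {1..n}" and ?A = "{(\<Gamma>, \<psi>). has_spanning_rainbow_copy \<Gamma> \<psi> T}"
  let ?U = "pmf_of_set {1..k}" and ?B = "Pi_pmf (all_pairs {1..n}) False (\<lambda>_. bernoulli_pmf p)"
  have finE: "finite ?E" by (simp add: all_pairs_def)
  have GE: "edges G \<subseteq> ?E" using G by (simp add: simple_graph_def)
  define \<Gamma> where "\<Gamma> b = graph_union G (Graph {1..n} {e \<in> ?E. b e})" for b
  have \<Gamma>e: "edges (\<Gamma> b) = {e \<in> ?E. b e \<or> e \<in> edges G}" for b using GE by (auto simp: \<Gamma>_def graph_union_def)
  have \<Gamma>v: "verts (\<Gamma> b) = {1..n}" for b using G by (auto simp: \<Gamma>_def graph_union_def)
  have fin\<Gamma>: "finite (edges (\<Gamma> b))" for b using finE by (simp add: \<Gamma>e)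
  have "Pi_pmf ?E None (coloured_pair G p k) = bind_pmf ?B
      (\<lambda>b. Pi_pmf ?E None (\<lambda>e. if b e \<or> e \<in> edges G then map_pmf (\<lambda>c. Some (Some c)) ?U else return_pmf None))"
    unfolding coloured_pair_def by (rule Pi_pmf_bind[OF finE])
  also have "\<dots> = bind_pmf ?B (\<lambda>b. map_pmf (\<lambda>\<psi> e. if e \<in> edges (\<Gamma> b) then Some (Some (\<psi> e)) else None)
      (Pi_pmf (edges (\<Gamma> b)) 0 (\<lambda>_. ?U)))"
  proof (rule bind_pmf_cong[OF refl])
    fix b
    have "Pi_pmf ?E None (\<lambda>e. if b e \<or> e \<in> edges G then map_pmf (\<lambda>c. Some (Some c)) ?U else return_pmf None) =
        Pi_pmf (edges (\<Gamma> b)) None (\<lambda>_. map_pmf (\<lambda>c. Some (Some c)) ?U)"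
      unfolding \<Gamma>e by (rule Pi_pmf_if_set[OF finE])
    also have "\<dots> = bind_pmf (Pi_pmf (edges (\<Gamma> b)) 0 (\<lambda>_. ?U))
        (\<lambda>\<psi>. Pi_pmf (edges (\<Gamma> b)) None (\<lambda>e. return_pmf (Some (Some (\<psi> e)))))"
      unfolding map_pmf_def by (rule Pi_pmf_bind[OF fin\<Gamma>])
    also have "\<dots> = map_pmf (\<lambda>\<psi> e. if e \<in> edges (\<Gamma> b) then Some (Some (\<psi> e)) else None) (Pi_pmf (edges (\<Gamma> b)) 0 (\<lambda>_. ?U))"
      using fin\<Gamma> by (simp add: map_pmf_def)
    finally show "Pi_pmf ?E None (\<lambda>e. if b e \<or> e \<in> edges G then map_pmf (\<lambda>c. Some (Some c)) ?U else return_pmf None) = \<dots>" .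
  qed
  finally have "emeasure (Pi_pmf ?E None (coloured_pair G p k)) (has_rainbow (copies {1..n} T)) =
      (\<integral>\<^sup>+b. emeasure (Pi_pmf (edges (\<Gamma> b)) 0 (\<lambda>_. ?U))
        {\<psi>. (\<lambda>e. if e \<in> edges (\<Gamma> b) then Some (Some (\<psi> e)) else None) \<in> has_rainbow (copies {1..n} T)} \<partial>?B)"
    by (simp add: vimage_def)
  also have "\<dots> \<le> (\<integral>\<^sup>+b. emeasure (Pi_pmf (edges (\<Gamma> b)) 0 (\<lambda>_. ?U)) {\<psi>. has_spanning_rainbow_copy (\<Gamma> b) \<psi> T} \<partial>?B)"
  proof (intro nn_integral_mono emeasure_mono)
    fix b
    show "{\<psi>. (\<lambda>e. if e \<in> edges (\<Gamma> b) then Some (Some (\<psi> e)) else None) \<in> has_rainbow (copies {1..n} T)} \<subseteq>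
        {\<psi>. has_spanning_rainbow_copy (\<Gamma> b) \<psi> T}"
    proof clarify
      fix \<psi> :: "nat set \<Rightarrow> nat"
      assume "(\<lambda>e. if e \<in> edges (\<Gamma> b) then Some (Some (\<psi> e)) else None) \<in> has_rainbow (copies {1..n} T)"
      then obtain F where F: "F \<in> copies {1..n} T"
        and rb: "rainbow_state F (\<lambda>e. if e \<in> edges (\<Gamma> b) then Some (Some (\<psi> e)) else None)"
        by (auto simp: has_rainbow_def)
      have sub: "F \<subseteq> edges (\<Gamma> b)" using rb by (auto simp: rainbow_state_def split: if_splits)
      have "inj_on \<psi> F" using rb sub unfolding rainbow_state_def inj_on_def by (auto split: if_splits)
      then show "has_spanning_rainbow_copy (\<Gamma> b) \<psi> T"
        using F sub unfolding has_spanning_rainbow_copy_def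
        by (intro exI[of _ "Graph {1..n} F"])
          (auto simp: copies_def spanning_subgraph_def simple_graph_def rainbow_def \<Gamma>v)
    qed
  qed simp
  also have "\<dots> = emeasure (coloured_perturbed_graph G n p k) ?A"
    by (simp add: coloured_perturbed_graph_def binomial_random_graph_def uniform_colouring_def
        Let_def vimage_def \<Gamma>_def bind_map_pmf)
  finally show ?thesis .
qed

text \<open>Two separate coins per pair, one thinning \<open>G\<close> and one for the random graph,
  make the two graphs independent, so that they can be exposed one after the other.\<close>

definition plain_pair :: "nat ugraph \<Rightarrow> real \<Rightarrow> real \<Rightarrow> nat set \<Rightarrow> pair_state pmf" where
  "plain_pair G q p e = bind_pmf (bernoulli_pmf q) (\<lambda>s. bind_pmf (bernoulli_pmf p)
     (\<lambda>r. return_pmf (if s \<and> e \<in> edges G \<or> r then Some None else None)))"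

lemma Pi_plain_pair:
  "Pi_pmf (all_pairs {1..n}) None (plain_pair G q p) =
    bind_pmf (Pi_pmf (all_pairs {1..n}) False (\<lambda>_. bernoulli_pmf q)) (\<lambda>s.
    bind_pmf (Pi_pmf (all_pairs {1..n}) False (\<lambda>_. bernoulli_pmf p)) (\<lambda>r.
      return_pmf (\<lambda>e. if e \<in> all_pairs {1..n} \<and> (s e \<and> e \<in> edges G \<or> r e) then Some None else None)))"
proof -
  have finE: "finite (all_pairs {1..n})" by (simp add: all_pairs_def)
  have "Pi_pmf (all_pairs {1..n}) None (plain_pair G q p) =
      bind_pmf (Pi_pmf (all_pairs {1..n}) False (\<lambda>_. bernoulli_pmf q)) (\<lambda>s.
        Pi_pmf (all_pairs {1..n}) None (\<lambda>e. bind_pmf (bernoulli_pmf p)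
          (\<lambda>r. return_pmf (if s e \<and> e \<in> edges G \<or> r then Some None else None))))"
    unfolding plain_pair_def by (rule Pi_pmf_bind[OF finE])
  also have "\<dots> = bind_pmf (Pi_pmf (all_pairs {1..n}) False (\<lambda>_. bernoulli_pmf q)) (\<lambda>s.
      bind_pmf (Pi_pmf (all_pairs {1..n}) False (\<lambda>_. bernoulli_pmf p)) (\<lambda>r.
        Pi_pmf (all_pairs {1..n}) None (\<lambda>e. return_pmf (if s e \<and> e \<in> edges G \<or> r e then Some None else None))))"
    by (intro bind_pmf_cong refl, rule Pi_pmf_bind[OF finE])
  also have "\<dots> = bind_pmf (Pi_pmf (all_pairs {1..n}) False (\<lambda>_. bernoulli_pmf q)) (\<lambda>s.
      bind_pmf (Pi_pmf (all_pairs {1..n}) False (\<lambda>_. bernoulli_pmf p)) (\<lambda>r.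
      return_pmf (\<lambda>e. if e \<in> all_pairs {1..n} \<and> (s e \<and> e \<in> edges G \<or> r e) then Some None else None)))"
    unfolding Pi_pmf_return_pmf[OF finE]
    by (intro bind_pmf_cong refl arg_cong[of _ _ return_pmf] ext) simp
  finally show ?thesis .
qed

text \<open>With \<open>m\<close> colours forbidden, a coloured pair is present in an allowed colour
  with probability at least \<open>1 - m / k\<close> if it is an edge of \<open>G\<close>, and
  \<open>p * (1 - m / k)\<close> if not. A plain edge of \<open>G\<close> can come from either coin,
  with probability at most \<open>q + p' \<le> 2 * q\<close>; hence the factor 2.\<close>

lemma prob_pairs_le:
  assumes T: "finite (edges T)" "card (edges T) \<le> m" and k: "m < k"
    and p: "0 \<le> p" "p \<le> 1" and q: "0 \<le> q" "2 * q \<le> 1 - real m / real k"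
    and p': "p' = p * q"
  shows "emeasure (Pi_pmf (all_pairs {1..n}) None (plain_pair G q p')) (has_rainbow (copies {1..n} T)) \<le>
    emeasure (Pi_pmf (all_pairs {1..n}) None (coloured_pair G p k)) (has_rainbow (copies {1..n} T))"
proof (rule plain_le_coloured[where m = m])
  show "finite (all_pairs {1..n})" by (simp add: all_pairs_def)
  show "finite F \<and> card F \<le> m" if F: "F \<in> copies {1..n} T" for F
  proof -
    obtain \<phi> where \<phi>: "F = (\<lambda>e. \<phi> ` e) ` edges T" using F by (auto simp: copies_def graph_isomorphic_def)
    have "finite (all_pairs {1..n})" by (simp add: all_pairs_def)
    then have "finite F" using F by (auto simp: copies_def intro: finite_subset)
    then show ?thesis using \<phi> T(2) card_image_le[OF T(1)] by (meson le_trans)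
  qed
  show "set_pmf (plain_pair G q p' e) \<subseteq> {None, Some None}" for e
    by (auto simp: plain_pair_def split: if_splits)
  have "0 \<le> real m / real k" by simp
  then have q1: "q \<le> 1" "2 * q \<le> 1" using q by linarith+
  have p'1: "0 \<le> p'" "p' \<le> q" "p' \<le> 1" using p q q1 by (auto simp: p' mult_left_le_one_le mult_le_one)
  fix e and U :: "nat set" assume U: "finite U" "card U \<le> m"
  have k0: "k > 0" using k by simp
  have fresh: "1 - real m / real k \<le> measure_pmf.prob (pmf_of_set {1..k}) (- U)"
  proof -
    have "real k - real m \<le> real (card ({1..k} \<inter> - U))"
    proof -
      have "card {1..k} - card U \<le> card ({1..k} - U)" by (rule diff_card_le_card_Diff[OF U(1)])
      then have "k - m \<le> card ({1..k} - U)" using U(2) by simp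
      then show ?thesis using k by (simp add: Diff_eq)
    qed
    then have "(real k - real m) / real k \<le> real (card ({1..k} \<inter> - U)) / real k"
      using k0 by (intro divide_right_mono) auto
    moreover have "measure_pmf.prob (pmf_of_set {1..k}) (- U) = real (card ({1..k} \<inter> - U)) / real k"
      using k0 by (subst measure_pmf_of_set) auto
    ultimately show ?thesis using k0 by (simp add: diff_divide_distrib)
  qed
  have col: "measure_pmf.prob (map_pmf (\<lambda>c. Some (Some c)) (pmf_of_set {1..k})) {v. \<exists>c. c \<notin> U \<and> v = Some (Some c)}
      = measure_pmf.prob (pmf_of_set {1..k}) (- U)"
    by (simp add: vimage_def Compl_eq)
  have prob_bind: "measure_pmf.prob (bind_pmf (bernoulli_pmf r) N) X =
      measure_pmf.prob (N True) X * r + measure_pmf.prob (N False) X * (1 - r)"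
    if r: "0 \<le> r" "r \<le> 1" for r and N :: "bool \<Rightarrow> pair_state pmf" and X
  proof -
    have "ennreal (measure_pmf.prob (bind_pmf (bernoulli_pmf r) N) X) = emeasure (bind_pmf (bernoulli_pmf r) N) X"
      by (simp only: measure_pmf.emeasure_eq_measure)
    also have "\<dots> = emeasure (N True) X * r + emeasure (N False) X * (1 - r)"
      using r by simp
    also have "\<dots> = ennreal (measure_pmf.prob (N True) X * r + measure_pmf.prob (N False) X * (1 - r))"
      using r by (simp add: measure_pmf.emeasure_eq_measure ennreal_mult)
    finally show ?thesis using r by (subst (asm) ennreal_inj) auto
  qed
  have "measure_pmf.prob (plain_pair G q p' e) {Some None} \<le> (if e \<in> edges G then 1 else p) * (2 * q)"
  proof -
    have "measure_pmf.prob (plain_pair G q p' e) {Some None} = (if e \<in> edges G then q + p' * (1 - q) else p')"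
      using p'1 q q1 by (simp add: plain_pair_def prob_bind indicator_def algebra_simps)
    moreover have "p' * (1 - q) \<le> q" using p'1 q q1 mult_left_le[of "1 - q" p'] by simp
    moreover have "p' \<le> p * (2 * q)" using p q by (simp add: p')
    ultimately show ?thesis by simp
  qed
  also have "\<dots> \<le> (if e \<in> edges G then 1 else p) * measure_pmf.prob (pmf_of_set {1..k}) (- U)"
    using fresh q p by (intro mult_left_mono) auto
  also have "\<dots> \<le> measure_pmf.prob (coloured_pair G p k e) {v. \<exists>c. c \<notin> U \<and> v = Some (Some c)}"
    using p by (auto simp: coloured_pair_def prob_bind col Compl_eq algebra_simps)
  finally show "measure_pmf.prob (plain_pair G q p' e) {Some None} \<le>
      measure_pmf.prob (coloured_pair G p k e) {v. \<exists>c. c \<notin> U \<and> v = Some (Some c)}" .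
qed

section \<open>The probability of a rainbow copy\<close>

lemma card_nbs:
  assumes "E \<subseteq> all_pairs W"
  shows "card (nbs E v) = card {e \<in> E. v \<in> e}"
proof -
  have "bij_betw (\<lambda>y. {v, y}) (nbs E v) {e \<in> E. v \<in> e}"
  proof (rule bij_betwI')
    fix e assume "e \<in> {e \<in> E. v \<in> e}"
    then have e: "e \<in> E" "v \<in> e" "card e = 2" using assms by (auto simp: all_pairs_def)
    then obtain y where "e = {v, y}" by (metis card_2_iff doubleton_eq_iff insertE singletonD)
    then show "\<exists>y\<in>nbs E v. e = {v, y}" using e by (auto simp: nbs_def)
  qed (auto simp: nbs_def doubleton_eq_iff)
  then show ?thesis by (rule bij_betw_same_card)
qed

lemma nbs_subset: "E \<subseteq> all_pairs W \<Longrightarrow> nbs E v \<subseteq> W"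
  by (auto simp: nbs_def all_pairs_def)

lemma tree_children_bound:
  assumes rt: "rooted_tree (verts T) r par rk" and E: "edges T = (\<lambda>v. {v, par v}) ` (verts T - {r})"
    and d: "max_degree T \<le> d" and z: "z \<in> verts T"
  shows "card (rooted_tree.children (verts T) r par z) \<le> d"
proof -
  interpret rooted_tree "verts T" r par rk by fact
  have finE: "finite (edges T)" unfolding E using finV by simp
  have "inj_on (\<lambda>c. {c, z}) (children z)" by (auto simp: inj_on_def doubleton_eq_iff)
  then have "card (children z) = card ((\<lambda>c. {c, z}) ` children z)" by (simp add: card_image)
  also have "\<dots> \<le> card {e \<in> edges T. z \<in> e}"
    using finE by (intro card_mono) (auto simp: children_def E)
  also have "\<dots> = degree T z" by (simp add: degree_def)
  also have "\<dots> \<le> max_degree T" unfolding max_degree_def using finV z by (intro Max_ge) auto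
  finally show ?thesis using d by simp
qed

text \<open>Root \<open>T\<close> anywhere, take a branch with \<open>N\<close> to
  \<open>d * N\<close> vertices, and re-root at its top \<open>v\<close>. Now the branch is
  parent-closed, and the rest of the tree leaves it only by the edge from \<open>v\<close> to its
  former parent, as \<open>embed_spanning\<close> demands. By \<open>pot\<close>, the final
  potential is below the weight of a pair served too rarely.\<close>

lemma tree_in_union:
  fixes W :: "'v set" and T :: "'a ugraph" and \<delta> \<kappa> :: real
  assumes T: "is_tree T" "card (verts T) = n" "max_degree T \<le> d"
    and finW: "finite W" and cardW: "card W = n"
    and EG: "EG \<subseteq> all_pairs W" "\<And>x. x \<in> W \<Longrightarrow> \<delta> * n \<le> card (nbs EG x)"
    and ER: "ER \<subseteq> all_pairs W" "joins_large W ER t"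
    and \<kappa>: "0 < \<kappa>" "\<kappa> \<le> 1"
    and free: "\<And>Q. gadget_system W ER Q \<Longrightarrow> card Q < m \<Longrightarrow> \<not> stuck ER (useful W EG \<kappa> Q)"
    and num: "d \<ge> 1" "K \<ge> 1" "t \<ge> 1" "t \<le> m" "N \<ge> 1" "d * N < n"
      "2 * (1 + d + d * d) + 2 * (4 * (2 + d + d * d)) * m \<le> N"
      "real (d * N + 3 * m + t) \<le> \<delta> * n" "1 + d * K * ((d + 1) * t) \<le> u" "u + d * N \<le> n"
    and pot: "real n^2 * (1 - \<kappa> / 2) ^ m < (1/2) ^ (t + d * t + n div K + 1 + u)"
  shows "\<exists>F\<in>copies W T. F \<subseteq> EG \<union> ER"
proof -
  obtain Q where Q: "gadget_system W ER Q" "card Q = m" "potential W EG Q \<le> (card W)^2 * (1 - \<kappa> / 2) ^ m"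
    using exists_gadget_system[OF finW \<kappa> free] by blast
  have rich: "t + d * t + n div K + 1 + u < card {g \<in> Q. {w, gfst g} \<in> EG \<and> {w, glast g} \<in> EG \<and> {x, gmid g} \<in> EG}"
    if "w \<in> W" "x \<in> W" for w x
  proof (rule ccontr)
    assume "\<not> ?thesis"
    then have "card {g \<in> Q. serves EG (w, x) g} \<le> t + d * t + n div K + 1 + u"
      by (simp add: serves_def)
    then have "(1/2 :: real) ^ (t + d * t + n div K + 1 + u) \<le> weight EG Q (w, x)"
      unfolding weight_def by (intro power_decreasing) auto
    also have "\<dots> \<le> potential W EG Q" using that by (intro weight_le_potential finW) auto
    finally show False using Q(3) pot cardW by simp
  qed
  have "verts T \<noteq> {}" using T by (auto simp: is_tree_def connected_graph_def)
  then obtain r0 where r0: "r0 \<in> verts T" by blast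
  obtain par0 rk0 where rt0: "rooted_tree (verts T) r0 par0 rk0"
    and E0: "edges T = (\<lambda>v. {v, par0 v}) ` (verts T - {r0})" using tree_rooted[OF T(1) r0] by blast
  interpret R0: rooted_tree "verts T" r0 par0 rk0 by fact
  have "\<exists>v\<in>R0.desc r0. N \<le> card (R0.desc v) \<and> card (R0.desc v) \<le> d * N"
  proof (rule R0.exists_branch)
    show "N \<le> card (R0.desc r0)" unfolding R0.desc_root
      using T(2) num(1,6) by (metis le_trans less_imp_le mult_le_mono1 nat_mult_1)
  qed (use tree_children_bound[OF rt0 E0 T(3)] num r0 in auto)
  then obtain v where v: "v \<in> verts T" "N \<le> card (R0.desc v)" "card (R0.desc v) \<le> d * N"
    using R0.desc_subset by blast
  define A0 where "A0 = R0.desc v"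
  obtain par rk where rt: "rooted_tree (verts T) v par rk"
    and E: "edges T = (\<lambda>u. {u, par u}) ` (verts T - {v})" using tree_rooted[OF T(1) v(1)] by blast
  interpret R: rooted_tree "verts T" v par rk by fact
  \<comment> \<open>Re-rooting keeps the edges: the new parent edge of \<open>u\<close> is the old
    parent edge of either \<open>u\<close> or its new parent.\<close>
  have flip: "par u = par0 u \<and> u \<noteq> r0 \<or> par0 (par u) = u \<and> par u \<in> verts T - {r0}" if "u \<in> verts T - {v}" for u
  proof -
    have "{u, par u} \<in> (\<lambda>v. {v, par0 v}) ` (verts T - {r0})" using that E E0 by blast
    then obtain z where "z \<in> verts T - {r0}" "{u, par u} = {z, par0 z}" by blast
    then show ?thesis by (auto simp: doubleton_eq_iff)
  qed
  have A0V: "A0 \<subseteq> verts T" by (simp add: A0_def R0.desc_subset)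
  have vA0: "v \<in> A0" using R0.desc_self v(1) by (simp add: A0_def)
  have pc: "R.parent_closed A0"
    unfolding R.parent_closed_def
  proof (intro conjI ballI)
    show "A0 \<subseteq> verts T" "v \<in> A0" by fact+
    fix u assume u: "u \<in> A0 - {v}"
    then have "u \<in> verts T - {v}" using A0V by blast
    from flip[OF this] show "par u \<in> A0"
      using R0.desc_par[of u v] R0.desc_child[of "par u" v] u by (auto simp: A0_def)
  qed
  have exit: "u = par0 v \<and> par u = v" if "u \<in> verts T - A0" "par u \<in> A0" for u
  proof -
    have "u \<in> verts T - {v}" using that vA0 by blast
    from flip[OF this] have "par0 (par u) = u"
      using R0.desc_child[of u v] that by (auto simp: A0_def)
    moreover have "par u = v"
      using R0.desc_par[of "par u" v] that calculation by (auto simp: A0_def)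
    ultimately show ?thesis by auto
  qed
  have degT: "card (R.children z) \<le> d" if "z \<in> verts T" for z
    by (rule tree_children_bound[OF rt E T(3) that])
  have "\<exists>\<phi>. inj_on \<phi> (verts T) \<and> \<phi> ` verts T \<subseteq> W \<and> (\<forall>u\<in>verts T - {v}. {\<phi> u, \<phi> (par u)} \<in> EG \<union> ER)"
  proof (rule R.embed_spanning[where d = d and K = K and t = t and Q = Q and ?A0.0 = A0 and w = "par0 v" and u = u])
    show "2 * (1 + d + d * d) + 2 * (4 * (2 + d + d * d)) * (card Q - t) \<le> card A0"
    proof -
      have "2 * (4 * (2 + d + d * d)) * (card Q - t) \<le> 2 * (4 * (2 + d + d * d)) * m"
        using Q(2) by (intro mult_left_mono) auto
      then show ?thesis using num(7) v(2) unfolding A0_def by linarith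
    qed
    show "card A0 + 3 * card Q + t \<le> card (nbs EG x)" if "x \<in> W" for x
    proof -
      have "real (card A0 + 3 * card Q + t) \<le> real (d * N + 3 * m + t)"
        using v(3) Q(2) unfolding A0_def of_nat_le_iff by simp
      then have "real (card A0 + 3 * card Q + t) \<le> real (card (nbs EG x))" using num(8) EG(2)[OF that] by linarith
      then show ?thesis by (simp only: of_nat_le_iff)
    qed
    show "u + card A0 \<le> card (verts T)" using num(10) v(3) T(2) by (simp add: A0_def)
    show "t + d * t + card (verts T) div K + 1 + u < card {g \<in> Q. {w, gfst g} \<in> EG \<and> {w, glast g} \<in> EG \<and> {x, gmid g} \<in> EG}"
      if "w \<in> W" "x \<in> W" for w x using rich[OF that] T(2) by simp
    show "\<And>u. u \<in> verts T - A0 \<Longrightarrow> par u \<in> A0 \<Longrightarrow> u = par0 v \<and> par u = v" by (rule exit)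
    show "\<And>z. z \<in> verts T \<Longrightarrow> card (R.children z) \<le> d" by (rule degT)
    show "R.parent_closed A0" by (rule pc)
  qed (use num ER Q finW cardW T(2) nbs_subset[OF EG(1)] in auto)
  then obtain \<phi> where \<phi>: "inj_on \<phi> (verts T)" "\<phi> ` verts T \<subseteq> W"
    "\<forall>u\<in>verts T - {v}. {\<phi> u, \<phi> (par u)} \<in> EG \<union> ER" by blast
  have "card (\<phi> ` verts T) = card W" using \<phi>(1) T(2) cardW by (simp add: card_image)
  then have "\<phi> ` verts T = W" using \<phi>(2) finW by (simp add: card_subset_eq)
  then have bij: "bij_betw \<phi> (verts T) W" using \<phi>(1) by (simp add: bij_betw_def)
  define F where "F = (\<lambda>e. \<phi> ` e) ` edges T"
  have sub: "F \<subseteq> EG \<union> ER" using \<phi>(3) by (auto simp: F_def E)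
  then have "F \<in> copies W T"
    using bij EG(1) ER(1) by (auto simp: copies_def graph_isomorphic_def F_def)
  then show ?thesis using sub by blast
qed

text \<open>Markov's inequality for the random variable
  \<open>(1/2) ^ card {e \<in> S. s e}\<close>, whose expectation is
  \<open>(1 - q / 2) ^ card S\<close>.\<close>

lemma prob_few_present:
  assumes finW: "finite W" and S: "S \<subseteq> all_pairs W" and q: "0 \<le> q" "q \<le> 1"
  shows "measure_pmf.prob (random_pairs W q) {s. card {e \<in> S. s e} \<le> t} \<le> 2 ^ t * (1 - q / 2) ^ card S"
proof -
  let ?E = "all_pairs W"
  have finE: "finite ?E" by (rule finite_all_pairs[OF finW])
  have finS: "finite S" using S finE finite_subset by blast
  define f where "f e b = (if e \<in> S \<and> b then ennreal (1/2) else 1)" for e b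
  have "emeasure (random_pairs W q) {s. card {e \<in> S. s e} \<le> t} = (\<integral>\<^sup>+s. indicator {s. card {e \<in> S. s e} \<le> t} s \<partial>random_pairs W q)"
    by simp
  also have "\<dots> \<le> (\<integral>\<^sup>+s. ennreal 2 ^ t * (\<Prod>e\<in>?E. f e (s e)) \<partial>random_pairs W q)"
  proof (rule nn_integral_mono)
    fix s
    have "(\<Prod>e\<in>?E. f e (s e)) = ennreal (1/2) ^ card {e \<in> S. s e}"
    proof -
      have "(\<Prod>e\<in>?E. f e (s e)) = (\<Prod>e\<in>{e \<in> S. s e}. ennreal (1/2))"
        unfolding f_def using S finE by (subst prod.If_cases) (auto intro!: arg_cong2[where f = power] arg_cong[where f = card])
      then show ?thesis by simp
    qed
    moreover have "1 \<le> ennreal 2 ^ t * ennreal (1/2) ^ j" if "j \<le> t" for j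
    proof -
      have "(1::real) \<le> 2 ^ (t - j)" by simp
      also have "\<dots> = 2 ^ t * (1/2) ^ j" using that by (simp add: power_diff power_divide)
      finally have "ennreal 1 \<le> ennreal (2 ^ t * (1/2) ^ j)" by (rule ennreal_leI)
      also have "ennreal (2 ^ t * (1/2) ^ j) = ennreal (2 ^ t) * ennreal ((1/2) ^ j)"
        by (rule ennreal_mult) auto
      also have "ennreal (2 ^ t) = ennreal 2 ^ t" by (rule ennreal_power[symmetric]) simp
      also have "ennreal ((1/2) ^ j) = ennreal (1/2) ^ j" by (rule ennreal_power[symmetric]) simp
      finally show ?thesis by (simp only: ennreal_1)
    qed
    ultimately show "indicator {s. card {e \<in> S. s e} \<le> t} s \<le> ennreal 2 ^ t * (\<Prod>e\<in>?E. f e (s e))"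
      by (auto simp: indicator_def)
  qed
  also have "\<dots> = ennreal 2 ^ t * (\<Prod>e\<in>?E. \<integral>\<^sup>+b. f e b \<partial>bernoulli_pmf q)"
    unfolding random_pairs_def by (simp add: nn_integral_cmult nn_integral_prod_Pi_pmf[OF finE])
  also have "(\<Prod>e\<in>?E. \<integral>\<^sup>+b. f e b \<partial>bernoulli_pmf q) = (\<Prod>e\<in>?E. if e \<in> S then ennreal (1 - q / 2) else 1)"
  proof (rule prod.cong)
    fix e
    have "ennreal (1/2) * ennreal q + ennreal (1 - q) = ennreal (1 - q / 2)"
    proof -
      have "ennreal (1/2) * ennreal q = ennreal (1/2 * q)" by (rule ennreal_mult[symmetric]) (use q in auto)
      also have "\<dots> + ennreal (1 - q) = ennreal (1/2 * q + (1 - q))" by (rule ennreal_plus[symmetric]) (use q in auto)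
      finally show ?thesis by (simp add: field_simps)
    qed
    moreover have "ennreal q + ennreal (1 - q) = 1" using q by (simp flip: ennreal_plus)
    ultimately show "(\<integral>\<^sup>+b. f e b \<partial>bernoulli_pmf q) = (if e \<in> S then ennreal (1 - q / 2) else 1)"
      using q by (simp add: f_def)
  qed simp
  also have "\<dots> = ennreal (1 - q / 2) ^ card S"
    using S finE by (simp add: prod.If_cases Int_absorb1)
  also have "ennreal 2 ^ t * ennreal (1 - q / 2) ^ card S = ennreal (2 ^ t * (1 - q / 2) ^ card S)"
  proof -
    have "ennreal 2 ^ t = ennreal (2 ^ t)" by (rule ennreal_power) simp
    moreover have "ennreal (1 - q / 2) ^ card S = ennreal ((1 - q / 2) ^ card S)"
      by (rule ennreal_power) (use q in auto)
    moreover have "ennreal (2 ^ t * (1 - q / 2) ^ card S) = ennreal (2 ^ t) * ennreal ((1 - q / 2) ^ card S)"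
      by (rule ennreal_mult) (use q in auto)
    ultimately show ?thesis by (simp only:)
  qed
  finally show ?thesis using q by (simp add: measure_pmf.emeasure_eq_measure)
qed

text \<open>The thinned seed graph is exposed first; \<delta> is the degree density wanted there,
  while \<open>g\<close> bounds the degrees of \<open>G\<close>. The first error term covers thinned
  graphs with a low degree. For every other one, failure means that the random graph does not join
  large sets or gets stuck, with bounds that do not depend on the thinned graph. The colours are
  restored by \<open>prob_pairs_le\<close>.\<close>

lemma prob_copy_bound:
  fixes T :: "'a ugraph" and \<delta> \<kappa> p q :: real
  assumes T: "is_tree T" "card (verts T) = n" "max_degree T \<le> d"
    and G: "simple_graph G" "verts G = {1..n}" "\<And>v. v \<in> {1..n} \<Longrightarrow> g \<le> degree G v"
    and p: "0 \<le> p" "p \<le> 1" and k: "n < k" and q: "0 \<le> q" "2 * q \<le> 1 - real n / real k"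
    and \<delta>: "0 < \<delta>" "\<delta> \<le> 1" "\<delta> * n \<le> real l + 1" and \<kappa>: "\<kappa> = \<delta>^3 / 4"
    and num: "d \<ge> 1" "K \<ge> 1" "s \<ge> 1" "2 * s \<le> m" "N \<ge> 1" "d * N < n"
      "2 * (1 + d + d * d) + 2 * (4 * (2 + d + d * d)) * m \<le> N"
      "real (d * N + 3 * m + 2 * s) \<le> \<delta> * n" "1 + d * K * ((d + 1) * (2 * s)) \<le> u" "u + d * N \<le> n"
    and small: "9 * real m + 3 \<le> \<delta>^3 / 2 * n" and j: "j \<ge> 1" "real j \<le> \<kappa> * n / 8"
    and pot: "real n^2 * (1 - \<kappa> / 2) ^ m < (1/2) ^ (2 * s + d * (2 * s) + n div K + 1 + u)"
  shows "1 - (n * (2 ^ l * (1 - q / 2) ^ g) + (4 ^ n * (1 - p * q) ^ (s * s) +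
      (1 + real n * real n * (p * q)^2) ^ n * (1 + n * (p * q)) ^ n * (1 - p * q) ^ (j * j))) \<le>
    measure_pmf.prob (coloured_perturbed_graph G n p k) {(\<Gamma>, \<psi>). has_spanning_rainbow_copy \<Gamma> \<psi> T}"
proof -
  let ?W = "{1..n}"
  define p' where "p' = p * q"
  define \<epsilon>1 where "\<epsilon>1 = n * (2 ^ l * (1 - q / 2) ^ g)"
  define \<epsilon>2 where "\<epsilon>2 = 4 ^ n * (1 - p') ^ (s * s) +
      (1 + real n * real n * p'^2) ^ n * (1 + n * p') ^ n * (1 - p') ^ (j * j)"
  have "0 \<le> real n / real k" by simp
  then have q1: "q \<le> 1" "q / 2 \<le> 1" using q by linarith+
  have p'1: "0 \<le> p'" "p' \<le> 1" using p q q1 by (auto simp: p'_def mult_le_one)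
  have n0: "n > 0" using num(6) by simp
  have \<kappa>1: "0 < \<kappa>" "\<kappa> \<le> 1" unfolding \<kappa> using \<delta>(1,2) power_le_one[of \<delta> 3] by auto
  have \<epsilon>0: "0 \<le> \<epsilon>1" "0 \<le> \<epsilon>2" unfolding \<epsilon>1_def \<epsilon>2_def using q1 p'1 by auto
  have GE: "edges G \<subseteq> all_pairs ?W" using G by (simp add: simple_graph_def)
  define EG where "EG s = {e \<in> edges G. s e}" for s :: "nat set \<Rightarrow> bool"
  have EGE: "EG s \<subseteq> all_pairs ?W" for s using GE by (auto simp: EG_def)
  define S where "S = {s. \<forall>x\<in>?W. \<delta> * n \<le> card (nbs (EG s) x)}"
  define A where "A s = {r. \<exists>F\<in>copies ?W T. F \<subseteq> EG s \<union> present ?W r}" for s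
  obtain r0 where r0: "r0 \<in> verts T" using T(1) by (auto simp: is_tree_def connected_graph_def)
  obtain par0 rk0 where "rooted_tree (verts T) r0 par0 rk0"
    and E0: "edges T = (\<lambda>v. {v, par0 v}) ` (verts T - {r0})" using tree_rooted[OF T(1) r0] by blast
  then interpret R0: rooted_tree "verts T" r0 par0 rk0 by simp
  have finT: "finite (edges T)" unfolding E0 using R0.finV by simp
  have "card (edges T) \<le> card (verts T - {r0})" unfolding E0 using R0.finV by (intro card_image_le) simp
  also have "\<dots> \<le> n" using R0.finV T(2) card_mono[of "verts T" "verts T - {r0}"] by auto
  finally have cardT: "card (edges T) \<le> n" .
  have PS: "1 - \<epsilon>1 \<le> measure_pmf.prob (random_pairs ?W q) S"
  proof -
    define B where "B x = {s. card {e \<in> {e \<in> edges G. x \<in> e}. s e} \<le> l}" for x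
    have "- S \<subseteq> (\<Union>x\<in>?W. B x)"
    proof
      fix s assume "s \<in> - S"
      then obtain x where x: "x \<in> ?W" "\<not> \<delta> * n \<le> card (nbs (EG s) x)" by (auto simp: S_def)
      then have "real (card (nbs (EG s) x)) < real (l + 1)" using \<delta>(3) by simp
      then have "card (nbs (EG s) x) \<le> l" unfolding of_nat_less_iff by simp
      moreover have "{e \<in> EG s. x \<in> e} = {e \<in> {e \<in> edges G. x \<in> e}. s e}" by (auto simp: EG_def)
      ultimately have "s \<in> B x" by (simp add: card_nbs[OF EGE] B_def)
      then show "s \<in> (\<Union>x\<in>?W. B x)" using x by blast
    qed
    then have "measure_pmf.prob (random_pairs ?W q) (- S) \<le> measure_pmf.prob (random_pairs ?W q) (\<Union>x\<in>?W. B x)"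
      by (intro measure_pmf.finite_measure_mono) auto
    also have "\<dots> \<le> (\<Sum>x\<in>?W. measure_pmf.prob (random_pairs ?W q) (B x))"
      by (intro measure_pmf.finite_measure_subadditive_finite) auto
    also have "\<dots> \<le> (\<Sum>x\<in>?W. 2 ^ l * (1 - q / 2) ^ g)"
    proof (rule sum_mono)
      fix x assume x: "x \<in> ?W"
      have "measure_pmf.prob (random_pairs ?W q) (B x) \<le> 2 ^ l * (1 - q / 2) ^ card {e \<in> edges G. x \<in> e}"
        unfolding B_def using GE q q1 by (intro prob_few_present) auto
      also have "\<dots> \<le> 2 ^ l * (1 - q / 2) ^ g"
        using G(3)[OF x] q q1 by (intro mult_left_mono power_decreasing) (auto simp: degree_def)
      finally show "measure_pmf.prob (random_pairs ?W q) (B x) \<le> 2 ^ l * (1 - q / 2) ^ g" .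
    qed
    also have "\<dots> = \<epsilon>1" by (simp add: \<epsilon>1_def)
    finally show ?thesis using measure_pmf.prob_compl[of S "random_pairs ?W q"] by (simp add: Compl_eq_Diff_UNIV)
  qed
  have PA: "1 - \<epsilon>2 \<le> measure_pmf.prob (random_pairs ?W p') (A s')" if s': "s' \<in> S" for s'
  proof -
    let ?J = "{b. \<not> joins_large ?W (present ?W b) (2 * s)}"
    let ?S = "{b. \<exists>Q. gadget_system ?W (present ?W b) Q \<and> card Q < m \<and> stuck (present ?W b) (useful ?W (EG s') \<kappa> Q)}"
    have deg: "\<delta> * n \<le> card (nbs (EG s') x)" if "x \<in> ?W" for x using s' that by (auto simp: S_def)
    have "- A s' \<subseteq> ?J \<union> ?S"
    proof
      fix b assume b: "b \<in> - A s'"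
      show "b \<in> ?J \<union> ?S"
      proof (rule ccontr)
        assume nb: "b \<notin> ?J \<union> ?S"
        have "\<exists>F\<in>copies ?W T. F \<subseteq> EG s' \<union> present ?W b"
        proof (rule tree_in_union[OF T _ _ EGE _ _ _ \<kappa>1 _ num(1,2) _ num(4-10) pot])
          show "\<delta> * n \<le> card (nbs (EG s') x)" if "x \<in> ?W" for x using deg[OF that] .
          show "joins_large ?W (present ?W b) (2 * s)" using nb by blast
          show "\<not> stuck (present ?W b) (useful ?W (EG s') \<kappa> Q)"
            if "gadget_system ?W (present ?W b) Q" "card Q < m" for Q using nb that by blast
        qed (use num(3) in \<open>auto simp: present_def\<close>)
        then show False using b by (simp add: A_def)
      qed
    qed
    then have "measure_pmf.prob (random_pairs ?W p') (- A s') \<le> measure_pmf.prob (random_pairs ?W p') (?J \<union> ?S)"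
      by (intro measure_pmf.finite_measure_mono) auto
    also have "\<dots> \<le> measure_pmf.prob (random_pairs ?W p') ?J + measure_pmf.prob (random_pairs ?W p') ?S"
      by (intro measure_Un_le) auto
    also have "\<dots> \<le> \<epsilon>2"
      unfolding \<epsilon>2_def
    proof (intro add_mono prob_not_joins_large prob_stuck)
      fix Q assume Q: "gadget_system ?W (all_pairs ?W) Q" "card Q < m"
      show "\<kappa> * real n ^ 3 \<le> card (useful ?W (EG s') \<kappa> Q)"
      proof (rule card_useful[OF _ _ n0 nbs_subset[OF EGE] \<delta>(1) deg Q(1) _ \<kappa>])
        have "real (9 * card Q + 3) \<le> 9 * real m + 3" using Q(2) by simp
        then show "real (9 * card Q + 3) \<le> \<delta>^3 / 2 * n" using small by linarith
      qed auto
    qed (use p'1 n0 j \<kappa>1 in auto)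
    finally show ?thesis using measure_pmf.prob_compl[of "A s'" "random_pairs ?W p'"] by (simp add: Compl_eq_Diff_UNIV)
  qed
  have "ennreal (1 - \<epsilon>2) * emeasure (random_pairs ?W q) S = (\<integral>\<^sup>+s'. ennreal (1 - \<epsilon>2) * indicator S s' \<partial>random_pairs ?W q)"
    by (simp add: nn_integral_cmult_indicator)
  also have "\<dots> \<le> (\<integral>\<^sup>+s'. emeasure (random_pairs ?W p') (A s') \<partial>random_pairs ?W q)"
  proof (rule nn_integral_mono)
    fix s' show "ennreal (1 - \<epsilon>2) * indicator S s' \<le> emeasure (random_pairs ?W p') (A s')"
      using PA[of s'] by (cases "s' \<in> S") (auto simp: measure_pmf.emeasure_eq_measure intro: ennreal_leI)
  qed
  also have "\<dots> \<le> emeasure (Pi_pmf (all_pairs ?W) None (plain_pair G q p')) (has_rainbow (copies ?W T))"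
  proof -
    have "A s' \<subseteq> {r. (\<lambda>e. if e \<in> all_pairs ?W \<and> (s' e \<and> e \<in> edges G \<or> r e) then Some None else None) \<in> has_rainbow (copies ?W T)}" for s'
    proof
      fix r assume "r \<in> A s'"
      then obtain F where F: "F \<in> copies ?W T" "F \<subseteq> EG s' \<union> present ?W r" by (auto simp: A_def)
      then have "F \<subseteq> {e \<in> all_pairs ?W. s' e \<and> e \<in> edges G \<or> r e}" using GE by (auto simp: EG_def present_def)
      then have "rainbow_state F (\<lambda>e. if e \<in> all_pairs ?W \<and> (s' e \<and> e \<in> edges G \<or> r e) then Some None else None)"
        by (auto simp: rainbow_state_def split: if_splits)
      then show "r \<in> {r. (\<lambda>e. if e \<in> all_pairs ?W \<and> (s' e \<and> e \<in> edges G \<or> r e) then Some None else None) \<in> has_rainbow (copies ?W T)}"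
        using F(1) by (auto simp: has_rainbow_def)
    qed
    then show ?thesis
      unfolding Pi_plain_pair random_pairs_def[symmetric]
      by (simp del: emeasure_return_pmf add: map_pmf_def[symmetric] vimage_def)
        (intro nn_integral_mono emeasure_mono, auto)
  qed
  also have "\<dots> \<le> emeasure (Pi_pmf (all_pairs ?W) None (coloured_pair G p k)) (has_rainbow (copies ?W T))"
    by (rule prob_pairs_le[OF finT cardT k p q p'_def])
  also have "\<dots> \<le> emeasure (coloured_perturbed_graph G n p k) {(\<Gamma>, \<psi>). has_spanning_rainbow_copy \<Gamma> \<psi> T}"
    by (rule coloured_pair_le[OF G(1,2)])
  finally have main: "ennreal (1 - \<epsilon>2) * emeasure (random_pairs ?W q) S \<le>
      emeasure (coloured_perturbed_graph G n p k) {(\<Gamma>, \<psi>). has_spanning_rainbow_copy \<Gamma> \<psi> T}" .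
  let ?P = "measure_pmf.prob (coloured_perturbed_graph G n p k) {(\<Gamma>, \<psi>). has_spanning_rainbow_copy \<Gamma> \<psi> T}"
  let ?S = "measure_pmf.prob (random_pairs ?W q) S"
  \<comment> \<open>The inequality \<open>main\<close> was stated in \<open>ennreal\<close>, where
    negative numbers become 0; if \<epsilon>2 exceeds 1, the claim is trivial.\<close>
  have "1 - (\<epsilon>1 + \<epsilon>2) \<le> ?P"
  proof (cases "\<epsilon>2 \<le> 1")
    case True
    then have "ennreal ((1 - \<epsilon>2) * ?S) \<le> ennreal ?P"
      using main by (simp add: measure_pmf.emeasure_eq_measure ennreal_mult)
    then have "(1 - \<epsilon>2) * ?S \<le> ?P" by (subst (asm) ennreal_le_iff) auto
    moreover have "\<epsilon>2 * ?S \<le> \<epsilon>2" using \<epsilon>0 by (intro mult_left_le) auto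
    ultimately show ?thesis using PS by (simp add: algebra_simps)
  next
    case False
    moreover have "0 \<le> ?P" by simp
    ultimately show ?thesis using \<epsilon>0 by linarith
  qed
  then show ?thesis unfolding \<epsilon>1_def \<epsilon>2_def p'_def .
qed

section \<open>Numerical estimates and the choice of constants\<close>

lemma eventually_le_linear:
  fixes c C :: real
  assumes "c > 0"
  shows "\<forall>\<^sub>F n in sequentially. C \<le> c * real n"
  using assms by real_asymp

lemma nat_floor_bounds:
  fixes a :: real
  assumes "0 \<le> a"
  shows "real (nat \<lfloor>a * real n\<rfloor>) \<le> a * real n" "a * real n - 1 \<le> real (nat \<lfloor>a * real n\<rfloor>)"
proof -
  have "0 \<le> \<lfloor>a * real n\<rfloor>" using assms by simp
  then have "real (nat \<lfloor>a * real n\<rfloor>) = of_int \<lfloor>a * real n\<rfloor>" by simp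
  then show "real (nat \<lfloor>a * real n\<rfloor>) \<le> a * real n" "a * real n - 1 \<le> real (nat \<lfloor>a * real n\<rfloor>)" by linarith+
qed

lemma power_le_exp:
  fixes x :: real
  assumes "0 \<le> x" "x \<le> 1" "y \<le> x * real m"
  shows "(1 - x) ^ m \<le> exp (- y)"
proof -
  have "1 - x \<le> exp (- x)" using exp_ge_add_one_self[of "- x"] by simp
  then have "(1 - x) ^ m \<le> exp (- x) ^ m" using assms by (intro power_mono) auto
  also have "\<dots> = exp (- (x * real m))" by (simp add: exp_of_nat_mult[symmetric] mult.commute)
  also have "\<dots> \<le> exp (- y)" using assms by simp
  finally show ?thesis .
qed

lemma two_power_le_exp: "real m \<le> y \<Longrightarrow> (2::real) ^ m \<le> exp y"
proof -
  assume "real m \<le> y"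
  have "(2::real) \<le> exp 1" using exp_ge_add_one_self[of 1] by simp
  then have "(2::real) ^ m \<le> exp 1 ^ m" by (intro power_mono) auto
  also have "\<dots> = exp (real m)" by (simp add: exp_of_nat_mult[symmetric])
  also have "\<dots> \<le> exp y" using \<open>real m \<le> y\<close> by simp
  finally show ?thesis .
qed

lemma half_power_ge_exp: "real m \<le> y \<Longrightarrow> exp (- y) \<le> (1/2 :: real) ^ m"
proof -
  assume "real m \<le> y"
  then have "inverse (exp y) \<le> inverse ((2::real) ^ m)" using two_power_le_exp by (intro le_imp_inverse_le) auto
  then show ?thesis by (simp add: exp_minus power_divide inverse_eq_divide)
qed

text \<open>The factor \<open>4 ^ n\<close> is at most \<open>exp (2 * n)\<close>, and the at least
  \<open>(\<sigma> * n / 2)^2\<close> absent pairs give \<open>exp (- 4 * n)\<close> once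
  \<open>x\<close> is large.\<close>

lemma join_error_le:
  fixes p \<sigma> x :: real
  assumes "0 \<le> p" "p \<le> 1" "p * real n = x" "0 < \<sigma>" "\<sigma> / 2 * real n \<le> real s" "4 \<le> x * (\<sigma> / 2)^2"
  shows "4 ^ n * (1 - p) ^ (s * s) \<le> exp (- real n)"
proof -
  have "(4::real) ^ n = 2 ^ (2 * n)" by (simp add: power_mult)
  also have "\<dots> \<le> exp (2 * real n)" by (rule two_power_le_exp) simp
  finally have 1: "(4::real) ^ n \<le> exp (2 * real n)" .
  have "x * (\<sigma> / 2)^2 * real n = p * ((\<sigma> / 2 * real n) * (\<sigma> / 2 * real n))"
    using assms(3) by (simp add: power2_eq_square)
  also have "\<dots> \<le> p * (real s * real s)" using assms by (intro mult_left_mono mult_mono) auto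
  finally have "x * (\<sigma> / 2)^2 * real n \<le> p * real (s * s)" by simp
  moreover have "4 * real n \<le> x * (\<sigma> / 2)^2 * real n" using assms by (intro mult_right_mono) auto
  ultimately have "(1 - p) ^ (s * s) \<le> exp (- (4 * real n))" using assms by (intro power_le_exp) auto
  then have "4 ^ n * (1 - p) ^ (s * s) \<le> exp (2 * real n) * exp (- (4 * real n))"
    using 1 assms by (intro mult_mono) auto
  also have "\<dots> = exp (- 2 * real n)" by (simp flip: exp_add)
  also have "\<dots> \<le> exp (- real n)" by simp
  finally show ?thesis .
qed

text \<open>The histories cost at most \<open>(1 + x)^(3 * n)\<close>, against
  \<open>exp (- x * \<sigma>^2 * n)\<close> from the absent pairs: the exponents are logarithmic and
  linear in \<open>x\<close>.\<close>

lemma stuck_error_le: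
  fixes p \<sigma> x :: real
  assumes "0 \<le> p" "p \<le> 1" "p * real n = x" "0 < \<sigma>" "\<sigma> * real n \<le> real j" "3 * ln (1 + x) + 1 \<le> x * \<sigma>^2"
  shows "(1 + real n * real n * p^2) ^ n * (1 + real n * p) ^ n * (1 - p) ^ (j * j) \<le> exp (- real n)"
proof -
  have x0: "0 \<le> x" using assms(1,3) by auto
  have "x * \<sigma>^2 * real n = p * ((\<sigma> * real n) * (\<sigma> * real n))"
    using assms(3) by (simp add: power2_eq_square)
  also have "\<dots> \<le> p * (real j * real j)" using assms by (intro mult_left_mono mult_mono) auto
  finally have "x * \<sigma>^2 * real n \<le> p * real (j * j)" by simp
  moreover have "(3 * ln (1 + x) + 1) * real n \<le> x * \<sigma>^2 * real n" using assms by (intro mult_right_mono) auto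
  ultimately have 1: "(1 - p) ^ (j * j) \<le> exp (- ((3 * ln (1 + x) + 1) * real n))"
    using assms by (intro power_le_exp) auto
  have "real n * real n * p^2 = x^2" "real n * p = x" using assms(3) by (auto simp: power2_eq_square)
  then have "(1 + real n * real n * p^2) ^ n * (1 + real n * p) ^ n = (1 + x^2) ^ n * (1 + x) ^ n" by simp
  also have "\<dots> \<le> ((1 + x)^2) ^ n * (1 + x) ^ n"
    using x0 by (intro mult_right_mono power_mono) (auto simp: power2_eq_square algebra_simps)
  also have "\<dots> = (exp (ln (1 + x))) ^ (3 * n)"
    using x0 by (simp flip: power_mult power_add)
  also have "\<dots> = exp (3 * ln (1 + x) * real n)"
    by (simp add: exp_of_nat_mult[symmetric] mult_ac)
  finally have 2: "(1 + real n * real n * p^2) ^ n * (1 + real n * p) ^ n \<le> exp (3 * ln (1 + x) * real n)" .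
  have "(1 + real n * real n * p^2) ^ n * (1 + real n * p) ^ n * (1 - p) ^ (j * j) \<le>
      exp (3 * ln (1 + x) * real n) * exp (- ((3 * ln (1 + x) + 1) * real n))"
    using 1 2 assms by (intro mult_mono) auto
  also have "\<dots> = exp (- real n)" by (simp add: algebra_simps flip: exp_add)
  finally show ?thesis .
qed

text \<open>The threshold is a quarter of the expected degree \<open>\<delta> * q * n\<close>:
  \<open>2 ^ l\<close> then consumes half of the exponent \<open>\<delta> * q * n / 2\<close> gained
  from the other factor. The term \<open>q / 2\<close> is the price of rounding
  \<open>g\<close>.\<close>

lemma thinning_error_le:
  fixes q e \<delta> :: real
  assumes "0 \<le> q" "q \<le> 1" "real l \<le> \<delta> * q / 4 * real n" "\<delta> * real n - 1 \<le> real g"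
  shows "2 ^ l * (1 - q / 2) ^ g \<le> exp (q / 2 - \<delta> * q / 4 * real n)"
proof -
  have "q / 2 * (\<delta> * real n - 1) \<le> q / 2 * real g" using assms by (intro mult_left_mono) auto
  then have "(1 - q / 2) ^ g \<le> exp (- (q / 2 * (\<delta> * real n - 1)))" using assms by (intro power_le_exp) auto
  moreover have "(2::real) ^ l \<le> exp (\<delta> * q / 4 * real n)" using assms by (intro two_power_le_exp)
  ultimately have "2 ^ l * (1 - q / 2) ^ g \<le> exp (\<delta> * q / 4 * real n) * exp (- (q / 2 * (\<delta> * real n - 1)))"
    using assms by (intro mult_mono) auto
  also have "\<dots> = exp (q / 2 - \<delta> * q / 4 * real n)" by (simp add: field_simps flip: exp_add)
  finally show ?thesis .
qed

text \<open>In the limit \<open>1 - n / k\<close> is \<open>\<alpha> / (1 + \<alpha>)\<close>. One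
  factor 2 of the 4 absorbs the rounding of \<open>k\<close>, the other is the one in
  \<open>prob_pairs_le\<close>.\<close>

lemma palette_ratio:
  fixes \<alpha> :: real
  assumes "\<alpha> > 0" "2 \<le> \<alpha> * real n" and k: "k = nat \<lfloor>(1 + \<alpha>) * real n\<rfloor>"
  shows "n < k" "2 * (\<alpha> / (4 * (1 + \<alpha>))) \<le> 1 - real n / real k"
proof -
  have kb: "real k \<le> (1 + \<alpha>) * real n" "(1 + \<alpha>) * real n - 1 \<le> real k"
    unfolding k using nat_floor_bounds[of "1 + \<alpha>" n] assms(1) by auto
  then have nk: "real n + \<alpha> * real n / 2 \<le> real k" using assms(2) by (simp add: algebra_simps)
  then have "real n < real k" using assms(2) by linarith
  then show "n < k" by simp
  then have k0: "real k > 0" by simp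
  have "\<alpha> * real k \<le> \<alpha> * ((1 + \<alpha>) * real n)" using kb assms by (intro mult_left_mono) auto
  also have "\<dots> = (1 + \<alpha>) * (\<alpha> * real n)" by simp
  also have "\<dots> \<le> (1 + \<alpha>) * (2 * (real k - real n))" using nk assms by (intro mult_left_mono) auto
  finally have "\<alpha> * real k \<le> 2 * (1 + \<alpha>) * (real k - real n)" by (simp add: algebra_simps)
  then show "2 * (\<alpha> / (4 * (1 + \<alpha>))) \<le> 1 - real n / real k"
    using k0 assms by (simp add: field_simps)
qed

text \<open>Demands of \<open>prob_copy_bound\<close> on its integers: \<open>m\<close> gadgets, a
  branch of \<open>N\<close> to \<open>d * N\<close> vertices, piece size \<open>K\<close>,
  \<open>u\<close> vertices kept back, and joined sets of size \<open>2 * s\<close>.\<close>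

definition admissible :: "nat \<Rightarrow> real \<Rightarrow> real \<Rightarrow> nat \<Rightarrow> nat \<Rightarrow> nat \<Rightarrow> nat \<Rightarrow> nat \<Rightarrow> nat \<Rightarrow> bool" where
  "admissible d e \<kappa> n K s m N u \<longleftrightarrow>
    K \<ge> 1 \<and> s \<ge> 1 \<and> 2 * s \<le> m \<and> N \<ge> 1 \<and> d * N < n \<and>
    2 * (1 + d + d * d) + 2 * (4 * (2 + d + d * d)) * m \<le> N \<and>
    real (d * N + 3 * m + 2 * s) \<le> e * n \<and> 1 + d * K * ((d + 1) * (2 * s)) \<le> u \<and> u + d * N \<le> n \<and>
    9 * real m + 3 \<le> e^3 / 2 * n \<and>
    real n^2 * (1 - \<kappa> / 2) ^ m < (1/2) ^ (2 * s + d * (2 * s) + n div K + 1 + u)"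

lemma eventually_constants:
  fixes e \<kappa> :: real and d :: nat
  assumes e: "0 < e" "e \<le> 1" and d: "d \<ge> 1" and \<kappa>: "\<kappa> = e^3 / 4"
  shows "\<exists>K \<sigma>. 0 < \<sigma> \<and> (\<forall>\<^sub>F n in sequentially. \<exists>m N u s. \<sigma> / 2 * real n \<le> real s \<and>
    admissible d e \<kappa> n K s m N u)"
proof -
  \<comment> \<open>The densities of \<open>N\<close>, \<open>m\<close>, \<open>u\<close>,
    \<open>s\<close> are \<gamma>, \<nu>, \<beta>, \<sigma>. The branch needs enough sites for
    \<open>m\<close> gadgets, so \<nu> is small against \<gamma>; it is small against
    \<open>e^3\<close> so that gadgets block few triples. With this \<beta>, \<open>m\<close>
    gadgets bring the potential down to about \<open>exp (- 8 * \<beta> * n)\<close>, while fewer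
    than \<open>4 * \<beta> * n\<close> services per pair are needed. Then \<open>K\<close> bounds
    the number of full pieces by \<open>\<beta> * n\<close>, and \<sigma> makes the room
    \<open>D * s\<close> for one piece at most \<open>\<beta> * n / 2\<close>.\<close>
  define \<gamma> where "\<gamma> = e / (4 * real d)"
  define C1 where "C1 = real (2 * (1 + d + d * d))"
  define C2 where "C2 = real (2 * (4 * (2 + d + d * d)))"
  define \<nu> where "\<nu> = min (\<gamma> / (2 * C2)) (e^3 / 36)"
  define \<beta> where "\<beta> = \<kappa> * \<nu> / 16"
  define K where "K = nat \<lceil>1 / \<beta>\<rceil>"
  define D where "D = real (d * K * ((d + 1) * 2))"
  define \<sigma> where "\<sigma> = \<beta> / (2 * D)"
  have d1: "real d \<ge> 1" using d by simp
  have C2: "C2 \<ge> 16" unfolding C2_def by simp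
  have \<gamma>: "0 < \<gamma>" "\<gamma> \<le> e / 4" "real d * \<gamma> = e / 4"
    using e d1 by (auto simp: \<gamma>_def field_simps)
  have e3: "0 < e^3" "e^3 \<le> e" "e^3 \<le> 1" using e power_decreasing[of 1 3 e] by auto
  have \<kappa>0: "0 < \<kappa>" "\<kappa> \<le> 1/4" unfolding \<kappa> using e3 by simp_all
  have \<nu>: "0 < \<nu>" "C2 * \<nu> \<le> \<gamma> / 2" "\<nu> \<le> e^3 / 36" "\<nu> \<le> e / 36"
  proof -
    show "0 < \<nu>" using \<gamma> C2 e3 by (auto simp: \<nu>_def)
    have "C2 * \<nu> \<le> C2 * (\<gamma> / (2 * C2))" using C2 by (intro mult_left_mono) (auto simp: \<nu>_def)
    then show "C2 * \<nu> \<le> \<gamma> / 2" using C2 by simp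
    show "\<nu> \<le> e^3 / 36" by (simp add: \<nu>_def)
    then show "\<nu> \<le> e / 36" using e3 by linarith
  qed
  have \<beta>: "0 < \<beta>" "\<beta> \<le> \<nu> / 64" using \<kappa>0 \<nu> by (auto simp: \<beta>_def field_simps)
  have K: "K \<ge> 1" "1 / \<beta> \<le> real K"
  proof -
    show "1 / \<beta> \<le> real K" unfolding K_def using \<beta> by (simp add: of_nat_ceiling)
    moreover have "0 < 1 / \<beta>" using \<beta> by simp
    ultimately have "0 < real K" by linarith
    then show "K \<ge> 1" by simp
  qed
  have D: "D \<ge> 4" "real (d + 1) * 2 \<le> D"
  proof -
    have "1 \<le> d * K" using d K(1) by simp
    then have "1 * ((d + 1) * 2) \<le> d * K * ((d + 1) * 2)" by (intro mult_right_mono) auto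
    then have *: "real ((d + 1) * 2) \<le> D" unfolding D_def of_nat_le_iff by simp
    then show "real (d + 1) * 2 \<le> D" by simp
    then show "D \<ge> 4" using d1 by simp
  qed
  have \<sigma>: "0 < \<sigma>" "D * \<sigma> = \<beta> / 2" "\<sigma> \<le> \<beta> / 8"
  proof -
    show 1: "0 < \<sigma>" "D * \<sigma> = \<beta> / 2" using \<beta> D by (auto simp: \<sigma>_def)
    have "4 * \<sigma> \<le> D * \<sigma>" using D(1) 1 by (intro mult_right_mono) auto
    then show "\<sigma> \<le> \<beta> / 8" using 1 by linarith
  qed
  \<comment> \<open>The spare \<open>4 * \<beta> * n\<close> in the exponent absorbs
    \<open>n^2\<close> and, through \<open>exp (\<kappa> / 2)\<close>, the rounding of
    \<open>m\<close>.\<close>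
  have ev: "\<forall>\<^sub>F n in sequentially. real n^2 * exp (\<kappa> / 2) < exp (4 * \<beta> * real n)"
    using \<beta>(1) by real_asymp
  have "\<forall>\<^sub>F n in sequentially. \<exists>m N u s. \<sigma> / 2 * real n \<le> real s \<and>
    admissible d e \<kappa> n K s m N u"
    using ev eventually_gt_at_top[of 0] eventually_le_linear[OF \<sigma>(1), of 4] eventually_le_linear[OF \<beta>(1), of 8]
      eventually_le_linear[OF \<gamma>(1), of "2 * C1 + 8"] eventually_le_linear[OF e3(1), of 16]
  proof eventually_elim
    case (elim n)
    define m where "m = nat \<lfloor>\<nu> * real n\<rfloor>"
    define N where "N = nat \<lfloor>\<gamma> * real n\<rfloor>"
    define u where "u = nat \<lfloor>\<beta> * real n\<rfloor>"
    define s where "s = nat \<lfloor>\<sigma> * real n\<rfloor>"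
    have n0: "0 < real n" using elim by simp
    have m: "real m \<le> \<nu> * real n" "\<nu> * real n - 1 \<le> real m" unfolding m_def using \<nu> nat_floor_bounds by auto
    have N: "real N \<le> \<gamma> * real n" "\<gamma> * real n - 1 \<le> real N" unfolding N_def using \<gamma> nat_floor_bounds by auto
    have u: "real u \<le> \<beta> * real n" "\<beta> * real n - 1 \<le> real u" unfolding u_def using \<beta> nat_floor_bounds by auto
    have s: "real s \<le> \<sigma> * real n" "\<sigma> * real n - 1 \<le> real s" unfolding s_def using \<sigma> nat_floor_bounds by auto
    have \<sigma>n: "\<sigma> * real n \<le> \<beta> / 8 * real n" and \<beta>n: "\<beta> * real n \<le> \<nu> / 64 * real n"
      and \<nu>n: "\<nu> * real n \<le> e / 36 * real n" and \<nu>n3: "\<nu> * real n \<le> e^3 / 36 * real n"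
      and en: "e * real n \<le> 1 * real n"
      using n0 \<sigma>(3) \<beta>(2) \<nu>(3,4) e(2) by (auto intro!: mult_right_mono)
    have \<gamma>n: "real d * (\<gamma> * real n) = e / 4 * real n" using \<gamma>(3) by simp
    have dN: "real d * real N \<le> e / 4 * real n" using mult_left_mono[OF N(1), of "real d"] \<gamma>n by simp
    have C2m: "C2 * real m \<le> \<gamma> / 2 * real n"
    proof -
      have "C2 * real m \<le> C2 * (\<nu> * real n)" using m(1) C2 by (intro mult_left_mono) auto
      also have "\<dots> = (C2 * \<nu>) * real n" by simp
      also have "\<dots> \<le> \<gamma> / 2 * real n" using \<nu>(2) n0 by (intro mult_right_mono) auto
      finally show ?thesis .
    qed
    have Ds: "D * real s \<le> \<beta> / 2 * real n"
    proof -
      have "D * real s \<le> D * (\<sigma> * real n)" using s(1) D by (intro mult_left_mono) auto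
      also have "\<dots> = (D * \<sigma>) * real n" by simp
      finally show ?thesis using \<sigma>(2) by simp
    qed
    have "\<sigma> / 2 * real n \<le> real s" using s(2) elim(3) by simp
    moreover have "s \<ge> 1"
    proof -
      have "1 \<le> real s" using s(2) elim(3) by simp
      then show ?thesis by simp
    qed
    moreover have "2 * s \<le> m"
    proof -
      have "real (2 * s) \<le> real m" using s(1) m(2) \<sigma>n \<beta>n elim(4) by simp
      then show ?thesis by (simp only: of_nat_le_iff)
    qed
    moreover have "C1 + C2 * real m \<le> real N" using C2m N(2) elim(5) by simp
    then have CN: "2 * (1 + d + d * d) + 2 * (4 * (2 + d + d * d)) * m \<le> N"
      unfolding C1_def C2_def by (simp only: of_nat_le_iff flip: of_nat_mult of_nat_add)
    moreover from this have "N \<ge> 1" by simp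
    moreover have "d * N < n"
    proof -
      have "real (d * N) < real n" unfolding of_nat_mult using dN en n0 by linarith
      then show ?thesis by (simp only: of_nat_less_iff)
    qed
    moreover have "real (d * N + 3 * m + 2 * s) \<le> e * n"
      using dN m(1) s(1) \<sigma>n \<beta>n \<nu>n by simp
    moreover have "1 + d * K * ((d + 1) * (2 * s)) \<le> u"
    proof -
      have "real (1 + d * K * ((d + 1) * (2 * s))) = 1 + D * real s" by (simp add: D_def algebra_simps)
      also have "\<dots> \<le> real u" using Ds u(2) elim(4) by simp
      finally show ?thesis by (simp only: of_nat_le_iff)
    qed
    moreover have "u + d * N \<le> n"
    proof -
      have "real (u + d * N) \<le> real n"
        unfolding of_nat_add of_nat_mult using dN u(1) \<beta>n \<nu>n en n0 by linarith
      then show ?thesis by (simp only: of_nat_le_iff)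
    qed
    moreover have "9 * real m + 3 \<le> e^3 / 2 * n" using m(1) \<nu>n3 elim(6) by simp
    moreover have "real n^2 * (1 - \<kappa> / 2) ^ m < (1/2) ^ (2 * s + d * (2 * s) + n div K + 1 + u)"
    proof -
      have "\<kappa> / 2 * (\<nu> * real n - 1) \<le> \<kappa> / 2 * real m" using m(2) \<kappa>0 by (intro mult_left_mono) auto
      then have "(1 - \<kappa> / 2) ^ m \<le> exp (- (\<kappa> / 2 * (\<nu> * real n - 1)))" using \<kappa>0 by (intro power_le_exp) auto
      also have "\<kappa> / 2 * (\<nu> * real n - 1) = 8 * \<beta> * real n - \<kappa> / 2" by (simp add: \<beta>_def algebra_simps)
      finally have "real n^2 * (1 - \<kappa> / 2) ^ m \<le> real n^2 * exp (- (8 * \<beta> * real n - \<kappa> / 2))" by (intro mult_left_mono) auto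
      also have "\<dots> = real n^2 * exp (\<kappa> / 2) * exp (- (8 * \<beta> * real n))"
      proof -
        have "exp (- (8 * \<beta> * real n - \<kappa> / 2)) = exp (\<kappa> / 2) * exp (- (8 * \<beta> * real n))" by (simp flip: exp_add)
        then show ?thesis by simp
      qed
      also have "\<dots> < exp (4 * \<beta> * real n) * exp (- (8 * \<beta> * real n))"
        using elim(1) by (intro mult_strict_right_mono) auto
      also have "\<dots> = exp (- (4 * \<beta> * real n))" by (simp flip: exp_add)
      also have "\<dots> \<le> (1/2) ^ (2 * s + d * (2 * s) + n div K + 1 + u)"
      proof (rule half_power_ge_exp)
        have "real (2 * s + d * (2 * s)) = (real (d + 1) * 2) * real s" by (simp add: algebra_simps)
        also have "\<dots> \<le> D * real s" using D(2) by (intro mult_right_mono) auto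
        finally have 1: "real (2 * s + d * (2 * s)) \<le> \<beta> / 2 * real n" using Ds by linarith
        have "1 / real K \<le> \<beta>" using K \<beta> by (simp add: field_simps)
        then have "real n * (1 / real K) \<le> real n * \<beta>" using n0 by (intro mult_left_mono) auto
        moreover have "real (n div K) \<le> real n / real K" by (simp add: of_nat_div_le_of_nat)
        ultimately have 2: "real (n div K) \<le> \<beta> * real n" by (simp add: mult.commute)
        have "real (2 * s + d * (2 * s) + n div K + 1 + u) = real (2 * s + d * (2 * s)) + real (n div K) + 1 + real u"
          by simp
        then show "real (2 * s + d * (2 * s) + n div K + 1 + u) \<le> 4 * \<beta> * real n"
          using 1 2 u(1) elim(4) by linarith
      qed
      finally show ?thesis .
    qed
    ultimately show ?case using K(1) unfolding admissible_def by blast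
  qed
  then show ?thesis using \<sigma>(1) by blast
qed

theorem theorem1p3:
  fixes \<delta> \<alpha> :: real and d :: nat
    and p f :: "nat \<Rightarrow> real"
    and T :: "nat \<Rightarrow> 'a ugraph"
    and G :: "nat \<Rightarrow> nat ugraph"
  assumes "\<delta> > 0" and "\<alpha> > 0" and "d \<ge> 2"
    and "filterlim f at_top sequentially"
    and "\<forall>\<^sub>F n in sequentially. p n = f n / real n"
    and "\<forall>\<^sub>F n in sequentially. 0 \<le> p n \<and> p n \<le> 1"
    and "\<forall>\<^sub>F n in sequentially. is_tree (T n) \<and> card (verts (T n)) = n \<and> max_degree (T n) \<le> d"
    and "\<forall>\<^sub>F n in sequentially.
           simple_graph (G n) \<and> verts (G n) = {1..n} \<and> real (min_degree (G n)) \<ge> \<delta> * real n"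
  shows "(\<lambda>n. measure_pmf.prob
            (coloured_perturbed_graph (G n) n (p n) (nat \<lfloor>(1 + \<alpha>) * real n\<rfloor>))
            {(\<Gamma>, \<psi>). has_spanning_rainbow_copy \<Gamma> \<psi> (T n)}) \<longlonglongrightarrow> 1"
proof -
  \<comment> \<open>The cap at 1 yields \<open>e \<le> 1\<close>, as
    \<open>eventually_constants\<close> asks.\<close>
  define \<delta>0 where "\<delta>0 = min \<delta> 1"
  define q where "q = \<alpha> / (4 * (1 + \<alpha>))"
  \<comment> \<open>The degree density of the thinned seed graph: a quarter of the expected one, as
    in \<open>thinning_error_le\<close>.\<close>
  define e where "e = \<delta>0 * q / 4"
  define \<kappa> where "\<kappa> = e^3 / 4"
  have \<delta>0: "0 < \<delta>0" "\<delta>0 \<le> 1" "\<delta>0 \<le> \<delta>" using assms(1) by (auto simp: \<delta>0_def)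
  have q: "0 < q" "q \<le> 1" using assms(2) by (auto simp: q_def field_simps)
  have e: "0 < e" "e \<le> 1" using \<delta>0 q mult_le_one[of \<delta>0 q] by (auto simp: e_def)
  have \<kappa>: "0 < \<kappa>" using e by (simp add: \<kappa>_def)
  have "d \<ge> 1" using assms(3) by simp
  then obtain K \<sigma> where \<sigma>: "0 < \<sigma>" and num: "\<forall>\<^sub>F n in sequentially. \<exists>m N u s. \<sigma> / 2 * real n \<le> real s \<and>
    admissible d e \<kappa> n K s m N u"
    using eventually_constants[OF e _ \<kappa>_def] by blast
  define err where "err n = real n * exp (q / 2 - \<delta>0 * q / 4 * real n) + 2 * exp (- real n)" for n :: nat
  let ?P = "\<lambda>n. measure_pmf.prob (coloured_perturbed_graph (G n) n (p n) (nat \<lfloor>(1 + \<alpha>) * real n\<rfloor>))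
            {(\<Gamma>, \<psi>). has_spanning_rainbow_copy \<Gamma> \<psi> (T n)}"
  \<comment> \<open>Here \<open>x\<close> stands for \<open>f n * q\<close>, which is
    \<open>n p\<close> after the loss of the factor \<open>q\<close>. Both error terms only ask that
    it exceed a constant, and this is where the divergence of \<open>f\<close> enters.\<close>
  have "\<forall>\<^sub>F x in at_top. 4 \<le> x * (\<sigma> / 2)^2"
    using \<sigma> by real_asymp
  moreover have "\<forall>\<^sub>F x in at_top. 3 * ln (1 + x) + 1 \<le> x * (\<kappa> / 16)^2"
    using \<kappa> by real_asymp
  ultimately have ev_x: "\<forall>\<^sub>F x in at_top. 4 \<le> x * (\<sigma> / 2)^2 \<and> 3 * ln (1 + x) + 1 \<le> x * (\<kappa> / 16)^2"
    by eventually_elim simp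
  have "filterlim (\<lambda>n. f n * q) at_top sequentially"
    using filterlim_at_top_mult_tendsto_pos[OF tendsto_const[of q] q(1) assms(4)] .
  from eventually_compose_filterlim[OF ev_x this]
  have ev_f: "\<forall>\<^sub>F n in sequentially. 4 \<le> f n * q * (\<sigma> / 2)^2 \<and> 3 * ln (1 + f n * q) + 1 \<le> f n * q * (\<kappa> / 16)^2" .
  have lower: "\<forall>\<^sub>F n in sequentially. 1 - err n \<le> ?P n"
    using num ev_f assms(5-8) eventually_gt_at_top[of 0] eventually_le_linear[OF \<kappa>, of 16]
      eventually_le_linear[OF assms(2), of 2]
  proof eventually_elim
    case (elim n)
    then obtain m N u s where s: "\<sigma> / 2 * real n \<le> real s" and
      *: "K \<ge> 1" "s \<ge> 1" "2 * s \<le> m" "N \<ge> 1" "d * N < n"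
      "2 * (1 + d + d * d) + 2 * (4 * (2 + d + d * d)) * m \<le> N"
      "real (d * N + 3 * m + 2 * s) \<le> e * n" "1 + d * K * ((d + 1) * (2 * s)) \<le> u" "u + d * N \<le> n"
      "9 * real m + 3 \<le> e^3 / 2 * n"
      "real n^2 * (1 - \<kappa> / 2) ^ m < (1/2) ^ (2 * s + d * (2 * s) + n div K + 1 + u)"
      unfolding admissible_def by blast
    define k where "k = nat \<lfloor>(1 + \<alpha>) * real n\<rfloor>"
    define l where "l = nat \<lfloor>e * real n\<rfloor>"
    define g where "g = nat \<lfloor>\<delta>0 * real n\<rfloor>"
    \<comment> \<open>The largest fan size allowed by \<open>exists_fan\<close>; rounding costs at
      most half of it, whence \<open>\<kappa> / 16\<close> in the condition on
      \<open>x\<close>.\<close>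
    define j where "j = nat \<lfloor>\<kappa> / 8 * real n\<rfloor>"
    have l: "real l \<le> e * real n" "e * real n - 1 \<le> real l" unfolding l_def using e nat_floor_bounds by auto
    have g: "real g \<le> \<delta>0 * real n" "\<delta>0 * real n - 1 \<le> real g" unfolding g_def using \<delta>0 nat_floor_bounds by auto
    have j: "real j \<le> \<kappa> / 8 * real n" "\<kappa> / 8 * real n - 1 \<le> real j" unfolding j_def using \<kappa> nat_floor_bounds[of "\<kappa> / 8" n] by auto
    have "1 \<le> real j" using j(2) elim(8) by simp
    then have j1: "j \<ge> 1" by simp
    have kq: "n < k" "2 * q \<le> 1 - real n / real k"
      using palette_ratio[OF assms(2) elim(9) k_def] by (auto simp: q_def)
    have p: "0 \<le> p n" "p n \<le> 1" and x: "p n * q * real n = f n * q" using elim by auto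
    have pq: "0 \<le> p n * q" "p n * q \<le> 1" using p q mult_le_one[of "p n" q] by auto
    have degree: "g \<le> degree (G n) v" if "v \<in> {1..n}" for v
    proof -
      have "real g \<le> real (min_degree (G n))"
        using g(1) elim mult_right_mono[OF \<delta>0(3), of "real n"] by linarith
      also have "min_degree (G n) \<le> degree (G n) v"
        unfolding min_degree_def using that elim by (intro Min_le) auto
      finally show ?thesis by simp
    qed
    have T: "is_tree (T n)" "card (verts (T n)) = n" "max_degree (T n) \<le> d"
      and G: "simple_graph (G n)" "verts (G n) = {1..n}" using elim by auto
    have el: "e * n \<le> real l + 1" and jle: "real j \<le> \<kappa> * n / 8" using l j by auto
    have "1 - (n * (2 ^ l * (1 - q / 2) ^ g) + (4 ^ n * (1 - p n * q) ^ (s * s) +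
        (1 + real n * real n * (p n * q)^2) ^ n * (1 + n * (p n * q)) ^ n * (1 - p n * q) ^ (j * j))) \<le> ?P n"
      unfolding k_def[symmetric]
      by (rule prob_copy_bound[OF T G _ p kq(1) _ kq(2) e el \<kappa>_def \<open>d \<ge> 1\<close> *(1-10) j1 jle *(11)])
        (use degree q in auto)
    moreover have "2 ^ l * (1 - q / 2) ^ g \<le> exp (q / 2 - \<delta>0 * q / 4 * real n)"
      using q l g by (intro thinning_error_le) (auto simp: e_def)
    then have "n * (2 ^ l * (1 - q / 2) ^ g) \<le> n * exp (q / 2 - \<delta>0 * q / 4 * real n)"
      by (intro mult_left_mono) auto
    moreover have "4 ^ n * (1 - p n * q) ^ (s * s) \<le> exp (- real n)"
      using elim(2) by (intro join_error_le[OF pq x \<sigma> s]) simp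
    moreover have "(1 + real n * real n * (p n * q)^2) ^ n * (1 + n * (p n * q)) ^ n * (1 - p n * q) ^ (j * j) \<le> exp (- real n)"
      using \<kappa> j(2) elim(2,8) by (intro stuck_error_le[OF pq x, where \<sigma> = "\<kappa> / 16"]) auto
    ultimately show ?case unfolding err_def by linarith
  qed
  have "err \<longlonglongrightarrow> 0"
  proof -
    define b where "b = \<delta>0 * q / 4"
    have "b > 0" using q(1) \<delta>0(1) by (simp add: b_def)
    then have 1: "(\<lambda>n. real n * exp (- (b * real n))) \<longlonglongrightarrow> 0" by real_asymp
    have 2: "(\<lambda>n. exp (- real n)) \<longlonglongrightarrow> 0" by real_asymp
    have "(\<lambda>n. exp (q / 2) * (real n * exp (- (b * real n))) + 2 * exp (- real n)) \<longlonglongrightarrow> exp (q / 2) * 0 + 2 * 0"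
      by (intro tendsto_add tendsto_mult tendsto_const 1 2)
    moreover have "err n = exp (q / 2) * (real n * exp (- (b * real n))) + 2 * exp (- real n)" for n
    proof -
      have "exp (q / 2 - \<delta>0 * q / 4 * real n) = exp (q / 2) * exp (- (b * real n))"
        by (simp add: b_def flip: exp_add)
      then show ?thesis by (simp add: err_def)
    qed
    then have "err = (\<lambda>n. exp (q / 2) * (real n * exp (- (b * real n))) + 2 * exp (- real n))" by blast
    ultimately show ?thesis by simp
  qed
  then have "(\<lambda>n. 1 - err n) \<longlonglongrightarrow> 1 - 0" by (intro tendsto_diff tendsto_const)
  then have lim: "(\<lambda>n. 1 - err n) \<longlonglongrightarrow> 1" by simp
  show ?thesis
    by (rule tendsto_sandwich[OF lower _ lim tendsto_const]) simp
qed

end
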